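(* Let $n\ge 1$ and let $G$ be a connected Lie subgroup of $Gl(n,\mathbb{R})$ which acts irreducibly on $\mathbb{R}^n$. Then $G$ is closed in $Gl(n,\mathbb{R})$.
   Context: "Lie subgroup" is meant in the weak sense of an immersed (not necessarily embedded) Lie subgroup: $G$ is a subgroup that carries a Lie group structure for which the inclusion into $Gl(n,\mathbb{R})$ is an injective immersion; connectedness refers to this structure. "Acts irreducibly" means that the only $G$-invariant real linear subspaces of $\mathbb{R}^n$ are $\{0\}$ and $\mathbb{R}^n$. *)

theory Defs
  imports "HOL-Analysis.Analysis" "HOL-Algebra.Group"
begin

(* Only meant for open S: there the Frechet derivative is unique and determined by the values of
   f on S. For finite-dimensional 'a, differentiating along every direction v and asking for
   continuity at every stage is the usual C^k condition on iterated partial derivatives. *)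
primrec Ck_on :: "nat \<Rightarrow> ('a::real_normed_vector \<Rightarrow> 'b::real_normed_vector) \<Rightarrow> 'a set \<Rightarrow> bool" where
  "Ck_on 0 f S \<longleftrightarrow> continuous_on S f"
| "Ck_on (Suc k) f S \<longleftrightarrow>
     (\<forall>x\<in>S. f differentiable (at x)) \<and>
     (\<forall>v. Ck_on k (\<lambda>x. frechet_derivative f (at x) v) S)"

definition smooth_on :: "('a::real_normed_vector \<Rightarrow> 'b::real_normed_vector) \<Rightarrow> 'a set \<Rightarrow> bool" where
  "smooth_on f S \<longleftrightarrow> (\<forall>k. Ck_on k f S)"

type_synonym ('a, 'e) chart = "'a set \<times> ('a \<Rightarrow> 'e)"

definition is_chart :: "'a topology \<Rightarrow> ('a, 'e::real_normed_vector) chart \<Rightarrow> bool" where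
  "is_chart T c \<longleftrightarrow> (case c of (U, \<phi>) \<Rightarrow>
     openin T U \<and> open (\<phi> ` U) \<and>
     homeomorphic_map (subtopology T U) (top_of_set (\<phi> ` U)) \<phi>)"

(* The model space R^k is an arbitrary finite-dimensional normed space, so that, unlike with
   class euclidean_space or types real^'k, dimension 0 is not excluded. The manifold topology T
   lives on topspace T and is unrelated to any topology the type 'a may have. *)
definition smooth_manifold :: "'a topology \<Rightarrow> ('a, 'e::real_normed_vector) chart set \<Rightarrow> bool" where
  "smooth_manifold T A \<longleftrightarrow>
     (\<exists>B::'e set. finite B \<and> span B = UNIV) \<and>
     Hausdorff_space T \<and> second_countable T \<and>
     (\<forall>c\<in>A. is_chart T c) \<and>
     (\<Union>(U, \<phi>)\<in>A. U) = topspace T \<and>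
     (\<forall>(U, \<phi>)\<in>A. \<forall>(V, \<psi>)\<in>A. smooth_on (\<psi> \<circ> inv_into U \<phi>) (\<phi> ` (U \<inter> V)))"

definition smooth_map ::
  "'a topology \<Rightarrow> ('a, 'e::real_normed_vector) chart set \<Rightarrow>
   'b topology \<Rightarrow> ('b, 'f::real_normed_vector) chart set \<Rightarrow> ('a \<Rightarrow> 'b) \<Rightarrow> bool" where
  "smooth_map T A T' A' f \<longleftrightarrow> continuous_map T T' f \<and>
     (\<forall>(U, \<phi>)\<in>A. \<forall>(V, \<psi>)\<in>A'. smooth_on (\<psi> \<circ> f \<circ> inv_into U \<phi>) (\<phi> ` (U \<inter> f -` V)))"

definition immersion ::
  "'a topology \<Rightarrow> ('a, 'e::real_normed_vector) chart set \<Rightarrow>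
   'b topology \<Rightarrow> ('b, 'f::real_normed_vector) chart set \<Rightarrow> ('a \<Rightarrow> 'b) \<Rightarrow> bool" where
  "immersion T A T' A' f \<longleftrightarrow> smooth_map T A T' A' f \<and>
     (\<forall>(U, \<phi>)\<in>A. \<forall>(V, \<psi>)\<in>A'. \<forall>p \<in> U \<inter> f -` V.
        inj (frechet_derivative (\<psi> \<circ> f \<circ> inv_into U \<phi>) (at (\<phi> p))))"

definition prod_atlas ::
  "('a, 'e) chart set \<Rightarrow> ('b, 'f) chart set \<Rightarrow> ('a \<times> 'b, 'e \<times> 'f) chart set" where
  "prod_atlas A B = {(U \<times> V, map_prod \<phi> \<psi>) | U \<phi> V \<psi>. (U, \<phi>) \<in> A \<and> (V, \<psi>) \<in> B}"

definition lie_group ::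
  "('a, 'm) monoid_scheme \<Rightarrow> 'a topology \<Rightarrow> ('a, 'e::real_normed_vector) chart set \<Rightarrow> bool" where
  "lie_group H T A \<longleftrightarrow>
     group H \<and> topspace T = carrier H \<and> smooth_manifold T A \<and>
     smooth_map (prod_topology T T) (prod_atlas A A) T A (\<lambda>(x, y). x \<otimes>\<^bsub>H\<^esub> y) \<and>
     smooth_map T A T A (\<lambda>x. inv\<^bsub>H\<^esub> x)"

definition GL :: "(real^'n^'n) monoid" where
  "GL = \<lparr>carrier = {M. invertible M}, mult = (**), one = mat 1\<rparr>"

lemma group_GL: "group (GL :: (real^'n^'n) monoid)"
proof (rule groupI)
  fix M :: "real^'n^'n"
  assume "M \<in> carrier GL"
  then obtain N where "M ** N = mat 1" "N ** M = mat 1"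
    by (auto simp: GL_def invertible_def)
  then show "\<exists>N\<in>carrier GL. N \<otimes>\<^bsub>GL\<^esub> M = \<one>\<^bsub>GL\<^esub>"
    by (auto simp: GL_def invertible_def)
qed (auto simp: GL_def invertible_mult matrix_mul_assoc invertible_def[of "mat 1"])

(* GL as a manifold: the open subset of invertible matrices, with the identity as its chart *)
definition GL_topology :: "(real^'n^'n) topology" where
  "GL_topology = top_of_set (carrier GL)"

definition GL_atlas :: "(real^'n^'n, real^'n^'n) chart set" where
  "GL_atlas = {(carrier GL, id)}"

(* Immersed, not necessarily embedded: the topology T of the Lie group structure may be strictly
   finer than the subspace topology of G. *)
definition lie_subgroup_GL ::
  "(real^'n^'n) set \<Rightarrow> (real^'n^'n) topology \<Rightarrow>
   (real^'n^'n, 'e::real_normed_vector) chart set \<Rightarrow> bool" where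
  "lie_subgroup_GL G T A \<longleftrightarrow>
     subgroup G GL \<and> lie_group (GL\<lparr>carrier := G\<rparr>) T A \<and>
     immersion T A GL_topology GL_atlas (\<lambda>M. M)"

definition acts_irreducibly :: "(real^'n^'n) set \<Rightarrow> bool" where
  "acts_irreducibly G \<longleftrightarrow>
     (\<forall>V::(real^'n) set. subspace V \<and> (\<forall>M\<in>G. \<forall>v\<in>V. M *v v \<in> V) \<longrightarrow> V = {0} \<or> V = UNIV)"

end

theory Submission
  imports Defs "HOL-Computational_Algebra.Fundamental_Theorem_Algebra"
    "HOL-Computational_Algebra.Polynomial_Factorial" "HOL-Computational_Algebra.Field_as_Ring"
begin

text \<open>
  Let \<open>g\<close> be the tangent space of \<open>G\<close> at the identity. Since \<open>G\<close> is connected, a function on matrices whose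
  derivative at every \<open>x\<close> in \<open>G\<close> vanishes on \<open>x g\<close> is constant on \<open>G\<close> (\<open>constant_on_G\<close>), and by continuity it
  is constant on the closure of \<open>G\<close> near the identity. If \<open>G\<close> is not closed, then a transversal to \<open>G\<close> at the
  identity (\<open>transversal_slice\<close>) contains points \<open>1 + Y k\<close> of the closure with \<open>Y k \<noteq> 0\<close> and
  \<open>Y k \<longlonglongrightarrow> 0\<close>. A limit \<open>y\<close> of the normalised \<open>Y k\<close> lies outside \<open>g\<close>, and the derivative at the identity in
  the direction \<open>y\<close> of every function as above vanishes. Functions of three kinds lead to a contradiction.

  The functions that send \<open>a\<close> to \<open>a X a\<^sup>-\<^sup>1\<close> modulo \<open>[g, g]\<close>, with \<open>X\<close> in \<open>g\<close>, show that \<open>[y, g]\<close> is contained in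
  \<open>[g, g]\<close> (\<open>Ad_modulo_subspace\<close>). So \<open>h = g + \<real> y\<close> is a Lie algebra with \<open>[h, h]\<close> contained in \<open>[g, g]\<close>.
  The same functions with \<open>X = y\<close> show that \<open>G\<close> normalises \<open>h\<close>.

  As \<open>G\<close> acts irreducibly, \<open>h\<close> is the sum of its centre and \<open>[h, h]\<close> (\<open>reductive_decomposition\<close>): the
  radical of the trace form on \<open>[h, h]\<close> consists of nilpotent matrices by Cartan's criterion
  (\<open>cartan_nilpotent\<close>), these have a common kernel by Engel's theorem (\<open>engel\<close>), and this kernel is
  invariant under \<open>G\<close>. So \<open>y\<close> differs from an element of \<open>[g, g]\<close> by a central element \<open>\<zeta>\<close> of \<open>h\<close> outside \<open>g\<close>.

  The functions that send \<open>a\<close> to \<open>a \<zeta> a\<^sup>-\<^sup>1\<close> show that the centre of \<open>h\<close> commutes with \<open>G\<close>. By Schur's lemma it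
  is a real subspace of a field isomorphic to \<open>\<real>\<close> or to the complex numbers, acting by scalars on a complex
  subspace that is invariant under \<open>G\<close> (\<open>commuting_family_eigenprojection\<close>). The trace on this subspace
  vanishes on \<open>[g, g]\<close> and is injective on the centre. As \<open>\<zeta>\<close> is not in \<open>g\<close>, the traces of \<open>g\<close> lie on a
  line \<open>\<real> c\<close> that does not contain the trace of \<open>\<zeta>\<close>, which is also the trace of \<open>y\<close>. So the determinant on this
  subspace maps \<open>G\<close> into the one-parameter group generated by \<open>c\<close>. Such a group is closed in the nonzero
  complex numbers: it is cut out infinitesimally by a homomorphism \<open>\<bar>w\<bar>\<^sup>\<alpha> w\<^sup>k\<close>
  (\<open>log_power_with_kernel\<close>). The composition of the determinant with this homomorphism is the last function;
  its derivative in the direction \<open>y\<close> does not vanish.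
\<close>

section \<open>Matrix algebra\<close>

text \<open>The vector space structure on the type of complex matrices is the real one; this is multiplication
  by a scalar from the ring of the entries.\<close>

definition scl :: "'a::comm_ring_1 \<Rightarrow> 'a^'n^'n \<Rightarrow> 'a^'n^'n" where
  "scl c M = (\<chi> i j. c * M $ i $ j)"

lemma mat_mul_add_right: "((B :: 'a::comm_ring_1^'n^'n) + C) ** A = B ** A + C ** A"
  by (simp add: matrix_matrix_mult_def vec_eq_iff sum.distrib algebra_simps)

lemma mat_mul_diff_right: "((B :: 'a::comm_ring_1^'n^'n) - C) ** A = B ** A - C ** A"
  by (simp add: matrix_matrix_mult_def vec_eq_iff sum_subtractf algebra_simps)

lemma mat_mul_diff_left: "A ** ((B :: 'a::comm_ring_1^'n^'n) - C) = A ** B - A ** C"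
  by (simp add: matrix_matrix_mult_def vec_eq_iff sum_subtractf algebra_simps)

lemma mat_mul_minus_left: "A ** (- (B :: 'a::comm_ring_1^'n^'n)) = - (A ** B)"
  by (simp add: matrix_matrix_mult_def vec_eq_iff sum_negf)

lemma mat_mul_minus_right: "(- (B :: 'a::comm_ring_1^'n^'n)) ** A = - (B ** A)"
  by (simp add: matrix_matrix_mult_def vec_eq_iff sum_negf)

lemma mat_mul_zero [simp]:
  "(0 :: 'a::comm_ring_1^'n^'n) ** A = 0" "A ** (0 :: 'a::comm_ring_1^'n^'n) = 0"
  by (simp_all add: matrix_matrix_mult_def vec_eq_iff)

lemma mat_mul_scl:
  "scl c A ** B = scl c (A ** B)" "A ** scl c B = scl c (A ** B)"
  by (simp_all add: matrix_matrix_mult_def vec_eq_iff scl_def sum_distrib_left algebra_simps)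

lemma scl_simps [simp]: "scl 1 A = A" "scl 0 A = 0" "scl c 0 = 0" "scl a (scl b A) = scl (a * b) A"
  by (simp_all add: scl_def vec_eq_iff algebra_simps)

lemma scl_add: "scl c (A + B) = scl c A + scl c B" "scl c (A - B) = scl c A - scl c B"
  "scl (a + b) A = scl a A + scl b A" "scl (a - b) A = scl a A - scl b A"
  "scl c (- A) = - scl c A" "scl (- c) A = - scl c A"
  by (simp_all add: scl_def vec_eq_iff algebra_simps)

lemma mat_mul_scaleR:
  "(r *\<^sub>R (A :: real^'n^'n)) ** B = r *\<^sub>R (A ** B)" "A ** (r *\<^sub>R (B :: real^'n^'n)) = r *\<^sub>R (A ** B)"
  by (simp_all add: matrix_matrix_mult_def vec_eq_iff sum_distrib_left algebra_simps)

lemmas mat_algebra = matrix_add_ldistrib mat_mul_add_right mat_mul_diff_right mat_mul_diff_left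
  mat_mul_minus_left mat_mul_minus_right mat_mul_scl mat_mul_scaleR
  matrix_mul_assoc [symmetric] scl_add

lemma mat_mul_sum_left: "A ** (\<Sum>i\<in>I. f i) = (\<Sum>i\<in>I. A ** (f i :: 'a::comm_ring_1^'n^'n))"
  by (induction I rule: infinite_finite_induct) (simp_all add: mat_algebra)

lemma mat_mul_sum_right: "(\<Sum>i\<in>I. f i) ** A = (\<Sum>i\<in>I. (f i :: 'a::comm_ring_1^'n^'n) ** A)"
  by (induction I rule: infinite_finite_induct) (simp_all add: mat_algebra)

lemma scl_sum: "scl c (\<Sum>i\<in>I. f i) = (\<Sum>i\<in>I. scl c (f i))"
  by (induction I rule: infinite_finite_induct) (simp_all add: scl_add)

lemma trace_scl: "trace (scl c A) = c * trace A"
  by (simp add: trace_def scl_def sum_distrib_left)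

lemma trace_zero [simp]: "trace (0 :: 'a::comm_ring_1^'n^'n) = 0"
  by (simp add: trace_def)

lemma trace_sum: "trace (\<Sum>i\<in>I. f i) = (\<Sum>i\<in>I. trace (f i :: 'a::comm_ring_1^'n^'n))"
  by (induction I rule: infinite_finite_induct) (simp_all add: trace_add)

primrec mpow :: "'a::comm_ring_1^'n^'n \<Rightarrow> nat \<Rightarrow> 'a^'n^'n" where
  "mpow A 0 = mat 1"
| "mpow A (Suc k) = A ** mpow A k"

lemma mpow_commute: "A ** B = B ** A \<Longrightarrow> mpow A k ** B = B ** mpow A k"
proof (induction k)
  case (Suc k)
  then show ?case by (simp add: mat_algebra) (simp add: matrix_mul_assoc)
qed simp

lemma mpow_Suc2: "mpow A (Suc k) = mpow A k ** A"
  by (simp add: mpow_commute)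

lemma mpow_add: "mpow A (j + k) = mpow A j ** mpow A k"
  by (induction j) (simp_all add: mat_algebra)

definition nilpotent :: "'a::comm_ring_1^'n^'n \<Rightarrow> bool" where
  "nilpotent A \<longleftrightarrow> (\<exists>k. mpow A k = 0)"

abbreviation bracket :: "'a::comm_ring_1^'n^'n \<Rightarrow> 'a^'n^'n \<Rightarrow> 'a^'n^'n" where
  "bracket A B \<equiv> A ** B - B ** A"

text \<open>Invariance of the trace form: every orthogonality argument for Lie algebras below moves a
  bracket from one factor to the other in this way.\<close>

lemma trace_bracket_cyclic:
  fixes A B C :: "'a::comm_ring_1^'n^'n"
  shows "trace (bracket A B ** C) = trace (A ** bracket B C)"
proof -
  have "trace (B ** A ** C) = trace (A ** C ** B)"
    using trace_mul_sym[of B "A ** C"] by (simp add: mat_algebra)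
  then show ?thesis by (simp add: mat_algebra trace_sub)
qed

section \<open>Polynomials in a matrix\<close>

text \<open>The Horner scheme for the matrix product; the operations \<open>*\<close> and \<open>^\<close> of this type are entrywise.\<close>

definition peval :: "'a::comm_ring_1 poly \<Rightarrow> 'a^'n^'n \<Rightarrow> 'a^'n^'n" where
  "peval p A = fold_coeffs (\<lambda>a X. mat a + A ** X) p 0"

lemma mat_0 [simp]: "mat 0 = (0 :: 'a::comm_ring_1^'n^'n)"
  by (simp add: mat_def vec_eq_iff)

lemma mat_add: "mat (a + b) = (mat a + mat b :: 'a::comm_ring_1^'n^'n)"
  by (simp add: mat_def vec_eq_iff)

lemma mat_mul_mat: "mat c ** A = scl c A"
proof -
  have "mat c = scl c (mat 1 :: 'a^'n^'n)" by (simp add: mat_def scl_def vec_eq_iff)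
  then show ?thesis by (metis mat_mul_scl(1) matrix_mul_lid)
qed

lemma mat_eq_scl: "mat c = scl c (mat 1)"
  using mat_mul_mat[of c "mat 1"] by simp

lemma peval_0 [simp]: "peval 0 A = 0"
  by (simp add: peval_def)

lemma peval_pCons [simp]: "peval (pCons a p) A = mat a + A ** peval p A"
  by (cases "p = 0 \<and> a = 0") (auto simp: peval_def)

lemma peval_1 [simp]: "peval 1 A = mat 1"
  by (simp add: one_pCons)

lemma peval_add: "peval (p + q) A = peval p A + peval q A"
  by (induction p q rule: poly_induct2) (simp_all add: mat_algebra mat_add)

lemma peval_smult: "peval (smult c p) A = scl c (peval p A)"
proof (induction p)
  case (pCons a p)
  have "mat (c * a) = scl c (mat a)" by (simp add: mat_def scl_def vec_eq_iff)
  with pCons show ?case by (simp add: mat_algebra)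
qed simp

lemma peval_mult: "peval (p * q) A = peval p A ** peval q A"
  by (induction p) (simp_all add: peval_add peval_smult mat_algebra mat_mul_mat)

lemma peval_sum: "peval (\<Sum>i\<in>I. f i) A = (\<Sum>i\<in>I. peval (f i) A)"
  by (induction I rule: infinite_finite_induct) (simp_all add: peval_add)

lemma peval_power: "peval (p ^ k) A = mpow (peval p A) k"
  by (induction k) (simp_all add: peval_mult)

lemma peval_linear: "peval [:-l, 1:] A = A - scl l (mat 1)"
  by (simp add: mat_eq_scl[of "-l"] scl_add)

lemma peval_commute: "peval p A ** peval q A = peval q A ** peval p A"
  by (metis peval_mult mult.commute)

section \<open>Primary decomposition of a complex matrix\<close>

text \<open>Indexing the vectors by numbers, instead of taking a finite set of them, also covers sequences
  with repetitions, such as the powers of an idempotent matrix.\<close>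

lemma linear_dependence_nat:
  fixes f :: "nat \<Rightarrow> 'a::euclidean_space"
  obtains c N where "\<exists>i\<le>N. c i \<noteq> (0::real)" "(\<Sum>i\<le>N. c i *\<^sub>R f i) = 0"
proof (cases "inj_on f {..DIM('a)}")
  case True
  have "card (f ` {..DIM('a)}) > DIM('a)" using True by (simp add: card_image)
  then have "dependent (f ` {..DIM('a)})"
    using independent_bound[of "f ` {..DIM('a)}"] by linarith
  then obtain u where u: "\<exists>v\<in>f ` {..DIM('a)}. u v \<noteq> 0" "(\<Sum>v\<in>f ` {..DIM('a)}. u v *\<^sub>R v) = 0"
    using dependent_finite[of "f ` {..DIM('a)}"] by auto
  have "(\<Sum>i\<le>DIM('a). u (f i) *\<^sub>R f i) = 0"
    using u(2) by (subst (asm) sum.reindex[OF True]) simp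
  with u(1) show ?thesis by (intro that[of "DIM('a)" "\<lambda>i. u (f i)"]) auto
next
  case False
  then obtain i j where ij: "i \<le> DIM('a)" "j \<le> DIM('a)" "i \<noteq> j" "f i = f j"
    by (auto simp: inj_on_def)
  define c where "c = (\<lambda>k. (if k = i then 1 else 0) - (if k = j then 1 else 0) :: real)"
  have "c k *\<^sub>R f k = (if k = i then f k else 0) - (if k = j then f k else 0)" for k
    by (simp add: c_def)
  then have "(\<Sum>k\<le>DIM('a). c k *\<^sub>R f k) = 0"
    using ij by (simp add: sum_subtractf)
  moreover have "c i \<noteq> 0" using ij by (simp add: c_def)
  ultimately show ?thesis using ij that by blast
qed

lemma scl_of_real: "scl (complex_of_real r) (A :: complex^'n^'n) = r *\<^sub>R A"
  by (simp add: scl_def vec_eq_iff) (simp add: scaleR_conv_of_real)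

lemma peval_monom: "peval (monom c k) A = scl c (mpow A k)"
  by (induction k) (simp_all add: monom_0 monom_Suc mat_algebra mat_eq_scl[of c])

lemma annihilating_polynomial:
  fixes A :: "complex^'n^'n"
  obtains p where "p \<noteq> 0" "peval p A = 0"
proof -
  obtain c N where c: "\<exists>i\<le>N. c i \<noteq> (0::real)" "(\<Sum>i\<le>N. c i *\<^sub>R mpow A i) = 0"
    using linear_dependence_nat .
  define p where "p = (\<Sum>i\<le>N. monom (of_real (c i) :: complex) i)"
  have "peval p A = 0"
    using c(2) by (simp add: p_def peval_sum peval_monom scl_of_real)
  moreover from c(1) obtain i where i: "i \<le> N" "c i \<noteq> 0" by blast
  have "coeff p i = of_real (c i)"
    using i by (simp add: p_def coeff_sum)
  then have "p \<noteq> 0" using i by auto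
  ultimately show ?thesis using that by blast
qed

text \<open>The Chinese remainder theorem in additive form: the summands become the spectral projections
  of a matrix that is annihilated by the product of the \<open>q l\<close>.\<close>

lemma coprime_partition_of_one:
  fixes q :: "'b \<Rightarrow> complex poly"
  assumes "finite L" "L \<noteq> {}" "\<And>l m. l \<in> L \<Longrightarrow> m \<in> L \<Longrightarrow> l \<noteq> m \<Longrightarrow> coprime (q l) (q m)"
  shows "\<exists>u. (\<Sum>l\<in>L. u l * (\<Prod>m\<in>L - {l}. q m)) = 1"
  using assms
proof (induction L rule: finite_ne_induct)
  case (singleton x)
  show ?case by (intro exI[of _ "\<lambda>_. 1"]) simp
next
  case (insert n L)
  then obtain u where u: "(\<Sum>l\<in>L. u l * (\<Prod>m\<in>L - {l}. q m)) = 1" by auto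
  have "coprime (q n) (\<Prod>m\<in>L. q m)"
    by (rule prod_coprime_right) (use insert in auto)
  then obtain a b where ab: "a * q n + b * (\<Prod>m\<in>L. q m) = 1"
    using bezout_coefficients_fst_snd[of "q n" "\<Prod>m\<in>L. q m"] by auto
  define u' where "u' = (\<lambda>l. if l = n then b else a * u l)"
  have 1: "insert n L - {n} = L" using insert by auto
  have 2: "u' l * (\<Prod>m\<in>insert n L - {l}. q m) = a * q n * (u l * (\<Prod>m\<in>L - {l}. q m))" if "l \<in> L" for l
  proof -
    have "insert n L - {l} = insert n (L - {l})" "n \<notin> L - {l}" "l \<noteq> n" using that insert by auto
    then show ?thesis using insert(1) by (simp add: u'_def algebra_simps)
  qed
  have "(\<Sum>l\<in>insert n L. u' l * (\<Prod>m\<in>insert n L - {l}. q m))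
      = b * (\<Prod>m\<in>L. q m) + a * q n * (\<Sum>l\<in>L. u l * (\<Prod>m\<in>L - {l}. q m))"
    using insert 1 2 by (simp add: u'_def sum_distrib_left)
  with u ab show ?case by (intro exI[of _ u']) (simp add: add.commute)
qed

lemma coprime_linear_polys:
  fixes a b :: complex
  assumes "a \<noteq> b"
  shows "coprime [:-a, 1:] [:-b, 1:]"
proof (rule coprimeI)
  fix c assume c: "c dvd [:-a, 1:]" "c dvd [:-b, 1:]"
  then have "c dvd [:-a, 1:] - [:-b, 1:]" by (rule dvd_diff)
  then have "c dvd [:b - a:]" by simp
  moreover have "[:b - a:] dvd 1" using assms by (simp add: is_unit_const_poly_iff dvd_field_iff)
  ultimately show "c dvd 1" by (rule dvd_trans)
qed

text \<open>Write an annihilating polynomial as a product of powers of linear factors, and evaluate the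
  corresponding partition of one at \<open>A\<close>. The projections \<open>P l\<close> split the space into the generalised
  eigenspaces; they take the place of a Jordan form. A common exponent \<open>k\<close> is chosen for all
  eigenvalues, and some \<open>P l\<close> may be zero.\<close>

lemma primary_decomposition:
  fixes A :: "complex^'n^'n"
  obtains L P k where "finite L" "mat 1 = (\<Sum>l\<in>L. P l)"
    "\<And>l. l \<in> L \<Longrightarrow> mpow (A - scl l (mat 1)) k ** P l = 0"
    "\<And>l. l \<in> L \<Longrightarrow> A ** P l = P l ** A"
    "\<And>l m. l \<in> L \<Longrightarrow> m \<in> L \<Longrightarrow> l \<noteq> m \<Longrightarrow> P l ** P m = 0"
    "\<And>l. l \<in> L \<Longrightarrow> P l ** P l = P l"
proof -
  obtain p where p: "p \<noteq> 0" "peval p A = 0" using annihilating_polynomial .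
  define L where "L = {z. poly p z = 0}"
  have fin: "finite L" using p(1) poly_roots_finite by (simp add: L_def)
  define k where "k = degree p"
  define q where "q = (\<lambda>l::complex. [:-l, 1:] ^ k)"
  have "smult (lead_coeff p) (\<Prod>z\<in>L. [:-z, 1:] ^ order z p) = p"
    unfolding L_def by (rule complex_poly_decompose)
  moreover have "(\<Prod>z\<in>L. [:-z, 1:] ^ order z p) dvd (\<Prod>z\<in>L. q z)"
    unfolding q_def k_def using order_degree[OF p(1)] by (intro prod_dvd_prod le_imp_power_dvd) auto
  ultimately have "p dvd (\<Prod>z\<in>L. q z)"
    using p(1) by (metis leading_coeff_0_iff smult_dvd)
  then have zero: "peval (\<Prod>z\<in>L. q z) A = 0"
    using p(2) by (auto simp: peval_mult elim: dvdE)
  have ne: "L \<noteq> {}"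
  proof
    assume "L = {}"
    with zero have "mat 1 = (0 :: complex^'n^'n)" by simp
    then have "mat 1 $ i $ i = (0 :: complex^'n^'n) $ i $ i" for i by simp
    then show False by (simp add: mat_def)
  qed
  have "\<exists>u. (\<Sum>l\<in>L. u l * (\<Prod>m\<in>L - {l}. q m)) = 1"
    using fin ne by (intro coprime_partition_of_one) (auto simp: q_def coprime_linear_polys)
  then obtain u where u: "(\<Sum>l\<in>L. u l * (\<Prod>m\<in>L - {l}. q m)) = 1" by blast
  define e where "e = (\<lambda>l. u l * (\<Prod>m\<in>L - {l}. q m))"
  define P where "P = (\<lambda>l. peval (e l) A)"
  have zero': "peval r A = 0" if "(\<Prod>z\<in>L. q z) dvd r" for r
    using that zero by (auto simp: peval_mult elim: dvdE)
  have one: "mat 1 = (\<Sum>l\<in>L. P l)"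
    using u by (simp add: P_def peval_sum [symmetric] e_def)
  have orth: "P l ** P m = 0" if "l \<in> L" "m \<in> L" "l \<noteq> m" for l m
  proof -
    have "(\<Prod>z\<in>L. q z) = q l * (\<Prod>m\<in>L - {l}. q m)"
      using that fin by (simp add: prod.remove)
    moreover have "q l dvd (\<Prod>z\<in>L - {m}. q z)" using that fin by (intro dvd_prodI) auto
    ultimately have "(\<Prod>z\<in>L. q z) dvd (\<Prod>z\<in>L - {m}. q z) * (\<Prod>m\<in>L - {l}. q m)"
      by (simp add: mult_dvd_mono)
    then have "(\<Prod>z\<in>L. q z) dvd e l * e m"
      using dvd_mult2[of _ _ "u l * u m"] by (simp add: e_def mult_ac)
    then show ?thesis unfolding P_def by (simp add: zero' flip: peval_mult)
  qed
  have nil: "mpow (A - scl l (mat 1)) k ** P l = 0" if "l \<in> L" for l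
  proof -
    have "(\<Prod>z\<in>L. q z) dvd q l * e l"
      unfolding e_def using that fin by (simp add: prod.remove mult_ac)
    then have "peval (q l * e l) A = 0" by (rule zero')
    then show ?thesis by (simp add: peval_mult P_def q_def peval_power peval_linear del: peval_pCons)
  qed
  have comm: "A ** P l = P l ** A" for l
    using peval_commute[of "[:0, 1:]" A "e l"] by (simp add: P_def)
  have idem: "P l ** P l = P l" if "l \<in> L" for l
  proof -
    have "P l = P l ** (\<Sum>m\<in>L. P m)" using one by (metis matrix_mul_rid)
    also have "\<dots> = (\<Sum>m\<in>L. if m = l then P l ** P l else 0)"
      unfolding mat_mul_sum_left by (intro sum.cong) (auto simp: orth that)
    also have "\<dots> = P l ** P l" using that fin by simp
    finally show ?thesis by (rule sym)
  qed
  show ?thesis by (rule that[of L P k]) (use fin one nil comm orth idem in auto)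
qed

section \<open>Traces of idempotent and nilpotent matrices\<close>

definition outer :: "complex^'n \<Rightarrow> complex^'n \<Rightarrow> complex^'n^'n" where
  "outer v f = (\<chi> i j. v $ i * f $ j)"

text \<open>Induction on the rank of the projection \<open>P\<close>. A vector \<open>v\<close> in its range with \<open>B v = 0\<close> and
  a covector \<open>f\<close> with \<open>f v = 1\<close> and \<open>f P = f\<close> give the rank one projection
  \<open>O1 = v f\<close>; replacing \<open>P\<close> by \<open>P - O1\<close> and \<open>B\<close> by \<open>(1 - O1) B\<close> lowers the rank by one, decreases the trace
  of \<open>P\<close> by one and keeps the trace of \<open>B\<close>.\<close>

lemma trace_on_primary_component:
  fixes P B :: "complex^'n^'n"
  assumes "P ** P = P" "P ** B = B" "B ** P = B" "mpow B k ** P = 0"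
  shows "trace B = 0 \<and> (\<exists>m::nat. trace P = of_nat m \<and> (m = 0 \<longrightarrow> P = 0))"
  using assms
proof (induction "dim (range (\<lambda>u. P *v u))" arbitrary: P B k rule: less_induct)
  case less
  note a = less.prems
  show ?case
  proof (cases "P = 0")
    case True
    with a(2) show ?thesis by (auto intro!: exI[of _ 0])
  next
    case False
    define k where "k = (LEAST k. mpow B k ** P = 0)"
    have k: "mpow B k ** P = 0" unfolding k_def using a(4) by (rule LeastI)
    then have "k \<noteq> 0" using False by (cases k) auto
    then have "mpow B (k - 1) ** P \<noteq> 0"
      using not_less_Least[of "k - 1" "\<lambda>k. mpow B k ** P = 0"] unfolding k_def by simp
    then obtain u where u: "(mpow B (k - 1) ** P) *v u \<noteq> 0"
      by (metis matrix_eq matrix_vector_mult_0)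
    define v where "v = (mpow B (k - 1) ** P) *v u"
    have v0: "v \<noteq> 0" using u by (simp add: v_def)
    have Bv: "B *v v = 0"
    proof -
      have "B ** (mpow B (k - 1) ** P) = mpow B k ** P"
        using \<open>k \<noteq> 0\<close> by (cases k) (simp_all add: mat_algebra)
      then show ?thesis by (simp add: v_def matrix_vector_mul_assoc k)
    qed
    have "P ** mpow B (k - 1) = mpow B (k - 1) ** P"
      using mpow_commute[of B P "k - 1"] a by simp
    then have Pv: "P *v v = v"
      by (simp add: v_def matrix_vector_mul_assoc) (metis a(1) matrix_mul_assoc)
    from v0 obtain i where i: "v $ i \<noteq> 0" by (auto simp: vec_eq_iff)
    define f where "f = inverse (v $ i) *s row i P"
    define O1 where "O1 = outer v f"
    have fv: "(\<Sum>j\<in>UNIV. f $ j * v $ j) = 1"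
    proof -
      have "(\<Sum>j\<in>UNIV. f $ j * v $ j) = inverse (v $ i) * (P *v v) $ i"
        by (simp add: f_def row_def matrix_vector_mult_def sum_distrib_left mult.assoc)
      then show ?thesis using Pv i by simp
    qed
    have Ol: "X ** O1 = outer (X *v v) f" for X
      by (simp add: O1_def outer_def matrix_matrix_mult_def matrix_vector_mult_def vec_eq_iff
          sum_distrib_right mult.assoc)
    have O: "P ** O1 = O1" "B ** O1 = 0"
      unfolding Ol Pv Bv by (simp_all add: O1_def outer_def vec_eq_iff)
    have O1v: "O1 *v v = v"
      using fv by (simp add: O1_def outer_def matrix_vector_mult_def vec_eq_iff mult.assoc flip: sum_distrib_left)
    have OO: "O1 ** O1 = O1"
      unfolding Ol O1v by (simp add: O1_def)
    have OP: "O1 ** P = O1"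
    proof -
      have "(\<Sum>k\<in>UNIV. row i P $ k * P $ k $ j) = row i P $ j" for j
        using arg_cong[OF a(1), of "\<lambda>X. X $ i $ j"] by (simp add: row_def matrix_matrix_mult_def)
      then have "(\<Sum>k\<in>UNIV. f $ k * P $ k $ j) = f $ j" for j
        by (simp add: f_def mult.assoc flip: sum_distrib_left)
      then show ?thesis
        by (simp add: O1_def outer_def matrix_matrix_mult_def vec_eq_iff mult.assoc flip: sum_distrib_left)
    qed
    have tO: "trace O1 = 1"
      using fv by (simp add: O1_def outer_def trace_def mult.commute)
    define P' where "P' = P - O1"
    define B' where "B' = B - O1 ** B"
    have id: "P' ** P' = P'" by (simp add: P'_def mat_algebra a O OO OP)
    have OB: "O1 ** (O1 ** B) = O1 ** B" by (metis OO matrix_mul_assoc)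
    have PO: "P ** (O1 ** B) = O1 ** B" by (metis O(1) matrix_mul_assoc)
    have b1: "P' ** B' = B'" by (simp add: P'_def B'_def mat_algebra a O OB PO)
    have b2: "B' ** P' = B'" by (simp add: P'_def B'_def mat_algebra a O OB PO)
    have pw: "B' ** mpow B' n = mpow B (Suc n) - O1 ** mpow B (Suc n)" for n
    proof (induction n)
      case (Suc n)
      have "B' ** O1 = 0" by (simp add: B'_def mat_algebra O)
      then have "B' ** (O1 ** X) = 0" for X :: "complex^'n^'n" by (metis mat_mul_zero(1) matrix_mul_assoc)
      with Suc show ?case by (simp add: mat_algebra) (simp add: B'_def mat_algebra)
    qed (simp add: B'_def)
    have "mpow B' (Suc k) ** P' = 0"
    proof -
      have *: "mpow B (Suc k) ** P = 0" using k by (simp add: mat_algebra)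
      have "mpow B (Suc k) ** O1 = mpow B (Suc k) ** P ** O1" by (simp add: mat_algebra O)
      with * have "mpow B (Suc k) ** O1 = 0" by simp
      with * have "mpow B (Suc k) ** P' = 0" unfolding P'_def mat_mul_diff_left by simp
      then show ?thesis
        using pw[of k] by (simp add: mat_algebra)
    qed
    moreover have "dim (range (\<lambda>u. P' *v u)) < dim (range (\<lambda>u. P *v u))"
    proof (rule dim_psubset)
      have lin: "linear (\<lambda>u. X *v u)" for X :: "complex^'n^'n"
        by (auto intro!: linearI simp: matrix_vector_right_distrib)
      have sp: "span (range (\<lambda>u. X *v u)) = range (\<lambda>u. X *v u)" for X :: "complex^'n^'n"
        using linear_subspace_image[OF lin[of X] subspace_UNIV] by (simp only: span_eq_iff)
      have "P ** P' = P'" by (simp add: P'_def mat_algebra a O)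
      then have sub: "range (\<lambda>u. P' *v u) \<subseteq> range (\<lambda>u. P *v u)"
        by (auto intro!: image_eqI[of _ _ "P' *v _"] simp: matrix_vector_mul_assoc)
      have "v \<notin> range (\<lambda>u. P' *v u)"
      proof
        assume "v \<in> range (\<lambda>u. P' *v u)"
        then have "P' *v v = v" using id by (auto simp: matrix_vector_mul_assoc)
        moreover have "P' *v v = 0" by (simp add: P'_def matrix_vector_mult_diff_rdistrib Pv O1v)
        ultimately show False using v0 by simp
      qed
      moreover have "v \<in> range (\<lambda>u. P *v u)" using Pv by (metis rangeI)
      ultimately show "span (range (\<lambda>u. P' *v u)) \<subset> span (range (\<lambda>u. P *v u))"
        unfolding sp using sub by blast
    qed
    ultimately obtain m where m: "trace B' = 0" "trace P' = of_nat m"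
      using less.hyps[of P' B' "Suc k"] id b1 b2 by blast
    have "trace (O1 ** B) = trace (B ** O1)" by (rule trace_mul_sym)
    then have "trace B = 0" using m(1) by (simp add: B'_def trace_sub O)
    moreover have "trace P = of_nat (Suc m)" using m(2) by (simp add: P'_def trace_sub tO diff_eq_eq add.commute)
    ultimately show ?thesis by (intro conjI exI[of _ "Suc m"]) auto
  qed
qed

section \<open>Cartan's criterion\<close>

definition ad_shift :: "complex^'n^'n \<Rightarrow> complex \<Rightarrow> complex^'n^'n \<Rightarrow> complex^'n^'n" where
  "ad_shift A k w = bracket A w - scl k w"

lemma ad_shift_linear:
  "ad_shift A k (v + w) = ad_shift A k v + ad_shift A k w"
  "ad_shift A k (v - w) = ad_shift A k v - ad_shift A k w"
  "ad_shift A k (scl c w) = scl c (ad_shift A k w)"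
  "ad_shift A k 0 = 0"
  by (simp_all add: ad_shift_def mat_algebra mult.commute)

lemma ad_shift_commute: "ad_shift A k (ad_shift A l w) = ad_shift A l (ad_shift A k w)"
  by (simp add: ad_shift_def mat_algebra mult.commute)

lemma ad_shift_pow_linear:
  "(ad_shift A k ^^ n) (v + w) = (ad_shift A k ^^ n) v + (ad_shift A k ^^ n) w"
  "(ad_shift A k ^^ n) (v - w) = (ad_shift A k ^^ n) v - (ad_shift A k ^^ n) w"
  "(ad_shift A k ^^ n) 0 = 0"
  by (induction n) (simp_all add: ad_shift_linear)

lemma ad_shift_pow_sum:
  "(ad_shift A k ^^ n) (\<Sum>i\<in>I. f i) = (\<Sum>i\<in>I. (ad_shift A k ^^ n) (f i))"
  by (induction I rule: infinite_finite_induct) (simp_all add: ad_shift_pow_linear)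

lemma ad_shift_pow_commute:
  "(ad_shift A k ^^ n) (ad_shift A l w) = ad_shift A l ((ad_shift A k ^^ n) w)"
  by (induction n) (simp_all add: ad_shift_commute)

lemma ad_shift_pow_pow_commute:
  "(ad_shift A k ^^ n) ((ad_shift A l ^^ m) w) = (ad_shift A l ^^ m) ((ad_shift A k ^^ n) w)"
  by (induction m) (simp_all add: ad_shift_pow_commute)

text \<open>On matrices that map the generalised eigenspace of \<open>m\<close> to that of \<open>l\<close>, the operator \<open>ad A\<close> has the
  single eigenvalue \<open>l - m\<close>: left multiplication by \<open>A - l\<close> and right multiplication by \<open>A - m\<close> commute
  and are nilpotent, so their difference is nilpotent.\<close>

lemma ad_shift_nilpotent:
  fixes A :: "complex^'n^'n"
  assumes "mpow (A - scl l (mat 1)) a ** w = 0" "w ** mpow (A - scl m (mat 1)) b = 0"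
  shows "(ad_shift A (l - m) ^^ (a + b)) w = 0"
  using assms
proof (induction "a + b" arbitrary: a b w)
  case 0
  then show ?case by simp
next
  case (Suc n)
  define X where "X = A - scl l (mat 1)"
  define Y where "Y = A - scl m (mat 1)"
  note p = Suc.prems[folded X_def Y_def]
  have step: "ad_shift A (l - m) w = X ** w - w ** Y"
    by (simp add: ad_shift_def X_def Y_def mat_algebra)
  show ?case
  proof (cases "a = 0 \<or> b = 0")
    case True
    then have "w = 0" using p by auto
    then show ?thesis by (simp add: ad_shift_pow_linear)
  next
    case False
    then obtain a' b' where ab: "a = Suc a'" "b = Suc b'" by (metis not0_implies_Suc)
    have 1: "(ad_shift A (l - m) ^^ (a' + b)) (X ** w) = 0"
    proof (rule Suc.hyps(1))
      show "n = a' + b" using Suc.hyps(2) ab by simp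
      show "mpow (A - scl l (mat 1)) a' ** (X ** w) = 0"
        using p(1) unfolding ab mpow_Suc2 by (simp add: matrix_mul_assoc X_def)
      show "X ** w ** mpow (A - scl m (mat 1)) b = 0"
        using p(2) by (simp add: Y_def flip: matrix_mul_assoc)
    qed
    have 2: "(ad_shift A (l - m) ^^ (a + b')) (w ** Y) = 0"
    proof (rule Suc.hyps(1))
      show "n = a + b'" using Suc.hyps(2) ab by simp
      show "mpow (A - scl l (mat 1)) a ** (w ** Y) = 0"
        using p(1) by (simp add: X_def matrix_mul_assoc)
      show "w ** Y ** mpow (A - scl m (mat 1)) b' = 0"
        using p(2) unfolding ab by (simp add: Y_def flip: matrix_mul_assoc)
    qed
    have "a + b = Suc (a' + b)" "a + b' = a' + b" using ab by auto
    with 2 have "(ad_shift A (l - m) ^^ (a + b)) w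
        = (ad_shift A (l - m) ^^ (a' + b)) (ad_shift A (l - m) w)"
      by (simp only: funpow_Suc_right o_apply)
    also have "\<dots> = 0"
      unfolding step ad_shift_pow_linear(2) 1 using 2 \<open>a + b' = a' + b\<close> by simp
    finally show ?thesis .
  qed
qed

text \<open>A complex subspace of matrices that is stable under \<open>ad A\<close>.\<close>

locale ad_invariant =
  fixes A :: "complex^'n^'n" and W :: "(complex^'n^'n) set"
  assumes diff: "\<And>v w. v \<in> W \<Longrightarrow> w \<in> W \<Longrightarrow> v - w \<in> W"
    and scale: "\<And>c w. w \<in> W \<Longrightarrow> scl c w \<in> W"
    and invariant: "\<And>w. w \<in> W \<Longrightarrow> bracket A w \<in> W"
begin

lemma ad_shift_mem: "w \<in> W \<Longrightarrow> ad_shift A k w \<in> W"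
  by (simp add: ad_shift_def diff scale invariant)

lemma add: "v \<in> W \<Longrightarrow> w \<in> W \<Longrightarrow> v + w \<in> W"
  using diff[of v "scl (-1) w"] scale[of w "-1"] by (simp add: scl_add)

lemma sum_mem: "w0 \<in> W \<Longrightarrow> (\<And>i. i \<in> I \<Longrightarrow> f i \<in> W) \<Longrightarrow> sum f I \<in> W"
  using diff[of w0 w0] by (induction I rule: infinite_finite_induct) (simp_all add: add)

text \<open>An operator with the single eigenvalue \<open>k \<noteq> l\<close> remains invertible modulo \<open>W\<close> after subtracting
  \<open>l\<close>.\<close>

lemma generalized_eigenvector_mem:
  assumes "(ad_shift A k ^^ n) u = 0" "ad_shift A l u \<in> W" "k \<noteq> l"
  shows "u \<in> W"
  using assms
proof (induction n arbitrary: u)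
  case 0
  then show ?case by (simp add: ad_shift_linear)
next
  case (Suc n)
  have "ad_shift A k u \<in> W"
  proof (rule Suc.IH)
    show "(ad_shift A k ^^ n) (ad_shift A k u) = 0"
      using Suc.prems(1) by (simp add: funpow_swap1)
    show "ad_shift A l (ad_shift A k u) \<in> W"
      using ad_shift_mem[OF Suc.prems(2), of k] by (simp add: ad_shift_commute)
  qed (fact \<open>k \<noteq> l\<close>)
  then have "ad_shift A l u - ad_shift A k u \<in> W" using Suc.prems(2) by (rule diff[rotated])
  then have "scl (k - l) u \<in> W" by (simp add: ad_shift_def scl_add)
  then have "scl (inverse (k - l)) (scl (k - l) u) \<in> W" by (rule scale)
  then show ?case using \<open>k \<noteq> l\<close> by simp
qed

lemma generalized_eigenvector_pow_mem:
  assumes "(ad_shift A k ^^ n) u = 0" "(ad_shift A l ^^ m) u \<in> W" "k \<noteq> l"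
  shows "u \<in> W"
  using assms
proof (induction m arbitrary: u)
  case (Suc m)
  have "ad_shift A l u \<in> W"
    by (rule Suc.IH) (use Suc.prems in \<open>simp_all add: ad_shift_pow_commute ad_shift_linear flip: funpow_swap1\<close>)
  then show ?case using Suc.prems(1,3) generalized_eigenvector_mem by blast
qed simp

text \<open>An invariant subspace contains the components of each of its elements: a power of
  \<open>ad A - l\<close> removes the component for \<open>l\<close>, and the components that remain are recovered from their
  images because \<open>ad A - l\<close> is invertible on them.\<close>

lemma generalized_eigenvectors_sum_mem:
  assumes "finite I" "\<And>k. k \<in> I \<Longrightarrow> (ad_shift A k ^^ n) (u k) = 0" "(\<Sum>k\<in>I. u k) \<in> W" "k \<in> I"
  shows "u k \<in> W"
  using assms
proof (induction I arbitrary: u k rule: finite_induct)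
  case (insert l I)
  have rest: "u k \<in> W" if "k \<in> I" for k
  proof (rule generalized_eigenvector_pow_mem)
    show "(ad_shift A k ^^ n) (u k) = 0" using insert.prems(1) that by simp
    show "k \<noteq> l" using that insert.hyps by auto
    show "(ad_shift A l ^^ n) (u k) \<in> W"
    proof (rule insert.IH[of "\<lambda>k. (ad_shift A l ^^ n) (u k)"])
      show "(ad_shift A k ^^ n) ((ad_shift A l ^^ n) (u k)) = 0" if "k \<in> I" for k
        using insert.prems(1)[of k] that
        by (subst ad_shift_pow_pow_commute) (simp add: ad_shift_pow_linear)
      have "(ad_shift A l ^^ n) (\<Sum>k\<in>insert l I. u k) \<in> W"
        using insert.prems(2) by (induction n) (auto simp: ad_shift_mem)
      then show "(\<Sum>k\<in>I. (ad_shift A l ^^ n) (u k)) \<in> W"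
        using insert by (simp add: ad_shift_pow_linear ad_shift_pow_sum)
    qed (fact that)
  qed
  have "(\<Sum>k\<in>I. u k) \<in> W"
    by (rule sum_mem[OF insert.prems(2)]) (rule rest)
  from diff[OF insert.prems(2) this] have "u l \<in> W" using insert.hyps by simp
  with rest show ?case using insert.prems(3) by auto
qed simp

end

definition cmat :: "real^'n^'n \<Rightarrow> complex^'n^'n" where
  "cmat x = (\<chi> i j. complex_of_real (x $ i $ j))"

definition Re_mat :: "complex^'n^'n \<Rightarrow> real^'n^'n" where
  "Re_mat w = (\<chi> i j. Re (w $ i $ j))"

lemma cmat_mult: "cmat (x ** y) = cmat x ** cmat y"
  by (simp add: cmat_def matrix_matrix_mult_def vec_eq_iff)

lemma cmat_linear: "cmat (x + y) = cmat x + cmat y" "cmat (x - y) = cmat x - cmat y"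
  "cmat (r *\<^sub>R x) = scl (of_real r) (cmat x)" "cmat 0 = 0" "cmat (mat 1) = mat 1"
  by (simp_all add: cmat_def vec_eq_iff scl_def mat_def)

lemma cmat_mpow: "cmat (mpow x k) = mpow (cmat x) k"
  by (induction k) (simp_all add: cmat_linear cmat_mult)

lemma cmat_eq_0_iff: "cmat x = 0 \<longleftrightarrow> x = 0"
  by (simp add: cmat_def vec_eq_iff)

lemma Re_mat_linear: "Re_mat (v + w) = Re_mat v + Re_mat w" "Re_mat (v - w) = Re_mat v - Re_mat w"
  "Re_mat (cmat x) = x"
  by (simp_all add: Re_mat_def vec_eq_iff cmat_def)

text \<open>The imaginary part of \<open>w\<close> is written as the real part of \<open>-\<i> w\<close>.\<close>

lemma Re_mat_scl: "Re_mat (scl c w) = Re c *\<^sub>R Re_mat w - Im c *\<^sub>R Re_mat (scl (-\<i>) w)"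
  by (simp add: Re_mat_def vec_eq_iff scl_def)

lemma Re_mat_mult: "Re_mat (cmat x ** w) = x ** Re_mat w" "Re_mat (w ** cmat x) = Re_mat w ** x"
  by (simp_all add: Re_mat_def vec_eq_iff cmat_def matrix_matrix_mult_def)

lemma Re_trace: "Re (trace w) = trace (Re_mat w)"
  by (simp add: trace_def Re_mat_def)

text \<open>Let \<open>y\<close> act on the generalised eigenspace of \<open>x\<close> for \<open>l\<close> as the conjugate of \<open>l\<close>. On the component
  of a matrix on which \<open>ad x\<close> has the eigenvalue \<open>\<kappa>\<close>, the operator \<open>ad y\<close> is multiplication by the
  conjugate of \<open>\<kappa>\<close>, because conjugation is additive. So \<open>ad y\<close> kills the component for \<open>0\<close>, and it maps
  the others into \<open>r\<close> since \<open>ad x\<close> does and is invertible there. The real part of \<open>y\<close> inherits this and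
  is therefore orthogonal to \<open>x\<close> by hypothesis; but the trace of \<open>x y\<close> is the sum of the \<open>\<bar>l\<bar>\<^sup>2\<close> over all
  eigenvalues with multiplicity, so that \<open>0\<close> is the only eigenvalue.\<close>

theorem cartan_nilpotent:
  fixes x :: "real^'n^'n" and h r :: "(real^'n^'n) set"
  assumes r: "subspace r" and rh: "r \<subseteq> h"
    and xh: "\<And>b. b \<in> h \<Longrightarrow> bracket x b \<in> r"
    and tr: "\<And>y. (\<And>b. b \<in> h \<Longrightarrow> bracket y b \<in> r) \<Longrightarrow> trace (x ** y) = 0"
  shows "nilpotent x"
proof -
  define A where "A = cmat x"
  obtain L P k where L: "finite L" and one: "mat 1 = (\<Sum>l\<in>L. P l)"
    and nil: "\<And>l. l \<in> L \<Longrightarrow> mpow (A - scl l (mat 1)) k ** P l = 0"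
    and comm: "\<And>l. l \<in> L \<Longrightarrow> A ** P l = P l ** A"
    and orth: "\<And>l m. l \<in> L \<Longrightarrow> m \<in> L \<Longrightarrow> l \<noteq> m \<Longrightarrow> P l ** P m = 0"
    and idem: "\<And>l. l \<in> L \<Longrightarrow> P l ** P l = P l"
    using primary_decomposition[of A] by metis
  have comm': "P l ** mpow (A - scl m (mat 1)) j = mpow (A - scl m (mat 1)) j ** P l" if "l \<in> L" for l m j
    by (rule mpow_commute[symmetric]) (simp add: mat_algebra comm that)
  define y where "y = (\<Sum>l\<in>L. scl (cnj l) (P l))"
  have yP: "y ** P l = scl (cnj l) (P l)" "P l ** y = scl (cnj l) (P l)" if "l \<in> L" for l
  proof -
    have "y ** P l = (\<Sum>m\<in>L. if m = l then scl (cnj l) (P l) else 0)"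
      unfolding y_def mat_mul_sum_right by (intro sum.cong) (auto simp: mat_mul_scl orth idem that)
    then show "y ** P l = scl (cnj l) (P l)" using that L by simp
    have "P l ** y = (\<Sum>m\<in>L. if m = l then scl (cnj l) (P l) else 0)"
      unfolding y_def mat_mul_sum_left by (intro sum.cong) (auto simp: mat_mul_scl orth idem that)
    then show "P l ** y = scl (cnj l) (P l)" using that L by simp
  qed
  \<comment> \<open>the complexification of \<open>r\<close>\<close>
  define W where "W = {w. Re_mat w \<in> r \<and> Re_mat (scl (-\<i>) w) \<in> r}"
  interpret W: ad_invariant A W
  proof
    show "v - w \<in> W" if "v \<in> W" "w \<in> W" for v w
      using that r by (simp add: W_def Re_mat_linear scl_add(2) subspace_diff)
    show "scl c w \<in> W" if "w \<in> W" for c w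
    proof -
      have "Re_mat (scl c w) \<in> r" for c
        unfolding Re_mat_scl[of c w] using that r by (simp add: W_def subspace_diff subspace_scale)
      then show ?thesis by (simp add: W_def)
    qed
    show "bracket A w \<in> W" if "w \<in> W" for w
    proof -
      have 1: "Re_mat (bracket A w) = bracket x (Re_mat w)" for w
        by (simp add: A_def Re_mat_linear Re_mat_mult)
      have "scl (-\<i>) (bracket A w) = bracket A (scl (-\<i>) w)"
        by (simp add: mat_mul_scl scl_add(2))
      then show ?thesis using that 1 xh rh by (auto simp: W_def simp del: scl_simps)
    qed
  qed
  have yb: "bracket (Re_mat y) b \<in> r" if b: "b \<in> h" for b
  proof -
    define w where "w = (\<lambda>(l, m). P l ** cmat b ** P m)"
    define S where "S = L \<times> L"
    define d where "d = (\<lambda>(l, m). l - m :: complex)"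
    define K where "K = d ` S"
    define u where "u = (\<lambda>\<kappa>. \<Sum>p\<in>{p \<in> S. d p = \<kappa>}. w p)"
    have fin: "finite S" "finite K" using L by (auto simp: S_def K_def)
    have "cmat b = mat 1 ** cmat b ** mat 1" by simp
    also have "\<dots> = (\<Sum>p\<in>S. w p)"
      unfolding one w_def S_def
      by (simp add: mat_mul_sum_left mat_mul_sum_right sum.cartesian_product[symmetric])
        (subst sum.swap, simp)
    also have "\<dots> = (\<Sum>\<kappa>\<in>K. u \<kappa>)"
      unfolding u_def K_def using fin by (simp add: sum.image_gen)
    finally have b_eq: "cmat b = (\<Sum>\<kappa>\<in>K. u \<kappa>)" .
    have w_nil: "(ad_shift A (d p) ^^ (k + k)) (w p) = 0" if "p \<in> S" for p
    proof -
      obtain l m where p: "p = (l, m)" "l \<in> L" "m \<in> L" using \<open>p \<in> S\<close> by (auto simp: S_def)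
      show ?thesis unfolding p d_def w_def prod.case
      proof (rule ad_shift_nilpotent)
        show "mpow (A - scl l (mat 1)) k ** (P l ** cmat b ** P m) = 0"
          using nil[OF p(2)] by (simp add: matrix_mul_assoc)
        show "P l ** cmat b ** P m ** mpow (A - scl m (mat 1)) k = 0"
          using nil[OF p(3)] comm'[OF p(3)] by (simp flip: matrix_mul_assoc)
      qed
    qed
    have u_nil: "(ad_shift A \<kappa> ^^ (k + k)) (u \<kappa>) = 0" for \<kappa>
      unfolding u_def ad_shift_pow_sum by (intro sum.neutral) (use w_nil in auto)
    have "Re_mat (bracket A (cmat b)) = bracket x b" "Re_mat (scl (-\<i>) (bracket A (cmat b))) = 0"
      by (simp_all add: A_def Re_mat_linear Re_mat_mult mat_algebra)
        (simp_all add: A_def flip: cmat_mult, simp add: Re_mat_def scl_def cmat_def vec_eq_iff)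
    then have "bracket A (cmat b) \<in> W" using xh[OF b] subspace_0[OF r] by (simp add: W_def)
    then have Ab: "(\<Sum>\<kappa>\<in>K. ad_shift A 0 (u \<kappa>)) \<in> W"
      by (simp add: b_eq ad_shift_def mat_mul_sum_left mat_mul_sum_right sum_subtractf)
    \<comment> \<open>\<open>ad x\<close> itself is the shift by \<open>0\<close>, hence the restriction to \<open>\<kappa> \<noteq> 0\<close>\<close>
    have u_mem: "u \<kappa> \<in> W" if "\<kappa> \<in> K" "\<kappa> \<noteq> 0" for \<kappa>
    proof (rule W.generalized_eigenvector_mem)
      show "ad_shift A 0 (u \<kappa>) \<in> W"
      proof (rule W.generalized_eigenvectors_sum_mem[where n = "k + k", OF fin(2) _ Ab that(1)])
        show "(ad_shift A \<kappa> ^^ (k + k)) (ad_shift A 0 (u \<kappa>)) = 0" for \<kappa>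
          unfolding ad_shift_pow_commute u_nil by (simp add: ad_shift_linear)
      qed
      show "(ad_shift A \<kappa> ^^ (k + k)) (u \<kappa>) = 0" by (rule u_nil)
    qed (fact that(2))
    have yu: "bracket y (u \<kappa>) = scl (cnj \<kappa>) (u \<kappa>)" for \<kappa>
    proof -
      have "bracket y (w p) = scl (cnj \<kappa>) (w p)" if p: "p \<in> S" "d p = \<kappa>" for p
      proof -
        obtain l m where lm: "p = (l, m)" "l \<in> L" "m \<in> L" using p(1) by (auto simp: S_def)
        have "y ** (P l ** X) = scl (cnj l) (P l ** X)" for X
          using yP(1)[OF lm(2)] by (metis mat_mul_scl(1) matrix_mul_assoc)
        moreover have "P m ** y = scl (cnj m) (P m)" using yP(2)[OF lm(3)] .
        ultimately show ?thesis
          using p(2) by (simp add: lm d_def w_def mat_algebra scl_add(4) flip: p(2))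
      qed
      then show ?thesis
        by (simp add: u_def mat_mul_sum_left mat_mul_sum_right scl_sum flip: sum_subtractf)
    qed
    have "bracket y (cmat b) = (\<Sum>\<kappa>\<in>K. bracket y (u \<kappa>))"
      by (simp add: b_eq mat_mul_sum_left mat_mul_sum_right sum_subtractf)
    also have "\<dots> \<in> W"
    proof (rule W.sum_mem)
      show "0 \<in> W" using W.scale[OF \<open>bracket A (cmat b) \<in> W\<close>, of 0] by simp
      then show "bracket y (u \<kappa>) \<in> W" if "\<kappa> \<in> K" for \<kappa>
        unfolding yu using u_mem[OF that] W.scale by (cases "\<kappa> = 0") auto
    qed
    finally have "Re_mat (bracket y (cmat b)) \<in> r" by (simp add: W_def)
    then show ?thesis by (simp add: Re_mat_linear Re_mat_mult)
  qed
  have "\<exists>m::nat. trace (P l) = of_nat m \<and> (m = 0 \<longrightarrow> P l = 0)"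
    "trace (A ** P l) = l * trace (P l)" if l: "l \<in> L" for l
  proof -
    define B where "B = (A - scl l (mat 1)) ** P l"
    have "(A - scl l (mat 1)) ** P l = P l ** (A - scl l (mat 1))"
      by (simp add: mat_algebra comm l)
    then have B: "P l ** B = B" "B ** P l = B"
      unfolding B_def by (metis idem l matrix_mul_assoc)+
    have "mpow B j ** P l = mpow (A - scl l (mat 1)) j ** P l" for j
    proof (induction j)
      case (Suc j)
      have "mpow B (Suc j) ** P l = (A - scl l (mat 1)) ** (P l ** (mpow (A - scl l (mat 1)) j ** P l))"
        using Suc by (simp add: B_def matrix_mul_assoc[symmetric])
      also have "P l ** (mpow (A - scl l (mat 1)) j ** P l) = mpow (A - scl l (mat 1)) j ** P l"
        by (metis comm' idem l matrix_mul_assoc)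
      finally show ?case by (simp add: matrix_mul_assoc)
    qed simp
    then have "mpow B k ** P l = 0" using nil[OF l] by simp
    from trace_on_primary_component[OF idem[OF l] B this]
    have t: "trace B = 0" "\<exists>m::nat. trace (P l) = of_nat m \<and> (m = 0 \<longrightarrow> P l = 0)" by auto
    show "\<exists>m::nat. trace (P l) = of_nat m \<and> (m = 0 \<longrightarrow> P l = 0)" by (rule t(2))
    show "trace (A ** P l) = l * trace (P l)"
      using t(1) by (simp add: B_def mat_algebra trace_sub trace_scl)
  qed
  then obtain m where m: "\<And>l. l \<in> L \<Longrightarrow> trace (P l) = of_nat (m l)"
      "\<And>l. l \<in> L \<Longrightarrow> m l = 0 \<Longrightarrow> P l = 0"
    and tA: "\<And>l. l \<in> L \<Longrightarrow> trace (A ** P l) = l * trace (P l)" by metis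
  have "trace (x ** Re_mat y) = Re (trace (A ** y))"
    by (simp add: Re_trace A_def Re_mat_mult)
  also have "trace (A ** y) = (\<Sum>l\<in>L. of_real ((cmod l)\<^sup>2 * real (m l)))"
    unfolding y_def mat_mul_sum_left trace_sum
  proof (intro sum.cong refl)
    fix l assume "l \<in> L"
    then have "trace (A ** scl (cnj l) (P l)) = (cnj l * l) * of_nat (m l)"
      using tA m(1) by (simp add: mat_mul_scl trace_scl)
    also have "cnj l * l = of_real ((cmod l)\<^sup>2)" by (metis complex_norm_square mult.commute of_real_power)
    finally show "trace (A ** scl (cnj l) (P l)) = of_real ((cmod l)\<^sup>2 * real (m l))" by simp
  qed
  finally have "(\<Sum>l\<in>L. (cmod l)\<^sup>2 * real (m l)) = 0"
    using tr[OF yb] by (simp flip: of_real_sum)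
  then have "(cmod l)\<^sup>2 * real (m l) = 0" if "l \<in> L" for l
    using that L by (subst (asm) sum_nonneg_eq_0_iff) auto
  then have P0: "P l = 0" if "l \<in> L" "l \<noteq> 0" for l using that m(2) by auto
  have "mpow A k = (\<Sum>l\<in>L. mpow A k ** P l)"
    using one by (metis mat_mul_sum_left matrix_mul_rid)
  also have "\<dots> = 0"
  proof (intro sum.neutral ballI)
    fix l assume "l \<in> L"
    then show "mpow A k ** P l = 0" using P0 nil[of l] by (cases "l = 0") auto
  qed
  finally have "mpow x k = 0" by (simp add: A_def flip: cmat_mpow cmat_eq_0_iff)
  then show ?thesis by (auto simp: nilpotent_def)
qed

section \<open>Engel's theorem\<close>

text \<open>If these products all vanish for some \<open>k\<close>, then \<open>m\<close> generates a nilpotent associative algebra.\<close>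

primrec words :: "(real^'n^'n) set \<Rightarrow> nat \<Rightarrow> (real^'n^'n) set" where
  "words m 0 = {mat 1}"
| "words m (Suc k) = {a ** w | a w. a \<in> m \<and> w \<in> words m k}"

lemma words_add: "w \<in> words m (j + k) \<Longrightarrow> \<exists>u\<in>words m j. \<exists>v\<in>words m k. w = u ** v"
proof (induction j arbitrary: w)
  case (Suc j)
  then obtain a w' where w: "w = a ** w'" "a \<in> m" "w' \<in> words m (j + k)" by auto
  with Suc.IH obtain u v where uv: "u \<in> words m j" "v \<in> words m k" "w' = u ** v" by blast
  have "w = (a ** u) ** v" "a ** u \<in> words m (Suc j)" using w uv by (auto simp: matrix_mul_assoc)
  with uv(2) show ?case by blast
qed auto

lemma words_snoc: "w \<in> words m k \<Longrightarrow> a \<in> m \<Longrightarrow> w ** a \<in> words m (Suc k)"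
proof (induction k arbitrary: w)
  case 0
  then show ?case by (auto intro!: exI[of _ a] exI[of _ "mat 1"])
next
  case (Suc k)
  then obtain b w' where w: "w = b ** w'" "b \<in> m" "w' \<in> words m k" by auto
  have "w ** a = b ** (w' ** a)" "w' ** a \<in> words m (Suc k)"
    using Suc w by (simp_all flip: matrix_mul_assoc)
  with w(2) show ?case by (subst words.simps) blast
qed

lemma words_zero_mono:
  assumes "words m N \<subseteq> {0}" "N \<le> k"
  shows "words m k \<subseteq> {0}"
proof
  fix w assume "w \<in> words m k"
  then have "w \<in> words m (N + (k - N))" using assms(2) by simp
  then obtain u v where "u \<in> words m N" "v \<in> words m (k - N)" "w = u ** v"
    using words_add by blast
  then show "w \<in> {0}" using assms(1) by auto
qed

definition lie_subalgebra :: "(real^'n^'n) set \<Rightarrow> bool" where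
  "lie_subalgebra m \<longleftrightarrow> subspace m \<and> (\<forall>a\<in>m. \<forall>b\<in>m. bracket a b \<in> m)"

lemma span_insert_subspaceE:
  assumes "subspace m" "x \<in> span (insert y m)"
  obtains c where "x - c *\<^sub>R y \<in> m"
proof -
  have "span m = m" using assms(1) by (simp add: span_eq_iff)
  with assms(2) obtain c where "x - c *\<^sub>R y \<in> m" unfolding span_breakdown_eq by metis
  then show ?thesis by (rule that)
qed

text \<open>Iterated brackets of an element of \<open>n\<close> with \<open>2 N\<close> elements of \<open>m\<close> vanish, since each term of their
  expansion has at least \<open>N\<close> factors from \<open>m\<close> on one side. The last iterated bracket outside \<open>m\<close>
  normalises \<open>m\<close>.\<close>

lemma normalizer_grows:
  fixes m n :: "(real^'n^'n) set"
  assumes "words m N \<subseteq> {0}" "m \<subset> n" "subspace m" and n: "lie_subalgebra n"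
  obtains y where "y \<in> n" "y \<notin> m" "\<And>a. a \<in> m \<Longrightarrow> bracket y a \<in> m"
proof -
  define D where "D = rec_nat n (\<lambda>_ D. {bracket z a | z a. z \<in> D \<and> a \<in> m})"
  have D: "D 0 = n" "D (Suc k) = {bracket z a | z a. z \<in> D k \<and> a \<in> m}" for k
    by (simp_all add: D_def)
  define Q where "Q = (\<lambda>k. span {u ** x ** v | u x v i j. u \<in> words m i \<and> v \<in> words m j \<and> i + j = k})"
  have Dn: "D k \<subseteq> n" for k
    by (induction k) (use n assms(2) in \<open>auto simp: D lie_subalgebra_def\<close>)
  have Q_Suc: "bracket z a \<in> Q (Suc k)" if "z \<in> Q k" "a \<in> m" for z a k
    using that(1) unfolding Q_def
  proof (induction z rule: span_induct_alt)
    case base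
    then show ?case by (simp add: span_zero)
  next
    case (step c z w)
    then obtain u x v i j where z: "z = u ** x ** v" "u \<in> words m i" "v \<in> words m j" "i + j = k"
      by blast
    have "u ** x ** (v ** a) \<in> Q (Suc k)" "a ** u ** x ** v \<in> Q (Suc k)"
    proof -
      have "a ** u \<in> words m (Suc i)" using z(2) that(2) by auto
      moreover have "i + Suc j = Suc k" "Suc i + j = Suc k" using z(4) by auto
      ultimately show "u ** x ** (v ** a) \<in> Q (Suc k)" "a ** u ** x ** v \<in> Q (Suc k)"
        unfolding Q_def using z(2,3) words_snoc[OF z(3) that(2)] by (intro span_base; blast)+
    qed
    then have "c *\<^sub>R (u ** x ** (v ** a)) - c *\<^sub>R (a ** u ** x ** v) \<in> Q (Suc k)"
      unfolding Q_def by (intro span_diff span_scale)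
    then have "c *\<^sub>R (u ** x ** (v ** a)) - c *\<^sub>R (a ** u ** x ** v) + bracket w a \<in> Q (Suc k)"
      using step(2) unfolding Q_def by (intro span_add)
    then show ?case unfolding Q_def by (simp add: z mat_algebra algebra_simps)
  qed
  have DQ: "D k \<subseteq> Q k" for k
  proof (induction k)
    case 0
    have "x \<in> Q 0" for x
      unfolding Q_def by (intro span_base) (auto intro!: exI[of _ "mat 1"] exI[of _ x])
    then show ?case by blast
  next
    case (Suc k)
    then show ?case using Q_Suc by (auto simp: D)
  qed
  have "Q (2 * N) \<subseteq> span {0}"
    unfolding Q_def
  proof (intro span_mono subsetI)
    fix z assume "z \<in> {u ** x ** v | u x v i j. u \<in> words m i \<and> v \<in> words m j \<and> i + j = 2 * N}"
    then obtain u x v i j where z: "z = u ** x ** v" "u \<in> words m i" "v \<in> words m j" "i + j = 2 * N"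
      by blast
    then consider "N \<le> i" | "N \<le> j" by linarith
    then have "u = 0 \<or> v = 0" using z words_zero_mono[OF assms(1)] by cases auto
    then show "z \<in> {0}" using z by auto
  qed
  then have "D (2 * N) \<subseteq> m" using DQ[of "2 * N"] subspace_0[OF assms(3)] by auto
  define k where "k = (LEAST k. D k \<subseteq> m)"
  have k: "D k \<subseteq> m" unfolding k_def by (rule LeastI) fact
  then have "k \<noteq> 0" using assms(2) D(1) by (cases k) auto
  then have "\<not> D (k - 1) \<subseteq> m"
    using not_less_Least[of "k - 1" "\<lambda>k. D k \<subseteq> m"] unfolding k_def by simp
  then obtain y where y: "y \<in> D (k - 1)" "y \<notin> m" by blast
  have "bracket y a \<in> m" if "a \<in> m" for a
    using k y(1) that D(2)[of "k - 1"] \<open>k \<noteq> 0\<close> by auto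
  then show ?thesis using that y Dn by blast
qed

text \<open>Modulo words with more factors from \<open>m\<close>, the element \<open>y\<close> commutes with \<open>m\<close>. So \<open>p\<close> factors from the
  span of \<open>y\<close> and \<open>m\<close> contribute at least one factor from \<open>m\<close>, as \<open>y ^ p = 0\<close>.\<close>

lemma words_zero_extend:
  fixes m :: "(real^'n^'n) set"
  assumes m: "words m N \<subseteq> {0}" "subspace m" and y: "mpow y p = 0" "\<And>a. a \<in> m \<Longrightarrow> bracket y a \<in> m"
  shows "words (span (insert y m)) (N * p) \<subseteq> {0}"
proof -
  \<comment> \<open>the words with at least \<open>j\<close> factors from \<open>m\<close>, all powers of \<open>y\<close> moved to the left\<close>
  define I where "I = (\<lambda>j. span {mpow y i ** w | i w j'. w \<in> words m j' \<and> j \<le> j'})"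
  have gen: "mpow y i ** w \<in> I j" if "w \<in> words m j'" "j \<le> j'" for i j j' w
    unfolding I_def using that by (intro span_base) blast
  have I_y: "y ** z \<in> I j" if "z \<in> I j" for z j
    using that unfolding I_def
  proof (induction z rule: span_induct_alt)
    case (step c z w)
    then obtain i v j' where z: "z = mpow y i ** v" "v \<in> words m j'" "j \<le> j'" by blast
    have "y ** z \<in> I j" using gen[OF z(2,3), of "Suc i"] z(1) by (simp add: matrix_mul_assoc)
    then have "c *\<^sub>R (y ** z) + y ** w \<in> I j"
      using step(2) unfolding I_def by (intro span_add span_scale)
    then show ?case unfolding I_def by (simp add: mat_algebra)
  qed (simp add: span_zero)
  have a_gen: "a ** (mpow y i ** w) \<in> I (Suc j)" if "a \<in> m" "w \<in> words m j'" "j \<le> j'" for a i w j j'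
    using that(1)
  proof (induction i arbitrary: a)
    case 0
    then have "a ** w \<in> words m (Suc j')" using that by auto
    from gen[OF this, of "Suc j" 0] show ?case using that by simp
  next
    case (Suc i)
    have "a ** (mpow y (Suc i) ** w) = y ** (a ** (mpow y i ** w)) - bracket y a ** (mpow y i ** w)"
      by (simp add: mat_algebra)
    also have "\<dots> \<in> I (Suc j)"
      using I_y[OF Suc.IH[OF Suc.prems]] Suc.IH[OF y(2)[OF Suc.prems]] unfolding I_def by (rule span_diff)
    finally show ?case .
  qed
  have I_a: "a ** z \<in> I (Suc j)" if "a \<in> m" "z \<in> I j" for a z j
    using that(2) unfolding I_def
  proof (induction z rule: span_induct_alt)
    case (step c z w)
    then obtain i v j' where z: "z = mpow y i ** v" "v \<in> words m j'" "j \<le> j'" by blast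
    have "c *\<^sub>R (a ** z) + a ** w \<in> I (Suc j)"
      using step(2) a_gen[OF that(1) z(2,3), of i] z(1) unfolding I_def by (intro span_add span_scale) simp_all
    then show ?case unfolding I_def by (simp add: mat_algebra)
  qed (simp add: span_zero)
  have I_mono: "I (Suc j) \<subseteq> I j" for j
    unfolding I_def by (intro span_mono) (auto dest: Suc_leD)
  have expand: "\<exists>c. w ** z - c *\<^sub>R (mpow y k ** z) \<in> I (Suc j)"
    if "w \<in> words (span (insert y m)) k" "z \<in> I j" for w z k j
    using that(1)
  proof (induction k arbitrary: w)
    case 0
    then show ?case by (intro exI[of _ 1]) (simp add: I_def span_zero)
  next
    case (Suc k)
    then obtain x w' where w: "w = x ** w'" "x \<in> span (insert y m)" "w' \<in> words (span (insert y m)) k"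
      by auto
    obtain d where d: "x - d *\<^sub>R y \<in> m"
      using span_insert_subspaceE[OF m(2) w(2)] .
    obtain c where c: "w' ** z - c *\<^sub>R (mpow y k ** z) \<in> I (Suc j)" using Suc.IH[OF w(3)] by blast
    define a where "a = x - d *\<^sub>R y"
    define t where "t = w' ** z - c *\<^sub>R (mpow y k ** z)"
    have yz: "mpow y k ** z \<in> I j"
      by (induction k) (use I_y that(2) in \<open>auto simp flip: matrix_mul_assoc\<close>)
    have t: "t \<in> I (Suc j)" "t \<in> I j" using c I_mono by (auto simp: t_def)
    have "w ** z - (d * c) *\<^sub>R (mpow y (Suc k) ** z)
        = (a ** t + c *\<^sub>R (a ** (mpow y k ** z))) + d *\<^sub>R (y ** t)"
    proof -
      have x: "x = a + d *\<^sub>R y" and w': "w' ** z = t + c *\<^sub>R (mpow y k ** z)"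
        by (simp_all add: a_def t_def)
      have "w ** z = x ** (w' ** z)" by (simp add: w(1) matrix_mul_assoc)
      then show ?thesis by (simp add: w' x mat_algebra algebra_simps)
    qed
    also have "\<dots> \<in> I (Suc j)"
      using I_a[OF d t(2)] I_a[OF d yz] I_y[OF t(1)] unfolding a_def[symmetric] I_def
      by (intro span_add span_scale)
    finally show ?case by blast
  qed
  have "words (span (insert y m)) (j * p) \<subseteq> I j" for j
  proof (induction j)
    case 0
    show ?case using gen[of "mat 1" 0 0 0] by simp
  next
    case (Suc j)
    show ?case
    proof
      fix w assume "w \<in> words (span (insert y m)) (Suc j * p)"
      then have "w \<in> words (span (insert y m)) (p + j * p)" by simp
      from words_add[OF this] Suc.IH obtain u z
        where w: "u \<in> words (span (insert y m)) p" "z \<in> I j" "w = u ** z" by blast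
      from expand[OF w(1,2)] show "w \<in> I (Suc j)" using w(3) y(1) by simp
    qed
  qed
  moreover have "I N \<subseteq> {0}"
  proof -
    have "{mpow y i ** w | i w j'. w \<in> words m j' \<and> N \<le> j'} \<subseteq> {0}"
      using words_zero_mono[OF m(1)] by fastforce
    then have "I N \<subseteq> span {0}" unfolding I_def by (rule span_mono)
    then show ?thesis by simp
  qed
  ultimately show ?thesis by blast
qed

text \<open>Among the subalgebras of \<open>n\<close> with vanishing long words, take one of largest dimension; by the two
  preceding lemmas it cannot be proper. A longest word that is nonzero then provides the vector.\<close>

theorem engel:
  fixes n :: "(real^'n^'n) set"
  assumes n: "lie_subalgebra n" and nil: "\<And>x. x \<in> n \<Longrightarrow> nilpotent x"
  obtains v where "v \<noteq> 0" "\<And>x. x \<in> n \<Longrightarrow> x *v v = 0"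
proof -
  define P where "P = (\<lambda>m. lie_subalgebra m \<and> m \<subseteq> n \<and> (\<exists>N. words m N \<subseteq> {0}))"
  have "words {0 :: real^'n^'n} (Suc 0) \<subseteq> {0}" by auto
  then have P0: "P {0}"
    using n unfolding P_def lie_subalgebra_def by (auto simp: subspace_0 intro!: exI[of _ "Suc 0"])
  obtain m where m: "P m" "\<And>m'. P m' \<Longrightarrow> dim m' \<le> dim m"
  proof -
    have "dim m < Suc DIM(real^'n^'n)" for m :: "(real^'n^'n) set"
      using dim_subset_UNIV[of m] by simp
    then show ?thesis using ex_has_greatest_nat[of P "{0}" dim, OF P0] that by blast
  qed
  obtain N where N: "words m N \<subseteq> {0}" using m(1) by (auto simp: P_def)
  have sub: "subspace m" "m \<subseteq> n" "\<And>a b. a \<in> m \<Longrightarrow> b \<in> m \<Longrightarrow> bracket a b \<in> m" "subspace n"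
    using m(1) n by (auto simp: P_def lie_subalgebra_def)
  have "m = n"
  proof (rule ccontr)
    assume "m \<noteq> n"
    then have "m \<subset> n" using sub by auto
    then obtain y where y: "y \<in> n" "y \<notin> m" "\<And>a. a \<in> m \<Longrightarrow> bracket y a \<in> m"
      using normalizer_grows[OF N _ sub(1) n] by blast
    obtain p where "mpow y p = 0" using nil[OF y(1)] by (auto simp: nilpotent_def)
    from words_zero_extend[OF N sub(1) this y(3)]
    have w: "\<exists>N. words (span (insert y m)) N \<subseteq> {0}" by blast
    have br: "bracket a b \<in> m" if "a \<in> span (insert y m)" "b \<in> span (insert y m)" for a b
    proof -
      from span_insert_subspaceE[OF sub(1) that(1)] obtain c where c: "a - c *\<^sub>R y \<in> m" .
      from span_insert_subspaceE[OF sub(1) that(2)] obtain d where d: "b - d *\<^sub>R y \<in> m" .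
      define a' b' where "a' = a - c *\<^sub>R y" and "b' = b - d *\<^sub>R y"
      have a: "a = a' + c *\<^sub>R y" and b: "b = b' + d *\<^sub>R y" by (simp_all add: a'_def b'_def)
      have "bracket a b = bracket a' b' - d *\<^sub>R bracket y a' + c *\<^sub>R bracket y b'"
        by (simp add: a b mat_algebra algebra_simps)
      also have "\<dots> \<in> m"
      proof -
        have "a' \<in> m" "b' \<in> m" using c d by (simp_all add: a'_def b'_def)
        note mem = sub(3)[OF this] this[THEN y(3)]
        show ?thesis
          by (rule subspace_add[OF sub(1) subspace_diff[OF sub(1) mem(1) subspace_scale[OF sub(1) mem(2)]]
                subspace_scale[OF sub(1) mem(3)]])
      qed
      finally show ?thesis .
    qed
    have "P (span (insert y m))"
      unfolding P_def lie_subalgebra_def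
    proof (intro conjI ballI w)
      show "span (insert y m) \<subseteq> n" using y(1) sub(2,4) by (simp add: span_minimal)
      show "bracket a b \<in> span (insert y m)" if "a \<in> span (insert y m)" "b \<in> span (insert y m)" for a b
        using br[OF that] by (simp add: span_base)
    qed simp
    moreover have "dim m < dim (span (insert y m))"
    proof (rule dim_psubset)
      have "y \<in> span (insert y m)" "m \<subseteq> span (insert y m)" by (auto simp: span_base)
      then show "span m \<subset> span (span (insert y m))" using y(2) sub(1) by (auto simp: span_eq_iff[THEN iffD2])
    qed
    ultimately show False using m(2) by fastforce
  qed
  define k where "k = (LEAST k. words n k \<subseteq> {0})"
  have k: "words n k \<subseteq> {0}" unfolding k_def by (rule LeastI) (use N \<open>m = n\<close> in simp)
  have "(mat 1 :: real^'n^'n) \<noteq> 0" by (simp add: mat_def vec_eq_iff)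
  then have "k \<noteq> 0" using k by (cases k) auto
  then have "\<not> words n (k - 1) \<subseteq> {0}"
    using not_less_Least[of "k - 1" "\<lambda>k. words n k \<subseteq> {0}"] unfolding k_def by simp
  then obtain w where w: "w \<in> words n (k - 1)" "w \<noteq> 0" by blast
  then obtain u where u: "w *v u \<noteq> 0" by (metis matrix_eq matrix_vector_mult_0)
  have "x *v (w *v u) = 0" if "x \<in> n" for x
  proof -
    have "x ** w \<in> words n (Suc (k - 1))" using that w(1) by auto
    then have "x ** w = 0" using k \<open>k \<noteq> 0\<close> by auto
    then show ?thesis by (simp add: matrix_vector_mul_assoc)
  qed
  with u that show ?thesis by blast
qed

section \<open>Irreducible Lie algebras of matrices\<close>

definition Ad :: "real^'n^'n \<Rightarrow> real^'n^'n \<Rightarrow> real^'n^'n" where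
  "Ad g x = g ** x ** matrix_inv g"

lemma Ad_linear: "Ad g (x + y) = Ad g x + Ad g y" "Ad g (x - y) = Ad g x - Ad g y"
  "Ad g (c *\<^sub>R x) = c *\<^sub>R Ad g x" "Ad g 0 = 0"
  by (simp_all add: Ad_def mat_algebra)

lemma linear_Ad: "linear (Ad g)"
  by (rule linearI) (simp_all add: Ad_linear)

lemma matrix_inv_left: "invertible (g :: real^'n^'n) \<Longrightarrow> matrix_inv g ** g = mat 1"
  and matrix_inv_right: "invertible (g :: real^'n^'n) \<Longrightarrow> g ** matrix_inv g = mat 1"
  unfolding matrix_inv_def invertible_def by (metis (mono_tags, lifting) someI_ex)+

lemma matrix_inv_eqI:
  fixes g h :: "real^'n^'n"
  assumes "g ** h = mat 1"
  shows "invertible g" "matrix_inv g = h"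
proof -
  have hg: "h ** g = mat 1" using assms by (simp add: matrix_left_right_inverse)
  then show inv: "invertible g" using assms by (auto simp: invertible_def)
  have "matrix_inv g = matrix_inv g ** (g ** h)" by (simp add: assms)
  also have "\<dots> = h" using matrix_inv_left[OF inv] by (simp add: matrix_mul_assoc)
  finally show "matrix_inv g = h" .
qed

lemma trace_scaleR: "trace (c *\<^sub>R (A :: real^'n^'n)) = c * trace A"
  by (simp add: trace_def sum_distrib_left)

lemma Ad_mult:
  assumes "invertible (g :: real^'n^'n)"
  shows "Ad g (x ** y) = Ad g x ** Ad g y"
proof -
  have "matrix_inv g ** (g ** z) = z" for z :: "real^'n^'n"
    using matrix_inv_left[OF assms] by (metis matrix_mul_assoc matrix_mul_lid)
  then show ?thesis by (simp add: Ad_def mat_algebra)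
qed

lemma Ad_bracket: "invertible g \<Longrightarrow> Ad g (bracket x y) = bracket (Ad g x) (Ad g y)"
  by (simp add: Ad_linear Ad_mult)

lemma trace_Ad: "invertible g \<Longrightarrow> trace (Ad g x) = trace x"
  by (simp add: Ad_def) (metis matrix_inv_left matrix_mul_assoc matrix_mul_lid trace_mul_sym)

lemma Ad_inverse:
  assumes "invertible (g :: real^'n^'n)"
  shows "Ad (matrix_inv g) (Ad g x) = x" "Ad g (Ad (matrix_inv g) x) = x"
proof -
  have "matrix_inv (matrix_inv g) = g"
    using matrix_inv_left[OF assms] by (rule matrix_inv_eqI)
  then show "Ad (matrix_inv g) (Ad g x) = x" "Ad g (Ad (matrix_inv g) x) = x"
    using matrix_inv_left[OF assms] matrix_inv_right[OF assms]
    by (simp_all add: Ad_def mat_algebra) (simp_all add: matrix_mul_assoc)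
qed

definition derived :: "(real^'n^'n) set \<Rightarrow> (real^'n^'n) set" where
  "derived h = span {bracket a b | a b. a \<in> h \<and> b \<in> h}"

lemma bracket_in_derived: "a \<in> h \<Longrightarrow> b \<in> h \<Longrightarrow> bracket a b \<in> derived h"
  unfolding derived_def by (intro span_base) blast

lemma subspace_derived: "subspace (derived h)"
  by (simp add: derived_def)

lemma derived_subset: "lie_subalgebra h \<Longrightarrow> derived h \<subseteq> h"
  unfolding derived_def lie_subalgebra_def by (intro span_minimal) auto

lemma Ad_derived:
  assumes "invertible g" "\<And>x. x \<in> h \<Longrightarrow> Ad g x \<in> h" "x \<in> derived h"
  shows "Ad g x \<in> derived h"
  using assms(3) unfolding derived_def[of h]
proof (induction x rule: span_induct_alt)
  case (step c x y)
  then obtain a b where ab: "x = bracket a b" "a \<in> h" "b \<in> h" by blast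
  have "Ad g x \<in> derived h"
    using assms(2) ab by (simp add: Ad_bracket[OF assms(1)] bracket_in_derived)
  then show ?case
    using step(2) unfolding Ad_linear derived_def by (intro span_add span_scale)
qed (simp add: Ad_linear span_zero)

text \<open>The trace form is the Euclidean inner product twisted by transposition, so the matrices that are
  orthogonal to \<open>W\<close> form a subspace of complementary dimension. It meets \<open>W\<close> only in \<open>0\<close> and hence
  complements \<open>W\<close>.\<close>

lemma complement_of_nondegenerate_trace:
  fixes W :: "(real^'n^'n) set"
  assumes W: "subspace W" and nondeg: "\<And>x. x \<in> W \<Longrightarrow> (\<And>w. w \<in> W \<Longrightarrow> trace (x ** w) = 0) \<Longrightarrow> x = 0"
  obtains w where "w \<in> W" "\<And>v. v \<in> W \<Longrightarrow> trace ((x - w) ** v) = 0"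
proof -
  have inner: "trace (u ** v) = transpose v \<bullet> u" for u v :: "real^'n^'n"
    unfolding trace_def matrix_matrix_mult_def inner_vec_def transpose_def
    by (simp add: mult.commute)
  define T where "T = transpose ` W"
  define U where "U = {u. \<forall>t\<in>T. orthogonal t u}"
  have lin: "linear (transpose :: real^'n^'n \<Rightarrow> real^'n^'n)"
    by (rule linearI) (simp_all add: transpose_def vec_eq_iff)
  have T: "subspace T" unfolding T_def using lin W by (rule linear_subspace_image)
  have dimT: "dim T = dim W"
    unfolding T_def using lin by (rule dim_image_eq) (metis inj_onI transpose_transpose)
  have U: "subspace U" unfolding U_def by (rule subspace_orthogonal_to_vectors)
  have trU: "trace (u ** v) = 0" if "u \<in> U" "v \<in> W" for u v
    using that by (simp add: inner U_def T_def orthogonal_def)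
  have "dim U + dim T = DIM(real^'n^'n)"
    using dim_subspace_orthogonal_to_vectors[OF T subspace_UNIV] by (simp add: U_def dim_UNIV)
  moreover have "W \<inter> U = {0}"
    using nondeg trU subspace_0[OF W] subspace_0[OF U] by blast
  ultimately have "dim {a + b | a b. a \<in> W \<and> b \<in> U} = DIM(real^'n^'n)"
    using dim_sums_Int[OF W U] dimT by simp
  then have "span {a + b | a b. a \<in> W \<and> b \<in> U} = UNIV" by (simp only: dim_eq_full)
  then have "{a + b | a b. a \<in> W \<and> b \<in> U} = UNIV"
    using span_eq_iff[THEN iffD2, OF subspace_sums[OF W U]] by (rule trans[OF sym, rotated])
  then obtain a b where "x = a + b" "a \<in> W" "b \<in> U" by blast
  then show ?thesis using trU that[of a] by simp
qed

locale irreducible_matrix_group =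
  fixes G :: "(real^'n^'n) set"
  assumes one: "mat 1 \<in> G"
    and mult: "\<And>a b. a \<in> G \<Longrightarrow> b \<in> G \<Longrightarrow> a ** b \<in> G"
    and inv: "\<And>a. a \<in> G \<Longrightarrow> matrix_inv a \<in> G"
    and invertible: "\<And>a. a \<in> G \<Longrightarrow> invertible a"
    and irreducible: "acts_irreducibly G"
begin

lemma invariant_subspace:
  assumes "subspace V" "\<And>g v. g \<in> G \<Longrightarrow> v \<in> V \<Longrightarrow> g *v v \<in> V" "v \<in> V" "v \<noteq> 0"
  shows "u \<in> V"
  using irreducible assms unfolding acts_irreducibly_def by blast

text \<open>A Lie algebra that is normalised by an irreducible group is the sum of its centre and its derived
  algebra. Let \<open>N\<close> be the radical of the trace form on the derived algebra. By invariance of the form,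
  brackets of \<open>N\<close> with \<open>h\<close> are orthogonal to \<open>h\<close>, so Cartan's criterion shows that \<open>N\<close> consists of nilpotent
  matrices. Their common kernel is nonzero by Engel's theorem and invariant under \<open>G\<close>, hence
  everything, and \<open>N = 0\<close>. So the derived algebra has an orthogonal complement in \<open>h\<close>; brackets of it
  with \<open>h\<close> lie in \<open>N\<close>, that is, it is central.\<close>

theorem reductive_decomposition:
  assumes h: "lie_subalgebra h" and Adh: "\<And>g x. g \<in> G \<Longrightarrow> x \<in> h \<Longrightarrow> Ad g x \<in> h" and x: "x \<in> h"
  obtains w where "w \<in> derived h" "\<And>y. y \<in> h \<Longrightarrow> bracket (x - w) y = 0"
proof -
  let ?W = "derived h"
  have sub: "subspace h" and br: "\<And>a b. a \<in> h \<Longrightarrow> b \<in> h \<Longrightarrow> bracket a b \<in> h"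
    using h by (auto simp: lie_subalgebra_def)
  define N where "N = {x \<in> ?W. \<forall>w\<in>?W. trace (x ** w) = 0}"
  define r where "r = {x \<in> h. \<forall>z\<in>h. trace (x ** z) = 0}"
  have r: "subspace r"
    unfolding r_def using sub
    by (auto simp: subspace_def mat_algebra trace_add trace_scaleR)
  have subN: "subspace N"
    unfolding N_def using subspace_derived[of h]
    by (auto simp: subspace_def mat_algebra trace_add trace_scaleR)
  have Nh: "N \<subseteq> h" using derived_subset[OF h] by (auto simp: N_def)
  have nil: "nilpotent x" if x: "x \<in> N" for x
  proof (rule cartan_nilpotent[OF r, of h])
    show "r \<subseteq> h" by (auto simp: r_def)
    show "bracket x b \<in> r" if "b \<in> h" for b
      using that x Nh br unfolding r_def trace_bracket_cyclic
      by (auto simp: trace_bracket_cyclic N_def bracket_in_derived simp del: trace_sub)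
    fix y assume y: "\<And>b. b \<in> h \<Longrightarrow> bracket y b \<in> r"
    have "x \<in> ?W" using x by (simp add: N_def)
    then show "trace (x ** y) = 0"
      unfolding derived_def
    proof (induction x rule: span_induct_alt)
      case (step c u v)
      then obtain a b where ab: "u = bracket a b" "a \<in> h" "b \<in> h" by blast
      have "trace (bracket a b ** y) = trace (a ** bracket b y)" by (rule trace_bracket_cyclic)
      also have "\<dots> = trace (bracket b y ** a)" by (rule trace_mul_sym)
      also have "\<dots> = - trace (bracket y b ** a)"
        by (simp only: mat_mul_diff_right trace_sub minus_diff_eq)
      also have "\<dots> = 0" using y[OF ab(3)] ab(2) by (simp add: r_def)
      finally have "trace (u ** y) = 0" by (simp add: ab(1))
      with step(2) show ?case
        by (simp add: mat_mul_add_right mat_mul_scaleR trace_add trace_scaleR)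
    qed simp
  qed
  have lieN: "lie_subalgebra N"
    unfolding lie_subalgebra_def
  proof (intro conjI ballI subN)
    fix a b assume ab: "a \<in> N" "b \<in> N"
    have "trace (bracket a b ** w) = 0" if "w \<in> ?W" for w
    proof -
      have "w \<in> h" "b \<in> h" using that ab Nh derived_subset[OF h] by auto
      then have "bracket b w \<in> ?W" by (simp add: bracket_in_derived)
      then show ?thesis using ab unfolding trace_bracket_cyclic by (simp add: N_def)
    qed
    moreover have "bracket a b \<in> ?W" using ab Nh by (intro bracket_in_derived) auto
    ultimately show "bracket a b \<in> N" unfolding N_def by blast
  qed
  have AdN: "Ad g x \<in> N" if g: "g \<in> G" and x: "x \<in> N" for g x
  proof -
    have "trace (Ad g x ** w) = 0" if w: "w \<in> ?W" for w
    proof -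
      have "Ad (matrix_inv g) w \<in> ?W"
        using Ad_derived[OF _ _ w] inv[OF g] invertible Adh by blast
      then have "trace (x ** Ad (matrix_inv g) w) = 0" using x by (simp add: N_def)
      moreover have "Ad g (x ** Ad (matrix_inv g) w) = Ad g x ** w"
        using invertible[OF g] by (simp add: Ad_mult Ad_inverse)
      ultimately show ?thesis by (metis trace_Ad invertible[OF g])
    qed
    moreover have "Ad g x \<in> ?W"
      using Ad_derived[OF invertible[OF g] Adh[OF g]] x by (simp add: N_def)
    ultimately show ?thesis by (simp add: N_def)
  qed
  obtain v where v: "v \<noteq> 0" "\<And>x. x \<in> N \<Longrightarrow> x *v v = 0"
    using engel[OF lieN nil] by blast
  define V where "V = {v. \<forall>x\<in>N. x *v v = 0}"
  have "subspace V"
    by (auto simp: V_def subspace_def matrix_vector_right_distrib matrix_vector_mult_scaleR)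
  moreover have "g *v u \<in> V" if g: "g \<in> G" and u: "u \<in> V" for g u
    unfolding V_def
  proof (intro CollectI ballI)
    fix x assume "x \<in> N"
    then have "Ad (matrix_inv g) x *v u = 0" using AdN inv[OF g] u by (simp add: V_def)
    then have "g *v (Ad (matrix_inv g) x *v u) = 0" by simp
    moreover have "g ** Ad (matrix_inv g) x = x ** g"
    proof -
      have "g ** Ad (matrix_inv g) x = Ad g (Ad (matrix_inv g) x) ** g"
        using matrix_inv_left[OF invertible[OF g]] by (simp add: Ad_def flip: matrix_mul_assoc)
      then show ?thesis using invertible[OF g] by (simp add: Ad_inverse)
    qed
    ultimately show "x *v (g *v u) = 0" by (simp add: matrix_vector_mul_assoc)
  qed
  ultimately have "u \<in> V" for u
    using invariant_subspace[of V v u] v by (auto simp: V_def)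
  then have N0: "x = 0" if "x \<in> N" for x
    using that by (auto simp: V_def intro!: matrix_eq[THEN iffD2])
  obtain w where w: "w \<in> ?W" "\<And>v. v \<in> ?W \<Longrightarrow> trace ((x - w) ** v) = 0"
    using complement_of_nondegenerate_trace[OF subspace_derived, of h x] N0 by (auto simp: N_def)
  have z: "x - w \<in> h" using x w(1) derived_subset[OF h] sub by (auto intro: subspace_diff)
  have "bracket (x - w) y = 0" if y: "y \<in> h" for y
  proof (rule N0)
    have "trace (bracket (x - w) y ** v) = 0" if "v \<in> ?W" for v
      unfolding trace_bracket_cyclic
      using that derived_subset[OF h] y by (intro w(2) bracket_in_derived) auto
    then show "bracket (x - w) y \<in> N"
      unfolding N_def using bracket_in_derived[OF z y] by blast
  qed
  with w(1) show ?thesis by (rule that)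
qed

section \<open>Commuting families and Schur's lemma\<close>

definition commutant :: "(real^'n^'n) set" where
  "commutant = {a. \<forall>g\<in>G. a ** g = g ** a}"

lemma commutant_algebra:
  "a \<in> commutant \<Longrightarrow> b \<in> commutant \<Longrightarrow> a + b \<in> commutant"
  "a \<in> commutant \<Longrightarrow> b \<in> commutant \<Longrightarrow> a - b \<in> commutant"
  "a \<in> commutant \<Longrightarrow> b \<in> commutant \<Longrightarrow> a ** b \<in> commutant"
  "a \<in> commutant \<Longrightarrow> c *\<^sub>R a \<in> commutant"
  "mat 1 \<in> commutant"
  by (auto simp: commutant_def mat_algebra) (metis matrix_mul_assoc)

lemma commutant_no_zero_divisors:
  assumes a: "a \<in> commutant" and "a ** b = 0" "a \<noteq> 0"
  shows "b = 0"
proof -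
  have "v = 0" if "a *v v = 0" for v
  proof (rule ccontr)
    assume "v \<noteq> 0"
    have "u \<in> {v. a *v v = 0}" for u
    proof (rule invariant_subspace)
      show "subspace {v. a *v v = 0}"
        by (auto simp: subspace_def matrix_vector_right_distrib matrix_vector_mult_scaleR)
      fix g v assume gv: "g \<in> G" "v \<in> {v. a *v v = 0}"
      have "a *v (g *v v) = g *v (a *v v)"
        using a gv(1) by (simp add: commutant_def matrix_vector_mul_assoc)
      then show "g *v v \<in> {v. a *v v = 0}" using gv(2) by simp
    qed (use that \<open>v \<noteq> 0\<close> in auto)
    then show False using \<open>a \<noteq> 0\<close> by (auto simp: matrix_eq)
  qed
  moreover have "a *v (b *v u) = 0" for u
    using assms(2) by (simp add: matrix_vector_mul_assoc)
  ultimately show ?thesis by (auto simp: matrix_eq)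
qed

text \<open>A complex eigenvalue \<open>l\<close> of \<open>a\<close> makes the real quadratic polynomial with roots \<open>l\<close> and its conjugate
  singular at \<open>a\<close>, and the commutant has no zero divisors.\<close>

lemma commutant_quadratic:
  assumes a: "a \<in> commutant"
  obtains \<alpha> \<beta> where "(a - \<alpha> *\<^sub>R mat 1) ** (a - \<alpha> *\<^sub>R mat 1) + \<beta>\<^sup>2 *\<^sub>R mat 1 = 0"
proof -
  define A where "A = cmat a"
  obtain L P k where one: "mat 1 = (\<Sum>l\<in>L. P l)"
    and nil: "\<And>l. l \<in> L \<Longrightarrow> mpow (A - scl l (mat 1)) k ** P l = 0"
    using primary_decomposition[of A] by metis
  have "\<exists>l\<in>L. P l \<noteq> 0"
  proof (rule ccontr)
    assume "\<not> ?thesis"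
    then have "mat 1 $ i $ i = (0 :: complex^'n^'n) $ i $ i" for i by (simp add: one)
    then show False by (simp add: mat_def)
  qed
  then obtain l where l: "l \<in> L" "P l \<noteq> 0" by blast
  define q where "q = (a - Re l *\<^sub>R mat 1) ** (a - Re l *\<^sub>R mat 1) + (Im l)\<^sup>2 *\<^sub>R mat 1"
  have q: "q \<in> commutant" unfolding q_def using a by (intro commutant_algebra)
  let ?X = "A - scl l (mat 1)" and ?Y = "A - scl (cnj l) (mat 1)"
  have "cmat q = ?Y ** ?X"
  proof -
    define B where "B = A - scl (complex_of_real (Re l)) (mat 1)"
    define c where "c = \<i> * complex_of_real (Im l)"
    have l: "l = complex_of_real (Re l) + c" "cnj l = complex_of_real (Re l) - c"
      by (simp_all add: complex_eq_iff c_def)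
    have "?X = B - scl c (mat 1)" by (subst l(1)) (simp add: B_def scl_add)
    moreover have "?Y = B + scl c (mat 1)" by (subst l(2)) (simp add: B_def scl_add)
    moreover have "c * c = - (complex_of_real (Im l))\<^sup>2" by (simp add: c_def power2_eq_square complex_eq_iff)
    ultimately have "?Y ** ?X = B ** B + scl ((complex_of_real (Im l))\<^sup>2) (mat 1)"
      by (simp add: mat_algebra)
    then show ?thesis by (simp add: q_def A_def B_def cmat_linear cmat_mult)
  qed
  have XY: "?X ** ?Y = ?Y ** ?X" by (simp add: mat_algebra mult.commute)
  have "mpow (?Y ** ?X) j = mpow ?Y j ** mpow ?X j" for j
  proof (induction j)
    case (Suc j)
    have "?X ** mpow ?Y j = mpow ?Y j ** ?X"
      using mpow_commute[of ?Y ?X j] XY by simp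
    then have "(?X ** mpow ?Y j) ** mpow ?X j = (mpow ?Y j ** ?X) ** mpow ?X j"
      by (rule arg_cong)
    then have "?X ** (mpow ?Y j ** mpow ?X j) = mpow ?Y j ** (?X ** mpow ?X j)"
      by (simp only: matrix_mul_assoc)
    with Suc show ?case by (simp flip: matrix_mul_assoc)
  qed simp
  then have "mpow (cmat q) k ** P l = 0"
    using nil[OF l(1)] \<open>cmat q = ?Y ** ?X\<close> by (simp flip: matrix_mul_assoc)
  have "q = 0"
  proof (rule ccontr)
    assume "q \<noteq> 0"
    have inj: "w = 0" if "cmat q ** w = 0" for w :: "complex^'n^'n"
    proof -
      have "q ** Re_mat w = 0" "q ** Re_mat (scl (-\<i>) w) = 0"
        using that Re_mat_mult(1)[of q w] Re_mat_mult(1)[of q "scl (-\<i>) w"]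
        by (simp_all add: mat_mul_scl) (simp_all add: Re_mat_def vec_eq_iff)
      then have "Re_mat w = 0" "Re_mat (scl (-\<i>) w) = 0"
        using commutant_no_zero_divisors[OF q _ \<open>q \<noteq> 0\<close>] by blast+
      then show ?thesis by (simp add: Re_mat_def scl_def vec_eq_iff complex_eq_iff)
    qed
    have "mpow (cmat q) k ** w = 0 \<Longrightarrow> w = 0" for w :: "complex^'n^'n"
      by (induction k) (auto dest!: inj simp flip: matrix_mul_assoc)
    with \<open>mpow (cmat q) k ** P l = 0\<close> l(2) show False by blast
  qed
  then show ?thesis using that unfolding q_def by blast
qed

text \<open>The commuting family lies in a commutative division algebra, which is \<open>\<real>\<close> or \<open>\<real> + \<real> J\<close> with
  \<open>J\<^sup>2 = -1\<close>. In the second case \<open>E\<close> projects to the \<open>\<i>\<close>-eigenspace of \<open>J\<close>; in both cases the family acts on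
  the range of \<open>E\<close> by scalars, and faithfully.\<close>

theorem commuting_family_eigenprojection:
  assumes F: "F \<subseteq> commutant" and comm: "\<And>a b. a \<in> F \<Longrightarrow> b \<in> F \<Longrightarrow> a ** b = b ** a"
  obtains E where "E ** E = E" "\<And>g. g \<in> G \<Longrightarrow> E ** cmat g = cmat g ** E" "trace E \<noteq> 0"
    "\<And>a. a \<in> F \<Longrightarrow> \<exists>l. cmat a ** E = scl l E \<and> (a \<noteq> 0 \<longrightarrow> l \<noteq> 0)"
proof (cases "\<forall>a\<in>F. \<exists>c. a = c *\<^sub>R mat 1")
  case True
  show ?thesis
  proof (rule that[of "mat 1"])
    show "trace (mat 1 :: complex^'n^'n) \<noteq> 0" by (simp add: trace_def mat_def)
    fix a assume "a \<in> F"
    then obtain c where "a = c *\<^sub>R mat 1" using True by blast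
    then show "\<exists>l. cmat a ** mat 1 = scl l (mat 1) \<and> (a \<noteq> 0 \<longrightarrow> l \<noteq> 0)"
      by (intro exI[of _ "of_real c"]) (auto simp: cmat_linear)
  qed simp_all
next
  case False
  then obtain a0 where a0: "a0 \<in> F" "\<And>c. a0 \<noteq> c *\<^sub>R mat 1" by blast
  obtain \<alpha> \<beta> where q: "(a0 - \<alpha> *\<^sub>R mat 1) ** (a0 - \<alpha> *\<^sub>R mat 1) + \<beta>\<^sup>2 *\<^sub>R mat 1 = 0"
    using commutant_quadratic a0(1) F by blast
  have c0: "a0 - \<alpha> *\<^sub>R mat 1 \<in> commutant" using a0(1) F by (auto intro!: commutant_algebra)
  have "\<beta> \<noteq> 0"
  proof
    assume "\<beta> = 0"
    then have "a0 - \<alpha> *\<^sub>R mat 1 = 0" using commutant_no_zero_divisors[OF c0, of "a0 - \<alpha> *\<^sub>R mat 1"] q by auto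
    then show False using a0(2) by simp
  qed
  define J where "J = (1 / \<beta>) *\<^sub>R (a0 - \<alpha> *\<^sub>R mat 1)"
  have J: "J \<in> commutant" unfolding J_def using c0 by (rule commutant_algebra)
  have "(a0 - \<alpha> *\<^sub>R mat 1) ** (a0 - \<alpha> *\<^sub>R mat 1) = - (\<beta>\<^sup>2 *\<^sub>R mat 1)"
    using q by (simp add: add_eq_0_iff2)
  then have JJ: "J ** J = - mat 1"
    using \<open>\<beta> \<noteq> 0\<close> unfolding J_def mat_mul_scaleR by (simp add: power2_eq_square)
  have JF: "J ** a = a ** J" if "a \<in> F" for a
    using comm[OF a0(1) that] by (simp add: J_def mat_algebra)
  define K where "K = cmat J"
  have KK: "K ** K = - mat 1"
    unfolding K_def by (simp add: JJ flip: cmat_mult) (simp add: cmat_def mat_def vec_eq_iff)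
  define E where "E = scl (1/2) (mat 1 - scl \<i> K)"
  have KE: "K ** E = scl \<i> E"
    by (simp add: E_def mat_algebra KK)
  have "E ** X = scl (1/2) (X - scl \<i> (K ** X))" for X :: "complex^'n^'n"
    by (simp add: E_def mat_mul_scl mat_mul_diff_right)
  then have "E ** E = scl (1/2) (E - scl \<i> (K ** E))" .
  also have "\<dots> = scl (1/2) (E + E)" unfolding KE scl_simps(4) by (simp only: complex_i_mult_minus i_squared scl_add(6) scl_simps(1) diff_minus_eq_add)
  also have "\<dots> = E" unfolding scl_add(1) scl_add(3)[symmetric] by simp
  finally have EE: "E ** E = E" .
  show ?thesis
  proof (rule that[of E])
    show "E ** E = E" by (rule EE)
    fix g assume "g \<in> G"
    then have "K ** cmat g = cmat g ** K"
      unfolding K_def using J by (simp add: commutant_def flip: cmat_mult)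
    then show "E ** cmat g = cmat g ** E" by (simp add: E_def mat_algebra)
  next
    have "Im (trace K) = 0" by (simp add: K_def trace_def cmat_def)
    moreover have trE: "trace E = 1/2 * (of_nat CARD('n) - \<i> * trace K)"
      by (simp add: E_def trace_scl trace_sub) (simp add: trace_def mat_def)
    ultimately have "Re (trace E) = real CARD('n) / 2" unfolding trE by simp
    then show "trace E \<noteq> 0" by auto
  next
    fix a assume a: "a \<in> F"
    \<comment> \<open>\<open>b\<close> and \<open>\<delta> J\<close> have the same square, so \<open>(b - \<delta> J) (b + \<delta> J) = 0\<close>\<close>
    obtain \<gamma> \<delta> where q: "(a - \<gamma> *\<^sub>R mat 1) ** (a - \<gamma> *\<^sub>R mat 1) + \<delta>\<^sup>2 *\<^sub>R mat 1 = 0"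
      using commutant_quadratic a F by blast
    define b where "b = a - \<gamma> *\<^sub>R mat 1"
    have b: "b \<in> commutant" using a F unfolding b_def by (auto intro!: commutant_algebra)
    have "(b - \<delta> *\<^sub>R J) ** (b + \<delta> *\<^sub>R J) = b ** b + \<delta>\<^sup>2 *\<^sub>R mat 1"
    proof -
      have "J ** b = b ** J" using JF[OF a] by (simp add: b_def mat_algebra)
      then show ?thesis by (simp add: mat_algebra JJ power2_eq_square algebra_simps)
    qed
    also have "\<dots> = 0" using q by (simp add: b_def)
    finally have "b - \<delta> *\<^sub>R J = 0 \<or> b + \<delta> *\<^sub>R J = 0"
      using commutant_no_zero_divisors[of "b - \<delta> *\<^sub>R J"] b J by (auto intro: commutant_algebra)
    then obtain \<epsilon> where eps: "b = \<epsilon> *\<^sub>R J"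
      by (metis add_eq_0_iff2 eq_iff_diff_eq_0 scaleR_minus_left)
    define l where "l = complex_of_real \<gamma> + \<i> * complex_of_real \<epsilon>"
    have a_eq: "a = \<gamma> *\<^sub>R mat 1 + \<epsilon> *\<^sub>R J" using eps by (simp add: b_def algebra_simps)
    have "cmat a ** E = scl l E"
      by (simp add: a_eq cmat_linear mat_algebra KE l_def mult.commute flip: K_def)
    moreover have "a \<noteq> 0 \<longrightarrow> l \<noteq> 0"
      by (auto simp: l_def a_eq complex_eq_iff)
    ultimately show "\<exists>l. cmat a ** E = scl l E \<and> (a \<noteq> 0 \<longrightarrow> l \<noteq> 0)" by blast
  qed
qed

end

section \<open>Derivatives of determinant and inverse at the identity\<close>

lemma bounded_bilinear_mat_mul: "bounded_bilinear ((**) :: real^'n^'n \<Rightarrow> real^'n^'n \<Rightarrow> real^'n^'n)"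
  unfolding bilinear_conv_bounded_bilinear[symmetric] bilinear_def
  by (auto intro!: linearI simp: mat_algebra)

lemmas bounded_linear_mat_mul_left = bounded_bilinear.bounded_linear_right[OF bounded_bilinear_mat_mul]
lemmas bounded_linear_mat_mul_right = bounded_bilinear.bounded_linear_left[OF bounded_bilinear_mat_mul]

text \<open>A permutation other than the identity moves two indices, so its product of matrix entries vanishes
  to second order at the identity.\<close>

lemma has_derivative_det_mat_1:
  "(det has_derivative trace) (at (mat 1 :: 'a::real_normed_field^'n^'n))"
proof -
  let ?P = "{p. p permutes (UNIV :: 'n set)}"
  let ?D = "\<lambda>H :: 'a^'n^'n. \<Sum>p\<in>?P. of_int (sign p) *
      (\<Sum>i\<in>UNIV. H $ i $ p i * (\<Prod>j\<in>UNIV - {i}. mat 1 $ j $ p j))"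
  have "((\<lambda>A :: 'a^'n^'n. A $ i $ k) has_derivative (\<lambda>H. H $ i $ k)) (at (mat 1))" for i k
    by (intro bounded_linear_imp_has_derivative bounded_linear_compose[OF bounded_linear_vec_nth]
        bounded_linear_vec_nth)
  then have "(det has_derivative ?D) (at (mat 1))"
    unfolding det_def[abs_def]
    by (intro has_derivative_sum has_derivative_mult_right has_derivative_prod)
  moreover have "?D H = trace H" for H
  proof -
    have "(\<Sum>i\<in>UNIV. H $ i $ p i * (\<Prod>j\<in>UNIV - {i}. mat 1 $ j $ p j)) = (if p = id then trace H else 0)"
      if p: "p permutes UNIV" for p
    proof (cases "p = id")
      case True
      then show ?thesis by (simp add: trace_def mat_def)
    next
      case False
      have "(\<Prod>j\<in>UNIV - {i}. mat 1 $ j $ p j :: 'a) = 0" for i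
      proof (rule ccontr)
        assume "(\<Prod>j\<in>UNIV - {i}. mat 1 $ j $ p j :: 'a) \<noteq> 0"
        then have *: "p j = j" if "j \<noteq> i" for j
          using that by (auto simp: mat_def split: if_splits)
        have "p i = i" using * p permutes_inj[OF p] by (metis injD)
        with * have "p = id" by (intro ext) (metis id_apply)
        with False show False by simp
      qed
      with False show ?thesis by (simp only: mult_zero_right sum.neutral_const if_False)
    qed
    then have "?D H = (\<Sum>p\<in>?P. if p = id then trace H else 0)"
      by (intro sum.cong refl) auto
    also have "\<dots> = trace H" by (simp add: permutes_id finite_permutations)
    finally show ?thesis .
  qed
  ultimately show ?thesis by (metis (no_types, lifting) ext)
qed

lemma eventually_invertible: "\<forall>\<^sub>F a in nhds (mat 1 :: real^'n^'n). invertible a"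
proof -
  have "isCont det (mat 1 :: real^'n^'n)"
    using has_derivative_det_mat_1 by (rule has_derivative_continuous)
  then have "filterlim det (nhds (det (mat 1 :: real^'n^'n))) (nhds (mat 1 :: real^'n^'n))"
    unfolding isCont_def by (simp only: tendsto_at_iff_tendsto_nhds)
  then have "\<forall>\<^sub>F a in nhds (mat 1 :: real^'n^'n). det a \<in> - {0}"
    by (rule topological_tendstoD) auto
  then show ?thesis by (simp add: invertible_det_nz)
qed

text \<open>For \<open>b = (1 + h)\<^sup>-\<^sup>1\<close> the identity \<open>b = 1 - b h\<close> gives both a bound for \<open>b\<close> and, used twice,
  \<open>b = 1 - h + b h h\<close>.\<close>

lemma has_derivative_matrix_inv_mat_1:
  "(matrix_inv has_derivative (\<lambda>h. - h)) (at (mat 1 :: real^'n^'n))"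
proof -
  obtain C where C: "C > 0" "\<And>(a :: real^'n^'n) (b :: real^'n^'n). norm (a ** b) \<le> norm a * norm b * C"
    using bounded_bilinear.pos_bounded[OF bounded_bilinear_mat_mul[where 'n = 'n]] by blast
  obtain e where e: "e > 0" "\<And>a :: real^'n^'n. dist a (mat 1) < e \<Longrightarrow> invertible a"
    using eventually_invertible[where 'n = 'n] unfolding eventually_nhds_metric by blast
  define s where "s = norm (mat 1 :: real^'n^'n)"
  define d where "d = min e (1 / (2 * C))"
  have d: "d > 0" using e C by (simp add: d_def)
  have inv1: "matrix_inv (mat 1) = (mat 1 :: real^'n^'n)" by (rule matrix_inv_eqI) simp
  show ?thesis
  proof (rule has_derivativeI_sandwich[OF d])
    show "bounded_linear (\<lambda>h :: real^'n^'n. - h)" by (intro bounded_linear_minus bounded_linear_ident)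
    show "((\<lambda>a :: real^'n^'n. 2 * s * C * C * norm (a - mat 1)) \<longlongrightarrow> 0) (at (mat 1))"
      by (auto intro!: tendsto_eq_intros)
    fix a :: "real^'n^'n" assume a: "a \<noteq> mat 1" "dist a (mat 1) < d"
    define h where "h = a - mat 1"
    define b where "b = matrix_inv a"
    have "invertible a" using a(2) e(2) by (simp add: d_def)
    then have "b ** a = mat 1" unfolding b_def by (rule matrix_inv_left)
    then have b: "b = mat 1 - b ** h" by (simp add: h_def mat_algebra)
    have n: "norm (a - mat 1) > 0" using a(1) by simp
    have h: "norm h < 1 / (2 * C)" using a(2) by (simp add: h_def d_def dist_norm)
    have "norm b \<le> s + norm (b ** h)"
      unfolding s_def by (subst b) (rule norm_triangle_ineq4)
    also have "norm (b ** h) \<le> norm b * norm h * C" by (rule C(2))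
    also have "\<dots> \<le> norm b * (1 / 2)"
    proof -
      have "norm h * C \<le> 1 / 2" using h C(1) by (simp add: field_simps)
      then show ?thesis using mult_left_mono[of "norm h * C" "1/2" "norm b"] by (simp add: mult.assoc)
    qed
    finally have nb: "norm b \<le> 2 * s" by simp
    have "matrix_inv a - matrix_inv (mat 1) - - (a - mat 1) = b ** h ** h"
    proof -
      have bh: "b ** h = h - b ** h ** h" by (subst (1) b) (simp add: mat_algebra)
      have "b - mat 1 = - (b ** h)" by (subst (1) b) simp
      also have "\<dots> = - (h - b ** h ** h)" by (subst (1) bh) (rule refl)
      finally show ?thesis by (simp add: inv1 h_def[symmetric] b_def[symmetric])
    qed
    also have "norm (b ** h ** h) \<le> norm b * norm h * C * norm h * C"
      using C(2)[of "b ** h" h] mult_right_mono[OF C(2)[of b h], of "norm h * C"] C(1)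
      by (simp add: mult.assoc)
    also have "\<dots> \<le> 2 * s * norm h * C * norm h * C"
      using nb C(1) by (intro mult_right_mono) auto
    finally have "norm (matrix_inv a - matrix_inv (mat 1) - - (a - mat 1)) \<le> 2 * s * norm h * C * norm h * C" .
    then show "norm (matrix_inv a - matrix_inv (mat 1) - - (a - mat 1)) / norm (a - mat 1)
        \<le> 2 * s * C * C * norm (a - mat 1)"
      unfolding pos_divide_le_eq[OF n] by (simp add: h_def mult_ac)
  qed
qed

lemma matrix_inv_mult:
  fixes x a :: "real^'n^'n"
  assumes "invertible x" "invertible a"
  shows "matrix_inv (x ** a) = matrix_inv a ** matrix_inv x"
proof (rule matrix_inv_eqI)
  have "x ** a ** (matrix_inv a ** matrix_inv x) = x ** (a ** matrix_inv a) ** matrix_inv x"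
    by (simp add: matrix_mul_assoc)
  then show "x ** a ** (matrix_inv a ** matrix_inv x) = mat 1"
    using assms by (simp add: matrix_inv_right)
qed

lemma Ad_Ad: "invertible x \<Longrightarrow> invertible a \<Longrightarrow> Ad (x ** a) X = Ad x (Ad a X)"
  by (simp add: Ad_def matrix_inv_mult matrix_mul_assoc)

lemma isCont_matrix_inv:
  fixes a :: "real^'n^'n"
  assumes a: "invertible a"
  shows "isCont matrix_inv a"
proof -
  let ?t = "\<lambda>b. matrix_inv a ** b"
  have t: "isCont ?t a" by (intro linear_continuous_at bounded_linear_mat_mul_left)
  have a1: "?t a = mat 1" using a by (rule matrix_inv_left)
  have "isCont matrix_inv (mat 1 :: real^'n^'n)"
    using has_derivative_matrix_inv_mat_1 by (rule has_derivative_continuous)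
  then have "isCont (\<lambda>b. matrix_inv (?t b)) a"
    using isCont_o2[OF t] a1 by simp
  then have c: "isCont (\<lambda>b. matrix_inv (?t b) ** matrix_inv a) a"
    using isCont_o2[OF _ linear_continuous_at[OF bounded_linear_mat_mul_right[where 'n = 'n]]] by blast
  have "filterlim ?t (nhds (mat 1)) (nhds a)"
    using t[unfolded isCont_def tendsto_at_iff_tendsto_nhds] by (simp only: a1)
  then have "\<forall>\<^sub>F b in nhds a. invertible (?t b)"
    using eventually_invertible[where 'n = 'n] unfolding filterlim_iff by blast
  then have "\<forall>\<^sub>F b in nhds a. matrix_inv (?t b) ** matrix_inv a = matrix_inv b"
  proof eventually_elim
    case (elim b)
    have "a ** ?t b = b" using matrix_inv_right[OF a] by (simp add: matrix_mul_assoc)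
    then show ?case using matrix_inv_mult[OF a elim] by simp
  qed
  from isCont_cong[OF this] c show ?thesis by simp
qed

lemma has_derivative_Ad_mat_1:
  "((\<lambda>a. Ad a X) has_derivative (\<lambda>H. bracket H X)) (at (mat 1))"
proof -
  have inv1: "matrix_inv (mat 1) = (mat 1 :: real^'n^'n)" by (rule matrix_inv_eqI) simp
  have "((\<lambda>a. (a ** X) ** matrix_inv a) has_derivative
      (\<lambda>H. (mat 1 ** X) ** (- H) + (H ** X) ** matrix_inv (mat 1))) (at (mat 1))"
    by (rule bounded_bilinear.FDERIV[OF bounded_bilinear_mat_mul _ has_derivative_matrix_inv_mat_1])
      (intro bounded_linear_imp_has_derivative bounded_linear_mat_mul_right)
  then show ?thesis by (simp add: Ad_def inv1 mat_mul_minus_left)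
qed

lemma isCont_Ad: "invertible a \<Longrightarrow> isCont (\<lambda>a. Ad a X) a"
  unfolding Ad_def
  by (intro bounded_bilinear.continuous[OF bounded_bilinear_mat_mul] isCont_matrix_inv continuous_intros)

lemma derivative_along_tangent_direction:
  fixes F :: "'a::real_normed_vector \<Rightarrow> 'b::real_normed_vector"
  assumes F: "(F has_derivative D) (at x)" and Y: "Y \<longlonglongrightarrow> 0" "\<And>k. Y k \<noteq> 0"
    and lim: "(\<lambda>k. Y k /\<^sub>R norm (Y k)) \<longlonglongrightarrow> y"
    and const: "\<forall>\<^sub>F k in sequentially. F (x + Y k) = F x"
  shows "D y = 0"
proof -
  have lin: "bounded_linear D" using F by (rule has_derivative_bounded_linear)
  have "(\<lambda>h. norm (F (x + h) - F x - D h) / norm h) \<midarrow>0\<rightarrow> 0"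
    using F by (simp add: has_derivative_at)
  then have "(\<lambda>k. norm (F (x + Y k) - F x - D (Y k)) / norm (Y k)) \<longlonglongrightarrow> 0"
    by (rule filterlim_compose) (use Y in \<open>auto intro: filterlim_atI\<close>)
  moreover have "\<forall>\<^sub>F k in sequentially. norm (F (x + Y k) - F x - D (Y k)) / norm (Y k)
      = norm (D (Y k /\<^sub>R norm (Y k)))"
    using const
    by eventually_elim (simp add: linear_cmul[OF bounded_linear.linear[OF lin]] divide_inverse mult.commute)
  ultimately have "(\<lambda>k. norm (D (Y k /\<^sub>R norm (Y k)))) \<longlonglongrightarrow> 0"
    using tendsto_cong by fast
  moreover have "(\<lambda>k. norm (D (Y k /\<^sub>R norm (Y k)))) \<longlonglongrightarrow> norm (D y)"
    by (intro tendsto_norm bounded_linear.tendsto[OF lin] lim)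
  ultimately have "norm (D y) = 0" by (rule LIMSEQ_unique[symmetric])
  then show ?thesis by simp
qed

section \<open>The tangent space of an immersed Lie subgroup\<close>

lemma smooth_on_differentiable: "smooth_on f S \<Longrightarrow> x \<in> S \<Longrightarrow> f differentiable (at x)"
  unfolding smooth_on_def by (metis Ck_on.simps(2))

text \<open>A right inverse over \<open>W\<close> of the identity map, with values in \<open>W\<close>, is a projection to \<open>W\<close>.\<close>

lemma linear_projection_exists:
  fixes W :: "'a::real_vector set"
  assumes "subspace W"
  obtains p where "linear p" "\<And>x. p x \<in> W" "\<And>w. w \<in> W \<Longrightarrow> p w = w"
proof -
  have "linear (\<lambda>x :: 'a. x)" by (rule linearI) auto
  from linear_exists_right_inverse_on[OF this assms] show ?thesis using that by auto
qed

locale connected_lie_subgroup =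
  fixes G :: "(real^'n^'n) set"
    and T :: "(real^'n^'n) topology"
    and A :: "(real^'n^'n, 'e::real_normed_vector) chart set"
  assumes lie: "lie_subgroup_GL G T A" and conn: "connected_space T"
begin

lemma subgroup_G: "subgroup G GL"
  using lie by (simp add: lie_subgroup_GL_def)

lemma topspace_T: "topspace T = G"
  using lie by (simp add: lie_subgroup_GL_def lie_group_def)

lemma invertible_G: "a \<in> G \<Longrightarrow> invertible a"
  using subgroup.subset[OF subgroup_G] by (auto simp: GL_def)

lemma one_G: "mat 1 \<in> G"
  using subgroup.one_closed[OF subgroup_G] by (simp add: GL_def)

lemma mult_G: "a \<in> G \<Longrightarrow> b \<in> G \<Longrightarrow> a ** b \<in> G"
  using subgroup.m_closed[OF subgroup_G] by (simp add: GL_def)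

lemma inv_G:
  assumes "a \<in> G"
  shows "matrix_inv a \<in> G"
proof -
  have "inv\<^bsub>GL\<^esub> a \<in> G" using subgroup.m_inv_closed[OF subgroup_G assms] .
  moreover have "inv\<^bsub>GL\<^esub> a = matrix_inv a"
  proof (rule group.inv_equality[OF group_GL])
    have "invertible (matrix_inv a)"
      using matrix_inv_eqI(1)[OF matrix_inv_left[OF invertible_G[OF assms]]] .
    then show "matrix_inv a \<otimes>\<^bsub>GL\<^esub> a = \<one>\<^bsub>GL\<^esub>" "matrix_inv a \<in> carrier GL" "a \<in> carrier GL"
      using invertible_G[OF assms] by (simp_all add: GL_def matrix_inv_left)
  qed
  ultimately show ?thesis by simp
qed

text \<open>The local parametrisation that belongs to a chart.\<close>

abbreviation par :: "(real^'n^'n) set \<Rightarrow> (real^'n^'n \<Rightarrow> 'e) \<Rightarrow> 'e \<Rightarrow> real^'n^'n" where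
  "par U \<phi> \<equiv> inv_into U \<phi>"

lemma manifold: "smooth_manifold T A"
  using lie by (simp add: lie_subgroup_GL_def lie_group_def)

lemma chart:
  assumes "(U, \<phi>) \<in> A"
  shows "openin T U" "open (\<phi> ` U)" "U \<subseteq> G" "inj_on \<phi> U"
    "homeomorphic_map (subtopology T U) (top_of_set (\<phi> ` U)) \<phi>"
proof -
  have "is_chart T (U, \<phi>)" using manifold assms by (auto simp: smooth_manifold_def)
  then show 1: "openin T U" "open (\<phi> ` U)"
    "homeomorphic_map (subtopology T U) (top_of_set (\<phi> ` U)) \<phi>"
    by (auto simp: is_chart_def)
  show 2: "U \<subseteq> G" using openin_subset[OF 1(1)] topspace_T by simp
  show "inj_on \<phi> U"
    using homeomorphic_imp_injective_map[OF 1(3)] 2 topspace_T by (simp add: Int_absorb1)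
qed

lemma chart_exists:
  assumes "p \<in> G"
  obtains U \<phi> where "(U, \<phi>) \<in> A" "p \<in> U"
proof -
  have "p \<in> (\<Union>(U, \<phi>)\<in>A. U)" using manifold assms topspace_T by (simp add: smooth_manifold_def)
  then show ?thesis using that by auto
qed

lemma chart_image_open:
  assumes c: "(U, \<phi>) \<in> A" and V: "openin T V" "V \<subseteq> U"
  shows "open (\<phi> ` V)"
proof -
  have "openin (subtopology T U) V"
    using V chart(1)[OF c] by (simp add: openin_open_subtopology)
  then have "openin (top_of_set (\<phi> ` U)) (\<phi> ` V)"
    using homeomorphic_map_openness[OF chart(5)[OF c]] openin_subset by blast
  then show ?thesis using chart(2)[OF c] by (simp add: openin_open_eq)
qed

lemma par_mem: "(U, \<phi>) \<in> A \<Longrightarrow> u \<in> \<phi> ` U \<Longrightarrow> par U \<phi> u \<in> G"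
  using chart(3) inv_into_into[of u \<phi> U] by blast

lemma par_image_open:
  assumes c: "(U, \<phi>) \<in> A" and V: "open V" "V \<subseteq> \<phi> ` U"
  shows "openin T (par U \<phi> ` V)"
proof -
  have sub: "par U \<phi> ` V \<subseteq> U" using V(2) by (auto intro: inv_into_into)
  have "\<phi> ` (par U \<phi> ` V) = V"
    using V(2) by (force simp: image_image f_inv_into_f subset_iff)
  then have "openin (top_of_set (\<phi> ` U)) (\<phi> ` (par U \<phi> ` V))"
    using V by (simp add: open_subset)
  then have "openin (subtopology T U) (par U \<phi> ` V)"
    using homeomorphic_map_openness[OF chart(5)[OF c], of "par U \<phi> ` V"] sub chart(3)[OF c] topspace_T
    by (simp add: Int_absorb1)
  then show ?thesis using chart(1)[OF c] by (simp add: openin_open_subtopology)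
qed

lemma par_differentiable:
  assumes c: "(U, \<phi>) \<in> A" and u: "u \<in> \<phi> ` U"
  shows "(par U \<phi> has_derivative frechet_derivative (par U \<phi>) (at u)) (at u)"
proof -
  have "smooth_map T A GL_topology GL_atlas (\<lambda>M. M)"
    using lie by (simp add: lie_subgroup_GL_def immersion_def)
  then have "smooth_on (id \<circ> (\<lambda>M. M) \<circ> inv_into U \<phi>) (\<phi> ` (U \<inter> (\<lambda>M. M) -` carrier GL))"
    using c by (auto simp: smooth_map_def GL_atlas_def)
  moreover have "U \<inter> (\<lambda>M. M) -` carrier GL = U"
    using chart(3)[OF c] subgroup.subset[OF subgroup_G] by auto
  ultimately have "smooth_on (par U \<phi>) (\<phi> ` U)" by (simp add: comp_def)
  from smooth_on_differentiable[OF this u] show ?thesis by (simp only: frechet_derivative_works)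
qed

definition tangent :: "(real^'n^'n) set \<Rightarrow> (real^'n^'n \<Rightarrow> 'e) \<Rightarrow> real^'n^'n \<Rightarrow> (real^'n^'n) set" where
  "tangent U \<phi> p = range (frechet_derivative (par U \<phi>) (at (\<phi> p)))"

text \<open>In charts, the restriction of \<open>\<Lambda>\<close> to \<open>G\<close> is a differentiable map \<open>m\<close> with
  \<open>\<Lambda> \<circ> par V \<psi> = par W \<eta> \<circ> m\<close> near the point; differentiate this identity.\<close>

lemma tangent_map:
  fixes \<Lambda> :: "real^'n^'n \<Rightarrow> real^'n^'n"
  assumes V: "(V, \<psi>) \<in> A" "q \<in> V" and W: "(W, \<eta>) \<in> A" "\<Lambda> q \<in> W"
    and cont: "continuous_map T T \<Lambda>"
    and diff: "(\<lambda>v. \<eta> (\<Lambda> (par V \<psi> v))) differentiable (at (\<psi> q))"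
    and lin: "bounded_linear \<Lambda>" and Z: "Z \<in> tangent V \<psi> q"
  shows "\<Lambda> Z \<in> tangent W \<eta> (\<Lambda> q)"
proof -
  let ?m = "\<lambda>v. \<eta> (\<Lambda> (par V \<psi> v))" and ?v = "\<psi> q"
  let ?D = "frechet_derivative (par V \<psi>) (at ?v)" and ?E = "frechet_derivative (par W \<eta>) (at (\<eta> (\<Lambda> q)))"
  define N where "N = V \<inter> {p \<in> topspace T. \<Lambda> p \<in> W}"
  have "openin T N"
    unfolding N_def using chart(1)[OF V(1)] chart(1)[OF W(1)] cont
    by (intro openin_Int openin_continuous_map_preimage)
  then have op: "open (\<psi> ` N)" by (rule chart_image_open[OF V(1)]) (simp add: N_def)
  have q: "?v \<in> \<psi> ` N" using V W chart(3)[OF V(1)] topspace_T by (auto simp: N_def)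
  have pq: "par V \<psi> ?v = q" using V chart(4) by simp
  have eq: "par W \<eta> (?m v) = \<Lambda> (par V \<psi> v)" if "v \<in> \<psi> ` N" for v
  proof -
    from that obtain p where "v = \<psi> p" "p \<in> N" by blast
    then have "par V \<psi> v = p" "\<Lambda> p \<in> W" using V(1) chart(4) by (auto simp: N_def)
    then show ?thesis using chart(4)[OF W(1)] by simp
  qed
  obtain m' where m': "(?m has_derivative m') (at ?v)" using diff unfolding differentiable_def ..
  have "((\<lambda>v. par W \<eta> (?m v)) has_derivative (\<lambda>h. ?E (m' h))) (at ?v)"
  proof (rule has_derivative_compose[OF m'])
    show "(par W \<eta> has_derivative ?E) (at (?m ?v))"
      using par_differentiable[OF W(1)] W(2) by (simp add: pq)
  qed
  then have 1: "((\<lambda>v. \<Lambda> (par V \<psi> v)) has_derivative (\<lambda>h. ?E (m' h))) (at ?v)"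
    by (rule has_derivative_transform_within_open[OF _ op q eq])
  have 2: "((\<lambda>v. \<Lambda> (par V \<psi> v)) has_derivative (\<lambda>h. \<Lambda> (?D h))) (at ?v)"
    by (rule bounded_linear.has_derivative[OF lin par_differentiable[OF V(1)]]) (use V in auto)
  from Z obtain w where "Z = ?D w" by (auto simp: tangent_def)
  then have "\<Lambda> Z = ?E (m' w)" using fun_cong[OF has_derivative_unique[OF 2 1], of w] by simp
  then show ?thesis by (auto simp: tangent_def)
qed

lemma mult_smooth:
  "smooth_map (prod_topology T T) (prod_atlas A A) T A (\<lambda>(x, y). x ** y)"
proof -
  have "smooth_map (prod_topology T T) (prod_atlas A A) T A (\<lambda>(x, y). x \<otimes>\<^bsub>GL\<lparr>carrier := G\<rparr>\<^esub> y)"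
    using lie by (simp add: lie_subgroup_GL_def lie_group_def)
  then show ?thesis by (simp add: GL_def)
qed

lemma mult_chart_differentiable:
  assumes c: "(U, \<phi>) \<in> A" "a \<in> U" "(V, \<psi>) \<in> A" "b \<in> V" "(W, \<eta>) \<in> A" "a ** b \<in> W"
  shows "(\<lambda>z. \<eta> (par U \<phi> (fst z) ** par V \<psi> (snd z))) differentiable (at (\<phi> a, \<psi> b))"
proof -
  let ?f = "\<eta> \<circ> (\<lambda>(x, y). x ** y) \<circ> inv_into (U \<times> V) (map_prod \<phi> \<psi>)"
  have "(U \<times> V, map_prod \<phi> \<psi>) \<in> prod_atlas A A" using c by (auto simp: prod_atlas_def)
  then have "smooth_on ?f (map_prod \<phi> \<psi> ` ((U \<times> V) \<inter> (\<lambda>(x, y). x ** y) -` W))"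
    using mult_smooth c(5) by (auto simp: smooth_map_def)
  moreover have "(\<phi> a, \<psi> b) \<in> map_prod \<phi> \<psi> ` ((U \<times> V) \<inter> (\<lambda>(x, y). x ** y) -` W)"
    using c by (auto intro!: image_eqI[of _ _ "(a, b)"])
  ultimately have "?f differentiable (at (\<phi> a, \<psi> b))" by (rule smooth_on_differentiable)
  then obtain f' where f': "(?f has_derivative f') (at (\<phi> a, \<psi> b))"
    unfolding differentiable_def ..
  have op: "open (\<phi> ` U \<times> \<psi> ` V)" using chart(2) c by (intro open_Times) auto
  have mem: "(\<phi> a, \<psi> b) \<in> \<phi> ` U \<times> \<psi> ` V" using c by auto
  have eq: "?f z = \<eta> (par U \<phi> (fst z) ** par V \<psi> (snd z))" if "z \<in> \<phi> ` U \<times> \<psi> ` V" for z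
  proof -
    from that obtain x y where z: "z = map_prod \<phi> \<psi> (x, y)" "x \<in> U" "y \<in> V" by auto
    have "inj_on (map_prod \<phi> \<psi>) (U \<times> V)" using chart(4) c by (intro map_prod_inj_on) auto
    then have "inv_into (U \<times> V) (map_prod \<phi> \<psi>) z = (x, y)"
      unfolding z by (rule inv_into_f_f) (use z in auto)
    moreover have "par U \<phi> (fst z) = x" "par V \<psi> (snd z) = y"
      using z chart(4)[OF c(1)] chart(4)[OF c(3)] by auto
    ultimately show ?thesis by simp
  qed
  show ?thesis
    unfolding differentiable_def
    by (rule exI) (rule has_derivative_transform_within_open[OF f' op mem eq])
qed

lemma tangent_left_translate:
  assumes a: "a \<in> G" and V: "(V, \<psi>) \<in> A" "q \<in> V" and W: "(W, \<eta>) \<in> A" "a ** q \<in> W"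
    and Z: "Z \<in> tangent V \<psi> q"
  shows "a ** Z \<in> tangent W \<eta> (a ** q)"
proof (rule tangent_map[where \<Lambda> = "\<lambda>x. a ** x", OF V W _ _ bounded_linear_mat_mul_left Z])
  obtain U \<phi> where U: "(U, \<phi>) \<in> A" "a \<in> U" using chart_exists[OF a] .
  have "continuous_map T T ((\<lambda>(x, y). x ** y) \<circ> (\<lambda>y. (a, y)))"
    using mult_smooth a topspace_T
    by (intro continuous_map_compose[of _ "prod_topology T T"]) (auto simp: smooth_map_def continuous_map_pairedI)
  then show "continuous_map T T (\<lambda>x. a ** x)" by (simp add: comp_def)
  have "(\<lambda>v. (\<phi> a, v)) differentiable (at (\<psi> q))"
    by (auto simp: differentiable_def intro!: exI derivative_eq_intros)
  from differentiable_compose[OF _ this, OF mult_chart_differentiable[OF U V W]]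
  show "(\<lambda>v. \<eta> (a ** par V \<psi> v)) differentiable (at (\<psi> q))"
    using U chart(4)[OF U(1)] by (simp add: comp_def)
qed

lemma tangent_right_translate:
  assumes a: "a \<in> G" and V: "(V, \<psi>) \<in> A" "q \<in> V" and W: "(W, \<eta>) \<in> A" "q ** a \<in> W"
    and Z: "Z \<in> tangent V \<psi> q"
  shows "Z ** a \<in> tangent W \<eta> (q ** a)"
proof (rule tangent_map[where \<Lambda> = "\<lambda>x. x ** a", OF V W _ _ bounded_linear_mat_mul_right Z])
  obtain U \<phi> where U: "(U, \<phi>) \<in> A" "a \<in> U" using chart_exists[OF a] .
  have "continuous_map T T ((\<lambda>(x, y). x ** y) \<circ> (\<lambda>y. (y, a)))"
    using mult_smooth a topspace_T
    by (intro continuous_map_compose[of _ "prod_topology T T"]) (auto simp: smooth_map_def continuous_map_pairedI)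
  then show "continuous_map T T (\<lambda>x. x ** a)" by (simp add: comp_def)
  have "(\<lambda>v. (v, \<phi> a)) differentiable (at (\<psi> q))"
    by (auto simp: differentiable_def intro!: exI derivative_eq_intros)
  from differentiable_compose[OF _ this, OF mult_chart_differentiable[OF V U W]]
  show "(\<lambda>v. \<eta> (par V \<psi> v ** a)) differentiable (at (\<psi> q))"
    using U chart(4)[OF U(1)] by (simp add: comp_def)
qed

definition chart1 :: "(real^'n^'n, 'e) chart" where
  "chart1 = (SOME c. c \<in> A \<and> mat 1 \<in> fst c)"

abbreviation "U1 \<equiv> fst chart1"
abbreviation "\<phi>1 \<equiv> snd chart1"

lemma chart1: "(U1, \<phi>1) \<in> A" "mat 1 \<in> U1"
proof -
  obtain U \<phi> where "(U, \<phi>) \<in> A" "mat 1 \<in> U" using chart_exists[OF one_G] .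
  then have "\<exists>c. c \<in> A \<and> mat 1 \<in> fst c" by (intro exI[of _ "(U, \<phi>)"]) simp
  then have "chart1 \<in> A \<and> mat 1 \<in> fst chart1" unfolding chart1_def by (rule someI_ex)
  then show "(U1, \<phi>1) \<in> A" "mat 1 \<in> U1" by simp_all
qed

text \<open>The Lie algebra of \<open>G\<close>, as the tangent space at the identity inside the space of matrices.\<close>

definition lie_alg :: "(real^'n^'n) set" where
  "lie_alg = tangent U1 \<phi>1 (mat 1)"

lemma linear_chart1_derivative: "bounded_linear (frechet_derivative (par U1 \<phi>1) (at (\<phi>1 (mat 1))))"
  by (rule has_derivative_bounded_linear[OF par_differentiable[OF chart1(1)]]) (use chart1 in auto)

lemma subspace_lie_alg: "subspace lie_alg"
  unfolding lie_alg_def tangent_def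
  by (intro linear_subspace_image bounded_linear.linear linear_chart1_derivative subspace_UNIV)

lemma Ad_lie_alg:
  assumes x: "x \<in> G" and Z: "Z \<in> lie_alg"
  shows "Ad x Z \<in> lie_alg"
proof -
  obtain U \<phi> where U: "(U, \<phi>) \<in> A" "x \<in> U" using chart_exists[OF x] .
  have 1: "x ** Z \<in> tangent U \<phi> x"
    using tangent_left_translate[OF x chart1 U(1)] U(2) Z by (simp add: lie_alg_def)
  have "x ** matrix_inv x = mat 1" using invertible_G[OF x] by (rule matrix_inv_right)
  then show ?thesis
    using tangent_right_translate[OF inv_G[OF x] U chart1(1) _ 1] chart1(2) by (simp add: lie_alg_def Ad_def)
qed

text \<open>The tangent space of \<open>G\<close> at \<open>x\<close> is \<open>x\<close> times the Lie algebra. So in every chart the function \<open>F\<close> has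
  derivative zero and is locally constant, and \<open>G\<close> is connected. This is how the Lie algebra determines
  the group below: every step from infinitesimal to global information goes through this theorem.\<close>

theorem constant_on_G:
  fixes F :: "real^'n^'n \<Rightarrow> 'b::real_normed_vector"
  assumes F: "\<And>x. x \<in> G \<Longrightarrow> \<exists>D. ((\<lambda>a. F (x ** a)) has_derivative D) (at (mat 1)) \<and> (\<forall>Z\<in>lie_alg. D Z = 0)"
    and x: "x \<in> G"
  shows "F x = F (mat 1)"
proof -
  have loc: "\<exists>N. openin T N \<and> p0 \<in> N \<and> (\<forall>q\<in>N. F q = F p0)" if p0: "p0 \<in> G" for p0
  proof -
    obtain U \<phi> where U: "(U, \<phi>) \<in> A" "p0 \<in> U" using chart_exists[OF p0] .
    have deriv: "((\<lambda>v. F (par U \<phi> v)) has_derivative (\<lambda>_. 0)) (at u)" if u: "u \<in> \<phi> ` U" for u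
    proof -
      define p where "p = par U \<phi> u"
      have p: "p \<in> U" "\<phi> p = u" using u by (auto simp: p_def inv_into_into f_inv_into_f)
      then have pG: "p \<in> G" using chart(3)[OF U(1)] by auto
      obtain D where D: "((\<lambda>a. F (p ** a)) has_derivative D) (at (mat 1))" "\<And>Z. Z \<in> lie_alg \<Longrightarrow> D Z = 0"
        using F[OF pG] by blast
      let ?d = "frechet_derivative (par U \<phi>) (at u)"
      have d1: "((\<lambda>v. matrix_inv p ** par U \<phi> v) has_derivative (\<lambda>h. matrix_inv p ** ?d h)) (at u)"
        by (rule bounded_linear.has_derivative[OF bounded_linear_mat_mul_left par_differentiable[OF U(1) u]])
      have pp: "matrix_inv p ** par U \<phi> u = mat 1"
        using matrix_inv_left[OF invertible_G[OF pG]] by (simp add: p_def[symmetric])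
      have d2: "((\<lambda>a. F (p ** a)) has_derivative D) (at (matrix_inv p ** par U \<phi> u))"
        using D(1) by (simp only: pp)
      have "((\<lambda>v. F (p ** (matrix_inv p ** par U \<phi> v))) has_derivative
          (\<lambda>h. D (matrix_inv p ** ?d h))) (at u)"
        by (rule has_derivative_compose[OF d1 d2])
      moreover have "p ** (matrix_inv p ** y) = y" for y :: "real^'n^'n"
        using matrix_inv_right[OF invertible_G[OF pG]] by (simp add: matrix_mul_assoc)
      moreover have "D (matrix_inv p ** ?d h) = 0" for h
      proof (rule D(2))
        have "?d h \<in> tangent U \<phi> p" by (simp add: tangent_def p(2))
        moreover have "matrix_inv p ** p = mat 1" using pp by (simp add: p_def)
        ultimately show "matrix_inv p ** ?d h \<in> lie_alg"
          using tangent_left_translate[OF inv_G[OF pG] U(1) p(1) chart1(1), of "?d h"] chart1(2)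
          by (simp add: lie_alg_def)
      qed
      ultimately show ?thesis by simp
    qed
    have "\<phi> p0 \<in> \<phi> ` U" using U by blast
    then obtain e where e: "e > 0" "ball (\<phi> p0) e \<subseteq> \<phi> ` U"
      using chart(2)[OF U(1)] unfolding open_contains_ball by blast
    have p0': "par U \<phi> (\<phi> p0) = p0" using U chart(4) by simp
    have "\<exists>c. \<forall>v\<in>ball (\<phi> p0) e. F (par U \<phi> v) = c"
      by (rule has_derivative_zero_constant[OF convex_ball])
        (use deriv e has_derivative_at_withinI in blast)
    then obtain c where c: "\<And>v. v \<in> ball (\<phi> p0) e \<Longrightarrow> F (par U \<phi> v) = c" by blast
    have "F p0 = c" using c[of "\<phi> p0"] e(1) p0' by simp
    show ?thesis
    proof (intro exI conjI)
      show "openin T (par U \<phi> ` ball (\<phi> p0) e)" by (rule par_image_open[OF U(1) open_ball e(2)])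
      show "p0 \<in> par U \<phi> ` ball (\<phi> p0) e" using p0' e(1) by (intro image_eqI[of _ _ "\<phi> p0"]) auto
      show "\<forall>q\<in>par U \<phi> ` ball (\<phi> p0) e. F q = F p0" using c \<open>F p0 = c\<close> by auto
    qed
  qed
  define S where "S = {x \<in> G. F x = F (mat 1)}"
  have "openin T S"
    unfolding openin_subopen[of T S]
  proof
    fix p assume p: "p \<in> S"
    then have "p \<in> G" by (simp add: S_def)
    from loc[OF this] obtain N where N: "openin T N" "p \<in> N" "\<forall>q\<in>N. F q = F p" by blast
    have NG: "N \<subseteq> G" using openin_subset[OF N(1)] by (simp only: topspace_T)
    have "q \<in> S" if "q \<in> N" for q
      using N(3) that p NG unfolding S_def by (simp add: subset_iff)
    then have "N \<subseteq> S" by (rule subsetI)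
    with N(1,2) show "\<exists>N. openin T N \<and> p \<in> N \<and> N \<subseteq> S" by (intro exI conjI)
  qed
  moreover have "openin T (G - S)"
    unfolding openin_subopen[of T "G - S"]
  proof
    fix p assume p: "p \<in> G - S"
    then have "p \<in> G" by (simp add: S_def)
    from loc[OF this] obtain N where N: "openin T N" "p \<in> N" "\<forall>q\<in>N. F q = F p" by blast
    have NG: "N \<subseteq> G" using openin_subset[OF N(1)] by (simp only: topspace_T)
    have "q \<in> G - S" if "q \<in> N" for q
      using N(3) that p NG unfolding S_def by (simp add: subset_iff)
    then have "N \<subseteq> G - S" by (rule subsetI)
    with N(1,2) show "\<exists>N. openin T N \<and> p \<in> N \<and> N \<subseteq> G - S" by (intro exI conjI)
  qed
  then have "closedin T S" by (simp add: closedin_def topspace_T) (auto simp: S_def)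
  moreover have "mat 1 \<in> S" using one_G by (simp add: S_def)
  ultimately have "S = G" using conn topspace_T by (auto simp: connected_space_clopen_in)
  then show ?thesis using x by (auto simp: S_def)
qed

theorem tangent_curve:
  assumes "Z \<in> lie_alg"
  obtains \<gamma> :: "real \<Rightarrow> real^'n^'n" where "(\<gamma> has_derivative (\<lambda>t. t *\<^sub>R Z)) (at 0)" "\<gamma> 0 = mat 1"
    "\<forall>\<^sub>F t in nhds 0. \<gamma> t \<in> G"
proof -
  let ?u = "\<phi>1 (mat 1)" and ?D = "frechet_derivative (par U1 \<phi>1) (at (\<phi>1 (mat 1)))"
  obtain w where w: "Z = ?D w" using assms by (auto simp: lie_alg_def tangent_def)
  have u: "?u \<in> \<phi>1 ` U1" using chart1 by blast
  have l: "((\<lambda>t. ?u + t *\<^sub>R w) has_derivative (\<lambda>t. t *\<^sub>R w)) (at 0)"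
    by (auto intro!: derivative_eq_intros)
  have "((\<lambda>t. par U1 \<phi>1 (?u + t *\<^sub>R w)) has_derivative (\<lambda>t. ?D (t *\<^sub>R w))) (at 0)"
    by (rule has_derivative_compose[OF l]) (use par_differentiable[OF chart1(1) u] in simp)
  then have 1: "((\<lambda>t. par U1 \<phi>1 (?u + t *\<^sub>R w)) has_derivative (\<lambda>t. t *\<^sub>R Z)) (at 0)"
    by (simp add: w linear_cmul[OF bounded_linear.linear[OF linear_chart1_derivative]])
  have "((\<lambda>t. ?u + t *\<^sub>R w) \<longlongrightarrow> ?u + 0 *\<^sub>R w) (nhds 0)"
    by (intro tendsto_intros filterlim_ident)
  then have "\<forall>\<^sub>F t in nhds 0. ?u + t *\<^sub>R w \<in> \<phi>1 ` U1"
    using chart(2)[OF chart1(1)] u by (intro topological_tendstoD) auto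
  then have 2: "\<forall>\<^sub>F t in nhds 0. par U1 \<phi>1 (?u + t *\<^sub>R w) \<in> G"
    by eventually_elim (rule par_mem[OF chart1(1)])
  have 3: "par U1 \<phi>1 (?u + 0 *\<^sub>R w) = mat 1" using chart1 chart(4) by simp
  show ?thesis by (rule that[OF 1 3 2])
qed

text \<open>Let \<open>M\<close> be a linear right inverse of the derivative of the parametrisation at the identity, so that
  \<open>P\<close> is a projection to the Lie algebra. The map \<open>\<Psi>\<close> that multiplies the point of \<open>G\<close> with parameter \<open>M X\<close>
  by \<open>1 + (X - P X)\<close> has the identity as its derivative at \<open>0\<close>, so it maps neighbourhoods of \<open>0\<close> to
  neighbourhoods of the identity matrix.\<close>

theorem transversal_slice:
  obtains P where "linear P" "\<And>X. P X \<in> lie_alg" "\<And>Z. Z \<in> lie_alg \<Longrightarrow> P Z = Z"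
    "\<And>\<epsilon>. \<epsilon> > 0 \<Longrightarrow> \<exists>\<delta>>0. \<forall>a. dist a (mat 1) < \<delta> \<longrightarrow>
       (\<exists>x\<in>G. \<exists>Y. a = x ** (mat 1 + Y) \<and> P Y = 0 \<and> norm Y < \<epsilon>)"
proof -
  let ?u = "\<phi>1 (mat 1)" and ?D = "frechet_derivative (par U1 \<phi>1) (at (\<phi>1 (mat 1)))"
  have u: "?u \<in> \<phi>1 ` U1" using chart1 by blast
  note linD = linear_chart1_derivative
  obtain M where M: "linear M" "\<And>Z. Z \<in> lie_alg \<Longrightarrow> ?D (M Z) = Z"
    using linear_exists_right_inverse_on[OF bounded_linear.linear[OF linD] subspace_UNIV]
    by (auto simp: lie_alg_def tangent_def)
  have blM: "bounded_linear M" using M(1) by (simp add: linear_conv_bounded_linear)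
  define P where "P = (\<lambda>X. ?D (M X))"
  have blP: "bounded_linear P" unfolding P_def by (rule bounded_linear_compose[OF linD blM])
  have P: "P X \<in> lie_alg" "Z \<in> lie_alg \<Longrightarrow> P Z = Z" for X Z
    using M(2) by (auto simp: P_def lie_alg_def tangent_def)
  have PP: "P (X - P X) = 0" for X
    using P by (simp add: linear_diff[OF bounded_linear.linear[OF blP]])
  define S where "S = {X. ?u + M X \<in> \<phi>1 ` U1}"
  have contM: "continuous_on UNIV (\<lambda>X. ?u + M X)"
    by (intro continuous_intros linear_continuous_on blM)
  have S: "open S"
    using open_vimage[OF chart(2)[OF chart1(1)] contM] by (simp add: S_def vimage_def)
  define \<Psi> where "\<Psi> = (\<lambda>X. par U1 \<phi>1 (?u + M X) ** (mat 1 + (X - P X)))"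
  have M0: "M 0 = 0" "P 0 = 0" using linear_0[OF M(1)] linear_0[OF bounded_linear.linear[OF blP]] by auto
  have par1: "par U1 \<phi>1 ?u = mat 1" using chart1 chart(4) by simp
  have derM: "((\<lambda>X. ?u + M X) has_derivative M) (at X)" for X
    using bounded_linear_imp_has_derivative[OF blM] by (auto intro!: derivative_eq_intros)
  have derP: "((\<lambda>X. mat 1 + (X - P X)) has_derivative (\<lambda>H. H - P H)) (at X)" for X
    using bounded_linear_imp_has_derivative[OF blP] by (auto intro!: derivative_eq_intros)
  have der: "(\<Psi> has_derivative (\<lambda>H. par U1 \<phi>1 (?u + M X) ** (H - P H)
      + frechet_derivative (par U1 \<phi>1) (at (?u + M X)) (M H) ** (mat 1 + (X - P X)))) (at X)"
    if "X \<in> S" for X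
    unfolding \<Psi>_def
    by (rule bounded_bilinear.FDERIV[OF bounded_bilinear_mat_mul has_derivative_compose[OF derM] derP])
      (use par_differentiable[OF chart1(1)] that in \<open>simp add: S_def\<close>)
  have "0 \<in> S" using u by (simp add: S_def M0)
  have der0: "(\<Psi> has_derivative id) (at 0)"
  proof -
    have "?D (M H) = P H" for H by (simp add: P_def)
    then show ?thesis using der[OF \<open>0 \<in> S\<close>] by (simp add: M0 par1 id_def)
  qed
  have cont: "continuous_on S \<Psi>"
    using der by (intro continuous_at_imp_continuous_on ballI has_derivative_continuous) blast
  have "\<exists>\<delta>>0. \<forall>a. dist a (mat 1) < \<delta> \<longrightarrow>
       (\<exists>x\<in>G. \<exists>Y. a = x ** (mat 1 + Y) \<and> P Y = 0 \<and> norm Y < \<epsilon>)" if "\<epsilon> > 0" for \<epsilon>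
  proof -
    define R where "R = S \<inter> {X. norm (X - P X) < \<epsilon>}"
    have "open {X. norm (X - P X) < \<epsilon>}"
      by (intro open_Collect_less continuous_intros linear_continuous_on blP)
    then have R: "open R" using S by (simp add: R_def open_Int)
    have "0 \<in> R" using \<open>0 \<in> S\<close> \<open>\<epsilon> > 0\<close> by (simp add: R_def M0)
    then have "0 \<in> interior R" using R by (simp add: interior_open)
    from sussmann_open_mapping[OF S cont \<open>0 \<in> S\<close> der0 bounded_linear_ident _ _ this]
    have "\<Psi> 0 \<in> interior (\<Psi> ` R)" by (simp add: R_def id_def comp_def)
    moreover have "\<Psi> 0 = mat 1" by (simp add: \<Psi>_def M0 par1)
    ultimately obtain \<delta> where d: "\<delta> > 0" "ball (mat 1) \<delta> \<subseteq> \<Psi> ` R"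
      unfolding mem_interior by auto
    show ?thesis
    proof (intro exI[of _ \<delta>] conjI allI impI d(1))
      fix a :: "real^'n^'n" assume "dist a (mat 1) < \<delta>"
      then have "a \<in> ball (mat 1) \<delta>" by (simp add: dist_commute)
      then obtain X where X: "X \<in> R" "a = \<Psi> X" using d(2) by blast
      show "\<exists>x\<in>G. \<exists>Y. a = x ** (mat 1 + Y) \<and> P Y = 0 \<and> norm Y < \<epsilon>"
      proof (intro bexI exI conjI)
        show "a = par U1 \<phi>1 (?u + M X) ** (mat 1 + (X - P X))" using X by (simp add: \<Psi>_def)
        show "P (X - P X) = 0" by (rule PP)
        show "norm (X - P X) < \<epsilon>" using X by (simp add: R_def)
        show "par U1 \<phi>1 (?u + M X) \<in> G"
          using X by (intro par_mem[OF chart1(1)]) (simp add: R_def S_def)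
      qed
    qed
  qed
  with P bounded_linear.linear[OF blP] show ?thesis using that by blast
qed

end

section \<open>Directions in which the closure leaves the identity\<close>

context connected_lie_subgroup
begin

text \<open>The unit tangent directions at the identity of sequences in the closure of \<open>G\<close>.\<close>

definition closure_direction :: "real^'n^'n \<Rightarrow> bool" where
  "closure_direction y \<longleftrightarrow> (\<exists>Y. Y \<longlonglongrightarrow> 0 \<and> (\<forall>k. Y k \<noteq> 0) \<and>
     (\<lambda>k. Y k /\<^sub>R norm (Y k)) \<longlonglongrightarrow> y \<and> (\<forall>k. mat 1 + Y k \<in> closure G))"

text \<open>A function that is constant on \<open>G\<close> is constant on its closure near the identity. So its derivative
  vanishes not only on the Lie algebra but in all directions in which the closure leaves the identity.\<close>

lemma derivative_zero_along_closure_direction: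
  fixes F :: "real^'n^'n \<Rightarrow> 'b::real_normed_vector"
  assumes F: "\<And>x. x \<in> G \<Longrightarrow> \<exists>D. ((\<lambda>a. F (x ** a)) has_derivative D) (at (mat 1)) \<and> (\<forall>Z\<in>lie_alg. D Z = 0)"
    and cont: "\<forall>\<^sub>F a in nhds (mat 1). isCont F a"
    and D: "(F has_derivative D) (at (mat 1))" and y: "closure_direction y"
  shows "D y = 0"
proof -
  obtain Y where Y: "Y \<longlonglongrightarrow> 0" "\<And>k. Y k \<noteq> 0" "(\<lambda>k. Y k /\<^sub>R norm (Y k)) \<longlonglongrightarrow> y"
    "\<And>k. mat 1 + Y k \<in> closure G"
    using y unfolding closure_direction_def by blast
  have "(\<lambda>k. mat 1 + Y k) \<longlonglongrightarrow> mat 1 + 0" by (intro tendsto_intros Y(1))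
  then have "(\<lambda>k. mat 1 + Y k) \<longlonglongrightarrow> mat 1" by simp
  from eventually_compose_filterlim[OF cont this]
  have "\<forall>\<^sub>F k in sequentially. isCont F (mat 1 + Y k)" .
  then have "\<forall>\<^sub>F k in sequentially. F (mat 1 + Y k) = F (mat 1)"
  proof eventually_elim
    case (elim k)
    obtain g where g: "\<And>n. g n \<in> G" "g \<longlonglongrightarrow> mat 1 + Y k"
      using Y(4)[of k] unfolding closure_sequential by blast
    have "(\<lambda>n. F (g n)) \<longlonglongrightarrow> F (mat 1 + Y k)" by (rule isCont_tendsto_compose[OF elim g(2)])
    moreover have "F (g n) = F (mat 1)" for n using F g(1) by (rule constant_on_G)
    ultimately show ?case by (simp add: LIMSEQ_const_iff)
  qed
  then show ?thesis by (rule derivative_along_tangent_direction[OF D Y(1,2,3)])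
qed

lemma derivative_zero_on_tangent:
  fixes F :: "real^'n^'n \<Rightarrow> 'b::real_normed_vector"
  assumes D: "(F has_derivative D) (at (mat 1))" and F: "\<And>x. x \<in> G \<Longrightarrow> F x = 0" and Z: "Z \<in> lie_alg"
  shows "D Z = 0"
proof -
  obtain \<gamma> where g: "(\<gamma> has_derivative (\<lambda>t. t *\<^sub>R Z)) (at 0)" "\<gamma> 0 = mat 1" "\<forall>\<^sub>F t in nhds (0::real). \<gamma> t \<in> G"
    using tangent_curve[OF Z] by blast
  have "(F has_derivative D) (at (\<gamma> 0))" using D by (simp only: g(2))
  from has_derivative_compose[OF g(1) this]
  have 1: "((\<lambda>t. F (\<gamma> t)) has_derivative (\<lambda>t. D (t *\<^sub>R Z))) (at 0)" .
  obtain S where S: "open S" "0 \<in> S" "\<And>t. t \<in> S \<Longrightarrow> \<gamma> t \<in> G"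
    using g(3) unfolding eventually_nhds by blast
  have 2: "((\<lambda>t. F (\<gamma> t)) has_derivative (\<lambda>_. 0)) (at 0)"
    by (rule has_derivative_transform_within_open[OF has_derivative_const S(1,2)]) (use F S(3) in auto)
  show ?thesis using fun_cong[OF has_derivative_unique[OF 1 2], of 1] by simp
qed

lemma Ad_mat_1: "Ad (mat 1) X = (X :: real^'n^'n)"
proof -
  have "matrix_inv (mat 1) = (mat 1 :: real^'n^'n)" by (rule matrix_inv_eqI) simp
  then show ?thesis by (simp add: Ad_def)
qed

text \<open>Apply the preceding principle for functions that are constant on \<open>G\<close> to the map sending \<open>a\<close> to the class of \<open>a X a\<^sup>-\<^sup>1\<close> modulo \<open>W\<close>, whose derivative at the
  identity is the class of the bracket with \<open>X\<close>. The quotient by \<open>W\<close> is realised as the kernel of a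
  projection to \<open>W\<close>.\<close>

lemma Ad_modulo_subspace:
  fixes W :: "(real^'n^'n) set"
  assumes W: "subspace W" "\<And>x w. x \<in> G \<Longrightarrow> w \<in> W \<Longrightarrow> Ad x w \<in> W"
    and X: "\<And>Z. Z \<in> lie_alg \<Longrightarrow> bracket Z X \<in> W"
  shows "x \<in> G \<Longrightarrow> Ad x X - X \<in> W" "closure_direction y \<Longrightarrow> bracket y X \<in> W"
proof -
  obtain p where p: "linear p" "\<And>x. p x \<in> W" "\<And>w. w \<in> W \<Longrightarrow> p w = w"
    using linear_projection_exists[OF W(1)] by blast
  define Q where "Q = (\<lambda>x. x - p x)"
  have Q: "linear Q" unfolding Q_def using p(1) by (intro linear_compose_sub linear_ident)
  have Q0: "Q x = 0 \<longleftrightarrow> x \<in> W" for x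
    unfolding Q_def using p(2)[of x] p(3)[of x] by auto
  define F where "F = (\<lambda>a. Q (Ad a X))"
  obtain S where S: "open S" "mat 1 \<in> S" "\<And>a. a \<in> S \<Longrightarrow> invertible (a :: real^'n^'n)"
    using eventually_invertible[where 'n = 'n] unfolding eventually_nhds by blast
  have der: "((\<lambda>a. F (x ** a)) has_derivative (\<lambda>H. Q (Ad x (bracket H X)))) (at (mat 1))"
    if x: "x \<in> G" for x
  proof -
    have "linear (\<lambda>M. Q (Ad x M))" using linear_compose[OF linear_Ad Q] by (simp add: comp_def)
    then have "bounded_linear (\<lambda>M. Q (Ad x M))" by (simp add: linear_conv_bounded_linear)
    from bounded_linear.has_derivative[OF this has_derivative_Ad_mat_1[of X]]
    show ?thesis
    proof (rule has_derivative_transform_within_open[OF _ S(1,2)])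
      show "Q (Ad x (Ad a X)) = F (x ** a)" if "a \<in> S" for a
        using Ad_Ad[OF invertible_G[OF x] S(3)[OF that]] by (simp add: F_def)
    qed
  qed
  have F: "\<exists>D. ((\<lambda>a. F (x ** a)) has_derivative D) (at (mat 1)) \<and> (\<forall>Z\<in>lie_alg. D Z = 0)" if x: "x \<in> G" for x
  proof (intro exI conjI ballI)
    show "((\<lambda>a. F (x ** a)) has_derivative (\<lambda>H. Q (Ad x (bracket H X)))) (at (mat 1))" by (rule der[OF x])
    show "Q (Ad x (bracket Z X)) = 0" if "Z \<in> lie_alg" for Z
      unfolding Q0 by (rule W(2)[OF x X[OF that]])
  qed
  show "Ad x X - X \<in> W" if x: "x \<in> G"
  proof -
    have "F x = F (mat 1)" using F x by (rule constant_on_G)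
    then have "Q (Ad x X - X) = 0" by (simp add: F_def Ad_mat_1 linear_diff[OF Q])
    then show ?thesis by (simp only: Q0)
  qed
  show "bracket y X \<in> W" if y: "closure_direction y"
  proof -
    have blQ: "bounded_linear Q" using Q by (simp add: linear_conv_bounded_linear)
    have "\<forall>\<^sub>F a in nhds (mat 1). isCont F a"
      using eventually_invertible
    proof eventually_elim
      case (elim a)
      show ?case unfolding F_def
        by (rule isCont_o2[OF isCont_Ad[OF elim] linear_continuous_at[OF blQ]])
    qed
    moreover have "(F has_derivative (\<lambda>H. Q (bracket H X))) (at (mat 1))"
      using der[OF one_G] by (simp add: Ad_mat_1)
    ultimately have "Q (bracket y X) = 0"
      using derivative_zero_along_closure_direction[where F = F, OF F _ _ y] by simp
    then show ?thesis by (simp only: Q0)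
  qed
qed

lemma lie_subalgebra_lie_alg: "lie_subalgebra lie_alg"
  unfolding lie_subalgebra_def
proof (intro conjI ballI subspace_lie_alg)
  fix Z X assume ZX: "Z \<in> lie_alg" "X \<in> lie_alg"
  obtain p where p: "linear p" "\<And>x. p x \<in> lie_alg" "\<And>w. w \<in> lie_alg \<Longrightarrow> p w = w"
    using linear_projection_exists[OF subspace_lie_alg] by blast
  have "linear (\<lambda>x. x - p x)" using p(1) by (intro linear_compose_sub linear_ident)
  then have bl: "bounded_linear (\<lambda>x. x - p x)" by (simp add: linear_conv_bounded_linear)
  have "bracket Z X - p (bracket Z X) = 0"
  proof (rule derivative_zero_on_tangent[OF bounded_linear.has_derivative[OF bl has_derivative_Ad_mat_1] _ ZX(1)])
    show "Ad x X - p (Ad x X) = 0" if "x \<in> G" for x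
      using p(3)[OF Ad_lie_alg[OF that ZX(2)]] by simp
  qed
  then show "bracket Z X \<in> lie_alg" using p(2)[of "bracket Z X"] by simp
qed

end

section \<open>The determinant on an invariant complex subspace\<close>

text \<open>For \<open>w \<noteq> 0\<close> this is \<open>\<bar>w\<bar>\<^sup>\<alpha> w\<^sup>k\<close>, a homomorphism from the nonzero complex numbers to themselves.\<close>

definition log_power :: "complex \<Rightarrow> nat \<Rightarrow> complex \<Rightarrow> complex" where
  "log_power \<alpha> k w = exp (\<alpha> * of_real (ln (cmod w))) * w ^ k"

lemma log_power_mult: "v \<noteq> 0 \<Longrightarrow> w \<noteq> 0 \<Longrightarrow> log_power \<alpha> k (v * w) = log_power \<alpha> k v * log_power \<alpha> k w"
  by (simp add: log_power_def norm_mult ln_mult exp_add power_mult_distrib algebra_simps)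

lemma has_derivative_log_power:
  "(log_power \<alpha> k has_derivative (\<lambda>h. \<alpha> * of_real (Re h) + of_nat k * h)) (at 1)"
proof -
  have "(cmod has_derivative Re) (at 1)"
    using has_derivative_norm[of "1 :: complex"] by (simp add: inner_complex_def)
  then have "((\<lambda>w. ln (cmod w)) has_derivative (\<lambda>h. Re h)) (at 1)"
    by (auto intro!: derivative_eq_intros)
  then have "((\<lambda>w. complex_of_real (ln (cmod w))) has_derivative (\<lambda>h. of_real (Re h))) (at 1)"
    by (rule has_derivative_of_real)
  then have 1: "((\<lambda>w. \<alpha> * complex_of_real (ln (cmod w))) has_derivative (\<lambda>h. \<alpha> * of_real (Re h))) (at 1)"
    by (rule has_derivative_mult_right)
  have "(exp has_derivative (*) (exp (\<alpha> * complex_of_real (ln (cmod 1))))) (at (\<alpha> * complex_of_real (ln (cmod 1))))"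
    using DERIV_exp by (simp only: has_field_derivative_def)
  from has_derivative_compose[OF 1 this]
  have 2: "((\<lambda>w. exp (\<alpha> * complex_of_real (ln (cmod w)))) has_derivative (\<lambda>h. \<alpha> * of_real (Re h))) (at 1)"
    by simp
  have 3: "((\<lambda>w :: complex. w ^ k) has_derivative (\<lambda>h. of_nat k * h)) (at 1)"
    using DERIV_power[OF DERIV_ident, of k "1 :: complex" UNIV] by (simp add: has_field_derivative_def)
  from has_derivative_mult[OF 2 3] show ?thesis
    by (simp add: log_power_def[abs_def] add.commute)
qed

lemma isCont_log_power: "w \<noteq> 0 \<Longrightarrow> isCont (log_power \<alpha> k) w"
  unfolding log_power_def[abs_def] by (intro continuous_intros) auto

text \<open>The derivative at \<open>1\<close> of a suitable homomorphism has the line through \<open>c\<close> as its exact kernel. This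
  expresses that the one-parameter subgroup generated by \<open>c\<close> (a point, a circle, a ray or a spiral) is
  closed in the group of nonzero complex numbers.\<close>

lemma log_power_with_kernel:
  obtains \<alpha> :: complex and k where "\<And>h. \<alpha> * of_real (Re h) + of_nat k * h = 0 \<longleftrightarrow> (\<exists>r. h = r *\<^sub>R c)"
proof -
  consider "c = 0" | "c \<noteq> 0" "Re c = 0" | "Re c \<noteq> 0" by blast
  then show ?thesis
  proof cases
    case 1
    then show ?thesis by (intro that[of 0 1]) simp
  next
    case 2
    then have "Im c \<noteq> 0" by (simp add: complex_eq_iff)
    have "1 * of_real (Re h) + of_nat 0 * h = 0 \<longleftrightarrow> (\<exists>r. h = r *\<^sub>R c)" for h :: complex
    proof
      assume "1 * of_real (Re h) + of_nat 0 * h = 0"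
      then have "h = (Im h / Im c) *\<^sub>R c" using 2 \<open>Im c \<noteq> 0\<close> by (simp add: complex_eq_iff)
      then show "\<exists>r. h = r *\<^sub>R c" ..
    qed (use 2 in auto)
    then show ?thesis by (rule that)
  next
    case 3
    have "(- c / of_real (Re c)) * of_real (Re h) + of_nat 1 * h = 0 \<longleftrightarrow> (\<exists>r. h = r *\<^sub>R c)" for h
    proof
      assume "(- c / of_real (Re c)) * of_real (Re h) + of_nat 1 * h = 0"
      then have "h = (Re h / Re c) *\<^sub>R c" by (simp add: scaleR_conv_of_real mult.commute)
      then show "\<exists>r. h = r *\<^sub>R c" ..
    next
      assume "\<exists>r. h = r *\<^sub>R c"
      then obtain r where "h = r *\<^sub>R c" ..
      then show "(- c / of_real (Re c)) * of_real (Re h) + of_nat 1 * h = 0"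
        using 3 by (simp add: scaleR_conv_of_real)
    qed
    then show ?thesis by (rule that)
  qed
qed

text \<open>Two independent elements of \<open>S\<close> would span the plane. The subspace \<open>0\<close> is covered by \<open>c = 0\<close>.\<close>

lemma proper_subspace_of_complex:
  assumes S: "subspace (S :: complex set)" and h: "h \<notin> S"
  obtains c where "c \<in> S" "\<And>s. s \<in> S \<Longrightarrow> \<exists>r. s = r *\<^sub>R c"
proof (cases "S \<subseteq> {0}")
  case True
  then show ?thesis using that[of 0] subspace_0[OF S] by auto
next
  case False
  then obtain c where c: "c \<in> S" "c \<noteq> 0" by blast
  have "\<exists>r. s = r *\<^sub>R c" if s: "s \<in> S" for s
  proof -
    have "Im (s / c) = 0"
    proof (rule ccontr)
      assume t: "Im (s / c) \<noteq> 0"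
      define b where "b = Im (h / c) / Im (s / c)"
      define a where "a = Re (h / c) - b * Re (s / c)"
      have hc: "h / c = of_real a + of_real b * (s / c)"
      proof -
        have "u = of_real (Re u - Im u / Im v * Re v) + of_real (Im u / Im v) * v" if "Im v \<noteq> 0" for u v
          using that by (simp add: complex_eq_iff)
        then show ?thesis using t unfolding a_def b_def .
      qed
      have "h = (h / c) * c" using c(2) by simp
      also have "\<dots> = (of_real a + of_real b * (s / c)) * c" by (simp only: hc)
      also have "\<dots> = a *\<^sub>R c + b *\<^sub>R s" using c(2) by (simp add: scaleR_conv_of_real distrib_right)
      finally have "h = a *\<^sub>R c + b *\<^sub>R s" .
      then show False using h S s c(1) by (simp add: subspace_add subspace_scale)
    qed
    then have sc: "s / c = of_real (Re (s / c))" by (simp add: complex_eq_iff)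
    have "s = (s / c) * c" using c(2) by simp
    also have "\<dots> = Re (s / c) *\<^sub>R c" by (subst sc) (simp add: scaleR_conv_of_real)
    finally have "s = Re (s / c) *\<^sub>R c" .
    then show ?thesis ..
  qed
  with c(1) show ?thesis by (rule that)
qed

text \<open>For a matrix \<open>x\<close> that commutes with the projection \<open>E\<close>, the trace of \<open>x\<close> on the range of \<open>E\<close>.\<close>

definition ctrace :: "complex^'n^'n \<Rightarrow> real^'n^'n \<Rightarrow> complex" where
  "ctrace E x = trace (cmat x ** E)"

lemma linear_ctrace: "linear (ctrace E)"
  by (rule linearI) (simp_all add: ctrace_def cmat_linear mat_algebra trace_add trace_scl scaleR_conv_of_real[where 'a = complex])

context connected_lie_subgroup
begin

text \<open>Let \<open>\<delta>\<close> be the determinant of the compression to the range of \<open>E\<close>, extended by the identity on the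
  kernel of \<open>E\<close>. It is multiplicative as soon as one factor commutes with \<open>E\<close>, and its derivative at
  the identity is \<open>ctrace E\<close>. The principle is applied to its composition with a homomorphism of the
  nonzero complex numbers.\<close>

lemma ctrace_closure_direction:
  assumes E: "E ** E = E" "\<And>g. g \<in> G \<Longrightarrow> E ** cmat g = cmat g ** E"
    and Z: "\<And>Z. Z \<in> lie_alg \<Longrightarrow> \<alpha> * of_real (Re (ctrace E Z)) + of_nat k * ctrace E Z = 0"
    and y: "closure_direction y"
  shows "\<alpha> * of_real (Re (ctrace E y)) + of_nat k * ctrace E y = 0"
proof -
  define m where "m = (\<lambda>a. E ** cmat a ** E + (mat 1 - E))"
  define \<delta> where "\<delta> = (\<lambda>a. det (m a))"
  have m1: "m (mat 1) = mat 1" by (simp add: m_def cmat_linear E)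
  have EX: "E ** (E ** X) = E ** X" for X :: "complex^'n^'n" by (simp add: matrix_mul_assoc E)
  have m_mult: "m (x ** a) = m x ** m a" if "x \<in> G" for x a
  proof -
    have "cmat x ** (E ** X) = E ** (cmat x ** X)" for X :: "complex^'n^'n"
      using E(2)[OF that] by (simp add: matrix_mul_assoc)
    then show ?thesis by (simp add: m_def cmat_mult mat_algebra E EX)
  qed
  have \<delta>_mult: "\<delta> (x ** a) = \<delta> x * \<delta> a" if "x \<in> G" for x a
    using m_mult[OF that] by (simp add: \<delta>_def det_mul)
  have \<delta>1: "\<delta> (mat 1) = 1" by (simp add: \<delta>_def m1 det_I)
  have \<delta>0: "\<delta> x \<noteq> 0" if "x \<in> G" for x
    using \<delta>_mult[OF that, of "matrix_inv x"] \<delta>1 matrix_inv_right[OF invertible_G[OF that]] by auto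
  have "linear (\<lambda>a. E ** cmat a ** E)"
    by (rule linearI) (simp_all add: cmat_linear mat_algebra flip: scl_of_real)
  then have bl: "bounded_linear (\<lambda>a. E ** cmat a ** E)" by (simp add: linear_conv_bounded_linear)
  have dm: "(m has_derivative (\<lambda>H. E ** cmat H ** E)) (at a)" for a
    unfolding m_def using bounded_linear_imp_has_derivative[OF bl] by (auto intro!: derivative_eq_intros)
  have "(det has_derivative trace) (at (m (mat 1)))" unfolding m1 by (rule has_derivative_det_mat_1)
  from has_derivative_compose[OF dm this]
  have "(\<delta> has_derivative (\<lambda>H. trace (E ** cmat H ** E))) (at (mat 1))" by (simp add: \<delta>_def)
  moreover have "trace (E ** cmat H ** E) = ctrace E H" for H
  proof -
    have "trace (E ** (cmat H ** E)) = trace ((cmat H ** E) ** E)" by (rule trace_mul_sym)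
    then show ?thesis by (simp add: ctrace_def mat_algebra E)
  qed
  ultimately have d\<delta>: "(\<delta> has_derivative ctrace E) (at (mat 1))" by simp
  have cont\<delta>: "isCont \<delta> a" for a
    unfolding \<delta>_def det_def
    by (intro continuous_intros bounded_linear.isCont[OF bounded_linear_vec_nth]
        has_derivative_continuous[OF dm])
  have "(\<delta> \<longlongrightarrow> \<delta> (mat 1)) (nhds (mat 1))"
    using cont\<delta>[of "mat 1"] unfolding isCont_def by (simp only: tendsto_at_iff_tendsto_nhds)
  then have ev: "\<forall>\<^sub>F a in nhds (mat 1). \<delta> a \<in> - {0}"
    by (rule topological_tendstoD) (auto simp: \<delta>1)
  then obtain S where S: "open S" "mat 1 \<in> S" "\<And>a. a \<in> S \<Longrightarrow> \<delta> a \<noteq> 0"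
    unfolding eventually_nhds by auto
  define F where "F = (\<lambda>a. log_power \<alpha> k (\<delta> a))"
  let ?D = "\<lambda>H. \<alpha> * of_real (Re (ctrace E H)) + of_nat k * ctrace E H"
  have "(log_power \<alpha> k has_derivative (\<lambda>h. \<alpha> * of_real (Re h) + of_nat k * h)) (at (\<delta> (mat 1)))"
    unfolding \<delta>1 by (rule has_derivative_log_power)
  from has_derivative_compose[OF d\<delta> this]
  have dF: "(F has_derivative ?D) (at (mat 1))" by (simp add: F_def)
  have "?D y = 0"
  proof (rule derivative_zero_along_closure_direction[where F = F, OF _ _ dF y])
    show "\<forall>\<^sub>F a in nhds (mat 1). isCont F a"
      using ev
    proof eventually_elim
      case (elim a)
      then show ?case unfolding F_def by (intro isCont_o2[OF cont\<delta> isCont_log_power]) simp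
    qed
    fix x assume x: "x \<in> G"
    have "((\<lambda>a. F x * F a) has_derivative (\<lambda>H. F x * ?D H)) (at (mat 1))"
      by (rule has_derivative_mult_right[OF dF])
    then have "((\<lambda>a. F (x ** a)) has_derivative (\<lambda>H. F x * ?D H)) (at (mat 1))"
    proof (rule has_derivative_transform_within_open[OF _ S(1,2)])
      show "F x * F a = F (x ** a)" if "a \<in> S" for a
        using S(3)[OF that] \<delta>0[OF x] by (simp add: F_def \<delta>_mult[OF x] log_power_mult)
    qed
    moreover have "\<forall>Z\<in>lie_alg. F x * ?D Z = 0" using Z by simp
    ultimately show "\<exists>D. ((\<lambda>a. F (x ** a)) has_derivative D) (at (mat 1)) \<and> (\<forall>Z\<in>lie_alg. D Z = 0)" by blast
  qed
  then show ?thesis .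
qed

end

section \<open>Closedness\<close>

locale irreducible_lie_subgroup = connected_lie_subgroup G T A
  for G :: "(real^'n^'n) set"
    and T :: "(real^'n^'n) topology"
    and A :: "(real^'n^'n, 'e::real_normed_vector) chart set" +
  assumes irr: "acts_irreducibly G"
begin

sublocale irreducible_matrix_group G
  by unfold_locales (use one_G mult_G inv_G invertible_G irr in auto)

text \<open>A direction \<open>y\<close> outside the Lie algebra \<open>g\<close> of \<open>G\<close> would span with it a Lie algebra \<open>h\<close> whose brackets
  all lie in \<open>[g, g]\<close>. Modulo \<open>[g, g]\<close> the element \<open>y\<close> is then central in \<open>h\<close>, so it is detected by the trace
  on the range of a projection \<open>E\<close> on which the centre acts by scalars. The traces of \<open>g\<close> form a proper
  subspace of the complex numbers, hence lie on a line, and the determinant on the range of \<open>E\<close> forces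
  the trace of \<open>y\<close> to lie on the same line.\<close>

theorem closure_direction_tangent:
  assumes y: "closure_direction y"
  shows "y \<in> lie_alg"
proof (rule ccontr)
  assume yL: "y \<notin> lie_alg"
  let ?d = "derived lie_alg"
  have dL: "?d \<subseteq> lie_alg" by (rule derived_subset[OF lie_subalgebra_lie_alg])
  have Add: "Ad x w \<in> ?d" if "x \<in> G" "w \<in> ?d" for x w
    by (rule Ad_derived[OF invertible_G[OF that(1)] Ad_lie_alg[OF that(1)] that(2)])
  have yX: "bracket y X \<in> ?d" if "X \<in> lie_alg" for X
    by (rule Ad_modulo_subspace(2)[OF subspace_derived Add _ y]) (use that bracket_in_derived in auto)
  define h where "h = span (insert y lie_alg)"
  have Lh: "lie_alg \<subseteq> h" "y \<in> h" by (auto simp: h_def span_base)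
  have hE: "\<exists>c. a - c *\<^sub>R y \<in> lie_alg" if "a \<in> h" for a
    using span_insert_subspaceE[OF subspace_lie_alg that[unfolded h_def]] by metis
  have br: "bracket a b \<in> ?d" if a: "a \<in> h" and b: "b \<in> h" for a b
  proof -
    obtain c where c: "a - c *\<^sub>R y \<in> lie_alg" using hE[OF a] ..
    obtain e where e: "b - e *\<^sub>R y \<in> lie_alg" using hE[OF b] ..
    have "bracket a b = bracket (a - c *\<^sub>R y) (b - e *\<^sub>R y)
        - e *\<^sub>R bracket y (a - c *\<^sub>R y) + c *\<^sub>R bracket y (b - e *\<^sub>R y)"
      by (simp add: mat_algebra algebra_simps)
    moreover have "bracket (a - c *\<^sub>R y) (b - e *\<^sub>R y) \<in> ?d" using c e by (rule bracket_in_derived)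
    ultimately show ?thesis
      using yX[OF c] yX[OF e] subspace_derived[of lie_alg]
      by (metis subspace_add subspace_diff subspace_scale)
  qed
  have dh: "derived h \<subseteq> ?d"
    unfolding derived_def[of h] by (rule span_minimal[OF _ subspace_derived]) (use br in auto)
  have lieh: "lie_subalgebra h"
    unfolding lie_subalgebra_def using br dL Lh by (auto simp: h_def)
  have Adh: "Ad x a \<in> h" if x: "x \<in> G" and a: "a \<in> h" for x a
  proof -
    obtain c where c: "a - c *\<^sub>R y \<in> lie_alg" using hE[OF a] ..
    have Zy: "bracket Z y \<in> ?d" if "Z \<in> lie_alg" for Z
    proof -
      have "bracket Z y = - bracket y Z" by simp
      then show ?thesis using yX[OF that] subspace_neg[OF subspace_derived] by metis
    qed
    have "Ad x y - y \<in> ?d"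
      by (rule Ad_modulo_subspace(1)[OF subspace_derived Add _ x]) (assumption | rule Zy)+
    then have "Ad x y - y \<in> h" "Ad x (a - c *\<^sub>R y) \<in> h"
      using dL Lh Ad_lie_alg[OF x c] by auto
    moreover have "Ad x a = Ad x (a - c *\<^sub>R y) + c *\<^sub>R (Ad x y - y) + c *\<^sub>R y"
      by (simp add: Ad_linear algebra_simps)
    ultimately show ?thesis using Lh(2) unfolding h_def
      by (metis span_add span_scale)
  qed
  \<comment> \<open>the centre of \<open>h\<close>\<close>
  define C where "C = {z \<in> h. \<forall>b\<in>h. bracket z b = 0}"
  have split: "\<exists>w\<in>?d. a - w \<in> C" if a: "a \<in> h" for a
  proof -
    obtain w where w: "w \<in> derived h" "\<And>b. b \<in> h \<Longrightarrow> bracket (a - w) b = 0"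
      using reductive_decomposition[OF lieh Adh a] by blast
    have "w \<in> ?d" using w(1) dh by blast
    moreover have "a - w \<in> h" using a \<open>w \<in> ?d\<close> dL Lh unfolding h_def by (intro span_diff) auto
    ultimately show ?thesis using w(2) unfolding C_def by blast
  qed
  have Ccomm: "C \<subseteq> commutant"
  proof
    fix z assume z: "z \<in> C"
    have "z ** x = x ** z" if x: "x \<in> G" for x
    proof -
      have "Ad x z - z \<in> {0}"
      proof (rule Ad_modulo_subspace(1)[OF _ _ _ x])
        show "bracket Z z \<in> {0}" if "Z \<in> lie_alg" for Z using z Lh that by (auto simp: C_def)
      qed (auto simp: Ad_linear)
      then have "Ad x z = z" by simp
      then have "Ad x z ** x = z ** x" by simp
      then show ?thesis
        using matrix_inv_left[OF invertible_G[OF x]] by (simp add: Ad_def flip: matrix_mul_assoc)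
    qed
    then show "z \<in> commutant" by (simp add: commutant_def)
  qed
  have Cab: "a ** b = b ** a" if "a \<in> C" "b \<in> C" for a b
  proof -
    have "bracket a b = 0" using that unfolding C_def by blast
    then show ?thesis by simp
  qed
  obtain E where E: "E ** E = E" "\<And>g. g \<in> G \<Longrightarrow> E ** cmat g = cmat g ** E" "trace E \<noteq> 0"
    "\<And>a. a \<in> C \<Longrightarrow> \<exists>l. cmat a ** E = scl l E \<and> (a \<noteq> 0 \<longrightarrow> l \<noteq> 0)"
  proof (rule commuting_family_eigenprojection[OF Ccomm])
    show "a ** b = b ** a" if "a \<in> C" "b \<in> C" for a b by (rule Cab[OF that])
  qed (rule that)
  let ?t = "ctrace E"
  have lint: "linear ?t" by (rule linear_ctrace)
  have EL: "E ** cmat Z = cmat Z ** E" if Z: "Z \<in> lie_alg" for Z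
  proof -
    have "linear (\<lambda>M. E ** cmat M - cmat M ** E)"
      by (rule linearI) (simp_all add: cmat_linear mat_algebra flip: scl_of_real)
    then have "((\<lambda>M. E ** cmat M - cmat M ** E) has_derivative (\<lambda>M. E ** cmat M - cmat M ** E)) (at (mat 1))"
      by (intro bounded_linear_imp_has_derivative) (simp add: linear_conv_bounded_linear)
    from derivative_zero_on_tangent[OF this _ Z] E(2) show ?thesis by simp
  qed
  have td: "?t w = 0" if "w \<in> ?d" for w
    using that unfolding derived_def
  proof (induction w rule: span_induct_alt)
    case base
    show ?case by (rule linear_0[OF lint])
  next
    case (step c u v)
    then obtain a b where ab: "u = bracket a b" "a \<in> lie_alg" "b \<in> lie_alg" by blast
    have "?t u = trace (bracket (cmat a) (cmat b) ** E)"
      by (simp add: ab(1) ctrace_def cmat_linear cmat_mult)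
    also have "\<dots> = trace (cmat a ** bracket (cmat b) E)" by (rule trace_bracket_cyclic)
    also have "\<dots> = 0" using EL[OF ab(3)] by simp
    finally show ?case using step(2) by (simp add: linear_add[OF lint] linear_cmul[OF lint])
  qed
  define S where "S = ?t ` lie_alg"
  have S: "subspace S" unfolding S_def using lint subspace_lie_alg by (rule linear_subspace_image)
  \<comment> \<open>a coincidence of traces would give a central element of trace zero, and these vanish\<close>
  have "?t y \<notin> S"
  proof
    assume "?t y \<in> S"
    then obtain X where X: "X \<in> lie_alg" "?t y = ?t X" by (auto simp: S_def)
    obtain w where w: "w \<in> ?d" "y - w \<in> C" using split[OF Lh(2)] by blast
    obtain v where v: "v \<in> ?d" "X - v \<in> C" using split[of X] X(1) Lh(1) by blast
    define z where "z = (y - w) - (X - v)"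
    have "z \<in> C"
      using w(2) v(2) unfolding C_def z_def h_def
      by (auto intro: span_diff) (simp add: mat_algebra algebra_simps)
    then obtain l where l: "cmat z ** E = scl l E" "z \<noteq> 0 \<longrightarrow> l \<noteq> 0" using E(4) by blast
    have "?t z = 0" unfolding z_def by (simp add: linear_diff[OF lint] td w(1) v(1) X(2))
    then have "l * trace E = 0" by (simp add: ctrace_def l(1) trace_scl)
    then have "z = 0" using E(3) l(2) by auto
    then have "y = X - v + w" by (simp add: z_def algebra_simps)
    then show False
      using yL X(1) v(1) w(1) dL subspace_lie_alg by (auto intro!: subspace_add subspace_diff)
  qed
  then obtain c where c: "c \<in> S" "\<And>s. s \<in> S \<Longrightarrow> \<exists>r. s = r *\<^sub>R c"
    using proper_subspace_of_complex[OF S] by metis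
  obtain \<alpha> :: complex and k where k: "\<And>t. \<alpha> * of_real (Re t) + of_nat k * t = 0 \<longleftrightarrow> (\<exists>r. t = r *\<^sub>R c)"
    using log_power_with_kernel[of c] by blast
  have "\<alpha> * of_real (Re (?t y)) + of_nat k * ?t y = 0"
    by (rule ctrace_closure_direction[OF E(1,2) _ y]) (use k c(2) in \<open>auto simp: S_def\<close>)
  then obtain r where "?t y = r *\<^sub>R c" using k by blast
  then show False using \<open>?t y \<notin> S\<close> subspace_scale[OF S c(1)] by simp
qed

lemma closure_left_translate:
  assumes "x \<in> G" "a \<in> closure G"
  shows "x ** a \<in> closure G"
proof -
  have "(\<lambda>a. x ** a) ` closure G \<subseteq> closure G"
  proof (rule image_closure_subset)
    show "continuous_on (closure G) (\<lambda>a. x ** a)"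
      by (intro linear_continuous_on bounded_linear_mat_mul_left)
    show "(\<lambda>a. x ** a) ` G \<subseteq> closure G" using mult_G[OF assms(1)] closure_subset by blast
  qed simp
  then show ?thesis using assms(2) by blast
qed

text \<open>Otherwise some points of the closure near the identity lie off \<open>G\<close>. Moving them into the
  transversal by an element of \<open>G\<close> gives points \<open>1 + Y k\<close> of the closure with \<open>Y k\<close> nonzero in the kernel
  of \<open>P\<close>, and a limit of their directions lies in this kernel, too, but not in the Lie algebra.\<close>

lemma locally_closed_at_one: "\<exists>\<delta>>0. \<forall>a\<in>closure G. dist a (mat 1) < \<delta> \<longrightarrow> a \<in> G"
proof (rule ccontr)
  assume neg: "\<not> ?thesis"
  obtain P where P: "linear P" "\<And>X. P X \<in> lie_alg" "\<And>Z. Z \<in> lie_alg \<Longrightarrow> P Z = Z"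
    "\<And>\<epsilon>. \<epsilon> > 0 \<Longrightarrow> \<exists>\<delta>>0. \<forall>a. dist a (mat 1) < \<delta> \<longrightarrow>
       (\<exists>x\<in>G. \<exists>Y. a = x ** (mat 1 + Y) \<and> P Y = 0 \<and> norm Y < \<epsilon>)"
    by (rule transversal_slice) (rule that)
  have "\<exists>Y. P Y = 0 \<and> Y \<noteq> 0 \<and> norm Y < inverse (real (Suc k)) \<and> mat 1 + Y \<in> closure G" for k
  proof -
    obtain \<delta> where d: "\<delta> > 0" "\<And>a :: real^'n^'n. dist a (mat 1) < \<delta> \<Longrightarrow>
        \<exists>x\<in>G. \<exists>Y. a = x ** (mat 1 + Y) \<and> P Y = 0 \<and> norm Y < inverse (real (Suc k))"
      using P(4)[of "inverse (real (Suc k))"] by auto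
    obtain a where a: "a \<in> closure G" "dist a (mat 1) < \<delta>" "a \<notin> G"
      using neg d(1) by blast
    obtain x Y where x: "x \<in> G" "a = x ** (mat 1 + Y)" "P Y = 0" "norm Y < inverse (real (Suc k))"
      using d(2)[OF a(2)] by blast
    have "Y \<noteq> 0" using a(3) x(1,2) by auto
    moreover have "matrix_inv x ** a = mat 1 + Y"
      unfolding x(2) matrix_mul_assoc matrix_inv_left[OF invertible_G[OF x(1)]] by simp
    then have "mat 1 + Y \<in> closure G"
      using closure_left_translate[OF inv_G[OF x(1)] a(1)] by simp
    ultimately show ?thesis using x by blast
  qed
  then obtain Y where Y: "\<And>k. P (Y k) = 0" "\<And>k. Y k \<noteq> 0" "\<And>k. norm (Y k) < inverse (real (Suc k))"
    "\<And>k. mat 1 + Y k \<in> closure G" by metis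
  have "Y \<longlonglongrightarrow> 0"
    by (rule Lim_null_comparison[OF _ LIMSEQ_inverse_real_of_nat]) (intro always_eventually allI less_imp_le Y(3))
  define u where "u = (\<lambda>k. Y k /\<^sub>R norm (Y k))"
  have "u k \<in> sphere 0 1" for k using Y(2) by (simp add: u_def)
  then obtain y r where y: "y \<in> sphere 0 1" "strict_mono r" "(u \<circ> r) \<longlonglongrightarrow> y"
    using compact_sphere[of "0 :: real^'n^'n" 1] unfolding compact_def by metis
  have "closure_direction y"
    unfolding closure_direction_def
  proof (intro exI[of _ "Y \<circ> r"] conjI allI)
    show "(Y \<circ> r) \<longlonglongrightarrow> 0" by (rule LIMSEQ_subseq_LIMSEQ[OF \<open>Y \<longlonglongrightarrow> 0\<close> y(2)])
    show "(\<lambda>k. (Y \<circ> r) k /\<^sub>R norm ((Y \<circ> r) k)) \<longlonglongrightarrow> y" using y(3) by (simp add: u_def comp_def)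
  qed (use Y in auto)
  then have "P y = y" using P(3) closure_direction_tangent by blast
  have "bounded_linear P" using P(1) by (simp add: linear_conv_bounded_linear)
  from bounded_linear.tendsto[OF this y(3)] have "(\<lambda>k. P ((u \<circ> r) k)) \<longlonglongrightarrow> P y" .
  moreover have "P ((u \<circ> r) k) = 0" for k by (simp add: u_def linear_cmul[OF P(1)] Y(1))
  ultimately have "P y = 0" by (simp add: LIMSEQ_const_iff)
  then show False using \<open>P y = y\<close> y(1) by simp
qed

text \<open>Translate a point of the closure close to the identity by the inverse of a nearby element of \<open>G\<close>.\<close>

theorem closed_in_GL: "closedin GL_topology G"
proof -
  obtain \<delta> where d: "\<delta> > 0" "\<And>a. a \<in> closure G \<Longrightarrow> dist a (mat 1) < \<delta> \<Longrightarrow> a \<in> G"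
    using locally_closed_at_one by blast
  have "a \<in> G" if a: "a \<in> carrier GL" "a \<in> closure G" for a
  proof -
    have inv: "invertible a" using a(1) by (simp add: GL_def)
    obtain g where g: "\<And>n. g n \<in> G" "g \<longlonglongrightarrow> a"
      using a(2) unfolding closure_sequential by blast
    have "(\<lambda>n. matrix_inv (g n)) \<longlonglongrightarrow> matrix_inv a"
      by (rule isCont_tendsto_compose[OF isCont_matrix_inv[OF inv] g(2)])
    then have "(\<lambda>n. matrix_inv (g n) ** a) \<longlonglongrightarrow> matrix_inv a ** a"
      by (rule bounded_linear.tendsto[OF bounded_linear_mat_mul_right])
    then have "(\<lambda>n. matrix_inv (g n) ** a) \<longlonglongrightarrow> mat 1" by (simp only: matrix_inv_left[OF inv])
    from tendstoD[OF this d(1)] obtain n where n: "dist (matrix_inv (g n) ** a) (mat 1) < \<delta>"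
      unfolding eventually_sequentially by blast
    have "matrix_inv (g n) ** a \<in> G"
      by (rule d(2)[OF closure_left_translate[OF inv_G[OF g(1)] a(2)] n])
    then have "g n ** (matrix_inv (g n) ** a) \<in> G" by (rule mult_G[OF g(1)])
    then show "a \<in> G" by (simp add: matrix_mul_assoc matrix_inv_right[OF invertible_G[OF g(1)]])
  qed
  then have "G = carrier GL \<inter> closure G"
    using subgroup.subset[OF subgroup_G] closure_subset by blast
  then show ?thesis
    unfolding GL_topology_def using closedin_closed_Int[of "closure G" "carrier GL"] by simp
qed

end

theorem theorem1:
  fixes G :: "(real^'n^'n) set"
    and T :: "(real^'n^'n) topology"
    and A :: "(real^'n^'n, 'e::real_normed_vector) chart set"
  assumes "lie_subgroup_GL G T A"
    and "connected_space T"
    and "acts_irreducibly G"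
  shows "closedin GL_topology G"
proof -
  interpret irreducible_lie_subgroup G T A by unfold_locales (fact assms)+
  show ?thesis by (rule closed_in_GL)
qed

end
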